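(* For each $g\in\mathbb N$ define $$H_g=\frac{1}{2^g}\,\frac{1}{g+1}\,\bigl(\Delta_{B_g}\bigr)^2\sum_{e\in\mathcal E_{2g+2}}\frac{-1}{\psi_e}$$ (a polynomial in $a_1,\dots,a_{2g+2}$). Then: (1) $H_1=\Delta_{B_1}\Delta_{U_1}\Delta_{U'_1}$; (2) $H_g\in\mathcal B^8_g$; (3) for all $g_1,g_2\in\mathbb N$ with $g_1+g_2=g$, $W_{g_1,g_2}H_g=H_{g_1}\otimes H_{g_2}$; (4) $\sum_{\sigma\in S_{2g+2}}\sigma(H_g)=0$, where $S_{2g+2}$ is the full symmetric group; (5) $\Phi_{ij}H_g=0$ for all distinct $i,j\in B_g$.
   Context: $\mathbb N=\{1,2,\dots\}$. For $r\in\mathbb N$ and an integer $w\ge0$, $S_w(r)$ is the set of polynomials $f\in\mathbb C[a_1,\dots,a_r]$ such that for every $\begin{pmatrix}A&B\\C&D\end{pmatrix}\in SL_2(\mathbb R)$, with $\gamma(z)=\frac{Az+B}{Cz+D}$, $f(a_1,\dots,a_r)=f(\gamma(a_1),\dots,\gamma(a_r))\prod_{i=1}^r(Ca_i+D)^w$. A permutation $\sigma$ acts by $\sigma(f)(a_1,\dots,a_r)=f(a_{\sigma(1)},\dots,a_{\sigma(r)})$. The star map $*:\mathbb C[a_1,\dots,a_r]\to\mathbb C[a_1,\dots,a_{r-1}]$ sends $f$ to $f^*=*f$, the coefficient of the highest power of $a_r$ in $f$; $*\otimes*$ acts factorwise on tensor products. For a finite set $T$ of indices, $\Delta_T=\prod_{i,j\in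 T,\,i>j}(a_i-a_j)$. $B_g=\{1,\dots,2g+2\}$, $U_g=\{1,3,\dots,2g+1\}$, $U'_g=B_g\setminus U_g$. For a sequence $e=(e_1,\dots,e_r)$ of positive integers, $\psi'_e=\prod_{i=1}^{r-1}(a_{e_i}-a_{e_{i+1}})$ and $\psi_e=(a_{e_r}-a_{e_1})\psi'_e$. $\mathcal E_r$ is the set of permutations $(e_1,\dots,e_r)$ of $(1,\dots,r)$ with $e_i\equiv i\pmod 2$ for all $i$. For $r=r_1+r_2$ and $j\ge0$, $T^{(j)}_{r_1,r_2}(f)$ is the coefficient of $t^j$ in $f(a_1,\dots,a_{r_1},\alpha_1+t,\dots,\alpha_{r_2}+t)$, an element of $\mathbb C[a_1,\dots,a_{r_1}]\otimes\mathbb C[\alpha_1,\dots,\alpha_{r_2}]$, and $\nu_{r_1,r_2}(f)$ is the $t$-degree of that expression. $S_w(2g+2)_0$ is the set of $f\in S_w(2g+2)$ with $\nu_{2g_1+1,2g_2+1}(f)\le\frac wg(2g_1g_2+g_1+g_2)$ for all $g_1,g_2\in\mathbb N$ with $g_1+g_2=g$. $\mathcal S_U$ is the group of permutations $\sigma$ of $B_g$ with $\sigma(U_g)\in\{U_g,U'_g\}$. For even $k$, $\mathcal B^k_g=\{f\in S_{kg/2}(2g+2)_0:\sigma(f)=f\ \forall\sigma\in\mathcal S_U\}$. Witt map: for $g_1,g_2\in\mathbb N$, $g=g_1+g_2$, $j\ge0$ and $f\in S_{gj}(2g+2)_0$, $W_{g_1,g_2}(f)$ is the unique element of $S_{g_1j}(2g_1+2)\otimes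 S_{g_2j}(2g_2+2)$ (variables $a_1,\dots,a_{2g_1+2}$ and $\alpha_1,\dots,\alpha_{2g_2+2}$) with $( *\otimes* )W_{g_1,g_2}(f)=T^{(j(2g_1g_2+g_1+g_2))}_{2g_1+1,2g_2+1}(f)$ (it exists and is unique). For distinct $m,n\in B_g$ and $f\in S_{gj}(2g+2)$, $\Phi_{mn}f$ is obtained by setting $a_m=a_n=0$ in $f$, dividing by $(\prod_{\ell\ne m,n}a_\ell)^{j}$, and reindexing the remaining $2g$ variables in increasing order as $a_1,\dots,a_{2g}$. *)

theory Defs
  imports Complex_Main "HOL-Library.Poly_Mapping" "HOL-Combinatorics.Permutations"
    "HOL-Computational_Algebra.Polynomial" "HOL-Computational_Algebra.Polynomial_Factorial"
begin

text \<open>Complex polynomials with variables indexed by \<open>'v\<close>: finitely supported functions from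
  monomials (exponent vectors) to coefficients.\<close>

type_synonym 'v mpoly = "('v \<Rightarrow>\<^sub>0 nat) \<Rightarrow>\<^sub>0 complex"

definition Const :: "complex \<Rightarrow> 'v mpoly" where
  "Const c = Poly_Mapping.single 0 c"

definition Var :: "'v \<Rightarrow> 'v mpoly" where
  "Var v = Poly_Mapping.single (Poly_Mapping.single v 1) 1"

text \<open>Substitution of elements \<open>x v\<close> of a commutative \<open>\<complex>\<close>-algebra for the variables;
  \<open>c\<close> is the structure map of the algebra.\<close>

definition insertion :: "(complex \<Rightarrow> 'b) \<Rightarrow> ('v \<Rightarrow> 'b) \<Rightarrow> 'v mpoly \<Rightarrow> 'b::comm_ring_1" where
  "insertion c x f = (\<Sum>m\<in>Poly_Mapping.keys f. c (Poly_Mapping.lookup f m) *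
     (\<Prod>v\<in>Poly_Mapping.keys m. x v ^ Poly_Mapping.lookup m v))"

definition msubst :: "('v \<Rightarrow> 'u mpoly) \<Rightarrow> 'v mpoly \<Rightarrow> 'u mpoly" where
  "msubst x f = insertion Const x f"

definition polys :: "nat \<Rightarrow> nat mpoly set" where
  "polys r = {f. \<forall>m\<in>Poly_Mapping.keys f. Poly_Mapping.keys m \<subseteq> {1..r}}"

definition perm_act :: "(nat \<Rightarrow> nat) \<Rightarrow> nat mpoly \<Rightarrow> nat mpoly" where
  "perm_act \<sigma> f = msubst (\<lambda>i. Var (\<sigma> i)) f"

text \<open>The invariance condition is an identity in the field of rational functions.\<close>

definition Sw :: "nat \<Rightarrow> nat \<Rightarrow> nat mpoly set" where
  "Sw w r = {f \<in> polys r. \<forall>A B C D :: real. A * D - B * C = 1 \<longrightarrow>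
     (let k = (\<lambda>x :: real. to_fract (Const (complex_of_real x)));
          a = (\<lambda>i. to_fract (Var i))
      in to_fract f =
         insertion (\<lambda>c. to_fract (Const c)) (\<lambda>i. (k A * a i + k B) / (k C * a i + k D)) f
         * (\<Prod>i=1..r. (k C * a i + k D) ^ w))}"

text \<open>The coefficient of the highest power of \<open>a\<^sub>r\<close>, reading \<open>f\<close> as a univariate polynomial
  in \<open>a\<^sub>r\<close>.\<close>

definition star :: "nat \<Rightarrow> nat mpoly \<Rightarrow> nat mpoly" where
  "star r f = lead_coeff
     (insertion (\<lambda>c. [:Const c:]) (\<lambda>i. if i = r then [:0, 1:] else [:Var i:]) f)"

text \<open>\<open>\<complex>[a\<^sub>1,\<dots>] \<otimes> \<complex>[\<alpha>\<^sub>1,\<dots>]\<close> is the polynomial ring in the variables \<open>a\<^sub>i = Var (Inl i)\<close> and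
  \<open>\<alpha>\<^sub>i = Var (Inr i)\<close>.\<close>

type_synonym tpoly = "(nat + nat) mpoly"

definition tensor :: "nat mpoly \<Rightarrow> nat mpoly \<Rightarrow> tpoly" where
  "tensor f h = msubst (\<lambda>i. Var (Inl i)) f * msubst (\<lambda>i. Var (Inr i)) h"

definition Sw_tensor :: "nat \<Rightarrow> nat \<Rightarrow> nat \<Rightarrow> nat \<Rightarrow> tpoly set" where
  "Sw_tensor w1 r1 w2 r2 = {F. \<exists>(n::nat) u v. (\<forall>i<n. u i \<in> Sw w1 r1 \<and> v i \<in> Sw w2 r2) \<and>
     F = (\<Sum>i<n. tensor (u i) (v i))}"

text \<open>The star map is not additive on all polynomials, but it is linear on \<open>Sw w r\<close>, where it is
  the coefficient of \<open>a\<^sub>r\<^sup>w\<close>; hence \<open>* \<otimes> *\<close> is well defined on \<open>Sw w1 r1 \<otimes> Sw w2 r2\<close>.\<close>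

definition star_tensor :: "nat \<Rightarrow> nat \<Rightarrow> nat \<Rightarrow> nat \<Rightarrow> tpoly \<Rightarrow> tpoly" where
  "star_tensor w1 r1 w2 r2 F = (THE G. \<exists>(n::nat) u v.
     (\<forall>i<n. u i \<in> Sw w1 r1 \<and> v i \<in> Sw w2 r2) \<and>
     F = (\<Sum>i<n. tensor (u i) (v i)) \<and>
     G = (\<Sum>i<n. tensor (star r1 (u i)) (star r2 (v i))))"

text \<open>\<open>f(a\<^sub>1,\<dots>,a\<^bsub>r\<^sub>1\<^esub>, \<alpha>\<^sub>1 + t, \<alpha>\<^sub>2 + t, \<dots>)\<close> as a univariate polynomial in \<open>t\<close>.\<close>

definition translate :: "nat \<Rightarrow> nat mpoly \<Rightarrow> tpoly poly" where
  "translate r1 f = insertion (\<lambda>c. [:Const c:])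
     (\<lambda>i. if i \<le> r1 then [:Var (Inl i):] else [:Var (Inr (i - r1)), 1:]) f"

definition Tcoeff :: "nat \<Rightarrow> nat \<Rightarrow> nat mpoly \<Rightarrow> tpoly" where
  "Tcoeff j r1 f = coeff (translate r1 f) j"

definition nu :: "nat \<Rightarrow> nat mpoly \<Rightarrow> nat" where
  "nu r1 f = degree (translate r1 f)"

definition Sw0 :: "nat \<Rightarrow> nat \<Rightarrow> nat mpoly set" where
  "Sw0 w g = {f \<in> Sw w (2*g+2). \<forall>g1 g2. g1 \<ge> 1 \<longrightarrow> g2 \<ge> 1 \<longrightarrow> g1 + g2 = g \<longrightarrow>
     real (nu (2*g1+1) f) \<le> real w / real g * real (2*g1*g2 + g1 + g2)}"

text \<open>The Witt map on \<open>Sw0 (g * j) g\<close> with \<open>g = g1 + g2\<close>.\<close>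

definition witt :: "nat \<Rightarrow> nat \<Rightarrow> nat \<Rightarrow> nat mpoly \<Rightarrow> tpoly" where
  "witt g1 g2 j f = (THE F. F \<in> Sw_tensor (g1*j) (2*g1+2) (g2*j) (2*g2+2) \<and>
     star_tensor (g1*j) (2*g1+2) (g2*j) (2*g2+2) F =
       Tcoeff (j * (2*g1*g2 + g1 + g2)) (2*g1+1) f)"

definition Bset :: "nat \<Rightarrow> nat set" where
  "Bset g = {1..2*g+2}"

definition Uset :: "nat \<Rightarrow> nat set" where
  "Uset g = {i \<in> Bset g. odd i}"

definition Uset' :: "nat \<Rightarrow> nat set" where
  "Uset' g = Bset g - Uset g"

definition S_U :: "nat \<Rightarrow> (nat \<Rightarrow> nat) set" where
  "S_U g = {\<sigma>. \<sigma> permutes Bset g \<and> \<sigma> ` Uset g \<in> {Uset g, Uset' g}}"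

text \<open>Only meaningful for even \<open>k\<close>.\<close>

definition BB :: "nat \<Rightarrow> nat \<Rightarrow> nat mpoly set" where
  "BB k g = {f \<in> Sw0 (k * g div 2) g. \<forall>\<sigma>\<in>S_U g. perm_act \<sigma> f = f}"

text \<open>\<open>\<Phi>\<^bsub>mn\<^esub>\<close> on \<open>Sw (g * j) (2 * g + 2)\<close>; the remaining variable \<open>a\<^sub>i\<close> is renamed to \<open>a\<^sub>k\<close> with
  \<open>k\<close> the rank of \<open>i\<close> in \<open>Bset g - {m, n}\<close>.\<close>

definition Phi :: "nat \<Rightarrow> nat \<Rightarrow> nat \<Rightarrow> nat \<Rightarrow> nat mpoly \<Rightarrow> nat mpoly" where
  "Phi g j m n f =
     msubst (\<lambda>i. Var (card {l \<in> Bset g - {m, n}. l \<le> i}))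
       (THE q. q * (\<Prod>l\<in>Bset g - {m, n}. Var l) ^ j =
          msubst (\<lambda>i. if i \<in> {m, n} then 0 else Var i) f)"

definition Delta :: "nat set \<Rightarrow> nat mpoly" where
  "Delta X = (\<Prod>(i, j) \<in> {(i, j). i \<in> X \<and> j \<in> X \<and> i > j}. Var i - Var j)"

text \<open>A sequence \<open>(e\<^sub>1,\<dots>,e\<^sub>r)\<close> is a function on \<open>nat\<close> of which only the values at \<open>1,\<dots>,r\<close>
  matter.\<close>

definition psi' :: "nat \<Rightarrow> (nat \<Rightarrow> nat) \<Rightarrow> nat mpoly" where
  "psi' r e = (\<Prod>i=1..r-1. Var (e i) - Var (e (i+1)))"

definition psi :: "nat \<Rightarrow> (nat \<Rightarrow> nat) \<Rightarrow> nat mpoly" where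
  "psi r e = (Var (e r) - Var (e 1)) * psi' r e"

definition EE :: "nat \<Rightarrow> (nat \<Rightarrow> nat) set" where
  "EE r = {e. e permutes {1..r} \<and> (\<forall>i\<in>{1..r}. even (e i) \<longleftrightarrow> even i)}"

definition H_frac :: "nat \<Rightarrow> nat mpoly fract" where
  "H_frac g = 1 / 2 ^ g * (1 / of_nat (g+1)) * to_fract (Delta (Bset g)) ^ 2 *
     (\<Sum>e\<in>EE (2*g+2). - 1 / to_fract (psi (2*g+2) e))"

definition Hpoly :: "nat \<Rightarrow> nat mpoly" where
  "Hpoly g = (THE f. to_fract f = H_frac g)"

lemma Var_diff_nonzero: "u \<noteq> v \<Longrightarrow> Var u - Var v \<noteq> (0 :: 'v mpoly)"
proof
  assume "u \<noteq> v" and "Var u - Var v = (0 :: 'v mpoly)"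
  then have "Poly_Mapping.keys (Var u :: 'v mpoly) = Poly_Mapping.keys (Var v :: 'v mpoly)"
    by simp
  then have "Poly_Mapping.keys (Poly_Mapping.single u (1::nat)) =
      Poly_Mapping.keys (Poly_Mapping.single v (1::nat))"
    by (simp add: Var_def)
  with \<open>u \<noteq> v\<close> show False by simp
qed

lemma psi_eq_prod:
  assumes "r \<ge> 1"
  shows "psi r e = (\<Prod>i=1..r. Var (e i) - Var (e (if i = r then 1 else i + 1)))"
proof -
  have "{1..r} = insert r {1..r-1}" using assms by auto
  moreover have "r \<notin> {1..r-1}" using assms by auto
  moreover have "psi' r e = (\<Prod>i=1..r-1. Var (e i) - Var (e (if i = r then 1 else i + 1)))"
    unfolding psi'_def using assms by (intro prod.cong) auto
  ultimately show ?thesis by (simp add: psi_def)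
qed

lemma psi_nonzero_dvd:
  assumes g: "g \<ge> 1" and e: "e \<in> EE (2*g+2)"
  shows "psi (2*g+2) e \<noteq> 0" and "psi (2*g+2) e dvd Delta (Bset g) ^ 2"
proof -
  let ?r = "2*g+2" and ?d = "\<lambda>(i, j). Var i - Var j :: nat mpoly"
  let ?n = "\<lambda>i. if i = ?r then 1 else i + 1"
  let ?P = "{(i, j). i \<in> Bset g \<and> j \<in> Bset g \<and> i > j}"
  let ?Q = "{(i, j). i \<in> Bset g \<and> j \<in> Bset g \<and> j > i}"
  let ?E = "(\<lambda>i. (e i, e (?n i))) ` {1..?r}"
  have perm: "e permutes {1..?r}" using e by (simp add: EE_def)
  have inj: "inj e" by (rule permutes_inj[OF perm])
  have inE: "inj_on (\<lambda>i. (e i, e (?n i))) {1..?r}"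
    by (rule inj_onI) (simp add: inj_eq[OF inj])
  have "1 \<le> ?r" by simp
  then have psi: "psi ?r e = prod ?d ?E"
    unfolding psi_eq_prod[OF \<open>1 \<le> ?r\<close>] prod.reindex[OF inE] by (simp only: o_def split_conv)
  have sub: "?E \<subseteq> ?P \<union> ?Q"
  proof
    fix p assume "p \<in> ?E"
    then obtain i where i: "i \<in> {1..?r}" and p: "p = (e i, e (?n i))" by blast
    have n: "?n i \<in> {1..?r}" "?n i \<noteq> i" using i by auto
    have "e i \<in> {1..?r}" "e (?n i) \<in> {1..?r}"
      by (simp_all only: permutes_in_image[OF perm] i n(1))
    moreover have "e i \<noteq> e (?n i)" 
      using n(2)[symmetric] by (simp only: inj_eq[OF inj] not_False_eq_True)
    ultimately show "p \<in> ?P \<union> ?Q" unfolding p Bset_def by auto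
  qed
  have finB: "finite (Bset g \<times> Bset g)" by (simp add: Bset_def)
  have fin: "finite ?P" "finite ?Q"
    by (rule finite_subset[OF _ finB]; auto)+
  have "?d p \<noteq> 0" if "p \<in> ?P \<union> ?Q" for p
    using that Var_diff_nonzero[of "fst p" "snd p"] by (cases p) auto
  then show "psi ?r e \<noteq> 0"
    unfolding psi using sub by (subst prod_zero_iff) blast+
  have swap: "?Q = prod.swap ` ?P" by (auto simp: image_iff)
  have "prod ?d ?Q = (\<Prod>p\<in>?P. - ?d p)"
    unfolding swap by (subst prod.reindex) (auto intro!: prod.cong)
  also have "\<dots> = (\<Prod>p\<in>?P. - 1) * prod ?d ?P"
    by (subst prod.distrib[symmetric]) simp
  finally have "prod ?d ?Q dvd Delta (Bset g)"
    by (simp add: Delta_def flip: prod_constant) (cases "even (card ?P)"; simp)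
  moreover have "prod ?d (?P \<union> ?Q) = Delta (Bset g) * prod ?d ?Q"
    using fin by (subst prod.union_disjoint) (auto simp: Delta_def)
  ultimately have "prod ?d (?P \<union> ?Q) dvd Delta (Bset g) ^ 2"
    by (simp add: power2_eq_square)
  moreover have "prod ?d ?E dvd prod ?d (?P \<union> ?Q)"
    using fin sub by (intro prod_dvd_prod_subset) auto
  ultimately show "psi ?r e dvd Delta (Bset g) ^ 2"
    unfolding psi by (rule dvd_trans[rotated])
qed

lemma to_fract_Hpoly:
  assumes "g \<ge> 1"
  shows "to_fract (Hpoly g) = H_frac g"
proof -
  let ?c = "Const (1 / (2 ^ g * of_nat (g+1))) :: nat mpoly"
  have "\<forall>e\<in>EE (2*g+2). \<exists>q. Delta (Bset g) ^ 2 = psi (2*g+2) e * q"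
    using psi_nonzero_dvd[OF assms] unfolding dvd_def by blast
  then obtain q where q: "\<And>e. e \<in> EE (2*g+2) \<Longrightarrow> Delta (Bset g) ^ 2 = psi (2*g+2) e * q e"
    by metis
  have pow: "to_fract (x ^ n) = to_fract x ^ n" for x :: "nat mpoly" and n
    by (induction n) simp_all
  have of_nat: "to_fract (of_nat n) = of_nat n" for n :: nat
    by (induction n) simp_all
  have cancel: "p \<noteq> 0 \<Longrightarrow> x = p * y \<Longrightarrow> x * (- 1 / p) = - y" for x p y :: "'f::field"
    by simp
  have summand: "to_fract (Delta (Bset g)) ^ 2 * (- 1 / to_fract (psi (2*g+2) e)) = to_fract (- q e)"
    if e: "e \<in> EE (2*g+2)" for e
  proof -
    have "to_fract (psi (2*g+2) e) \<noteq> 0"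
      using psi_nonzero_dvd(1)[OF assms e] by simp
    moreover have "to_fract (Delta (Bset g)) ^ 2 = to_fract (psi (2*g+2) e) * to_fract (q e)"
      using q[OF e] by (simp only: pow[symmetric] to_fract_mult[symmetric])
    ultimately show ?thesis
      unfolding to_fract_uminus by (rule cancel)
  qed
  have Cn: "(of_nat n :: nat mpoly) = Const (of_nat n)" for n
    by (simp add: Const_def)
  have "(2 ^ g * of_nat (g+1) :: nat mpoly) * ?c = of_nat (2 ^ g * (g+1)) * ?c"
    by (simp only: of_nat_mult of_nat_power of_nat_numeral)
  also have "\<dots> = 1"
  proof -
    have "(of_nat (2 ^ g * (g+1)) :: complex) \<noteq> 0" by (simp only: of_nat_eq_0_iff) simp
    moreover have "(2 ^ g * of_nat (g+1) :: complex) = of_nat (2 ^ g * (g+1))"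
      by (simp only: of_nat_mult of_nat_power of_nat_numeral)
    ultimately have "of_nat (2 ^ g * (g+1)) * (1 / (2 ^ g * of_nat (g+1))) = (1 :: complex)"
      by simp
    then show ?thesis
      unfolding Cn Const_def mult_single by (simp only: add_0 single_one)
  qed
  finally have "to_fract ((2 ^ g * of_nat (g+1)) * ?c) = 1" by simp
  moreover have "to_fract (2 :: nat mpoly) = 2"
    using of_nat[of 2] by (simp only: of_nat_numeral)
  ultimately have c1: "(2 ^ g * of_nat (g+1)) * to_fract ?c = 1"
    by (simp only: to_fract_mult pow of_nat)
  have recip: "1 / x * (1 / y) = z" if "x * y * z = 1" for x y z :: "'f::field"
  proof -
    have "x \<noteq> 0" "y \<noteq> 0" using that by auto
    with that show ?thesis by (simp add: field_simps)
  qed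
  have c: "1 / 2 ^ g * (1 / of_nat (g+1)) = to_fract ?c"
    by (rule recip[OF c1])
  have "H_frac g = to_fract ?c *
      (\<Sum>e\<in>EE (2*g+2). to_fract (Delta (Bset g)) ^ 2 * (- 1 / to_fract (psi (2*g+2) e)))"
    unfolding H_frac_def c by (simp only: sum_distrib_left mult.assoc)
  also have "\<dots> = to_fract (?c * (\<Sum>e\<in>EE (2*g+2). - q e))"
    by (simp only: to_fract_mult to_fract_sum summand cong: sum.cong)
  finally have ex: "to_fract (?c * (\<Sum>e\<in>EE (2*g+2). - q e)) = H_frac g" by simp
  show ?thesis
    unfolding Hpoly_def
    by (rule theI, rule ex) (simp only: ex[symmetric] to_fract_eq_iff)
qed

end

theory Submission
  imports Defs
begin

text \<open>
  All identities are checked at real points with distinct nonzero coordinates, where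
  \<open>H\<^sub>g\<close> is given by its defining formula.

  Weight and symmetry are read off termwise. The sum over all permutations vanishes because
  \<open>\<Sum> 1/\<psi>\<^sub>\<tau>\<close> telescopes when one value is moved around the cycle of the others, and
  \<open>\<Phi>\<^bsub>ij\<^esub> H\<^sub>g = 0\<close> because already \<open>\<Delta>\<close> divides \<open>H\<^sub>g\<close>.

  For the Witt map, translate the last \<open>2g\<^sub>2+1\<close> variables by \<open>t \<rightarrow> \<infinity>\<close>. A cycle \<open>e\<close> changes between the two
  blocks of variables at least twice, and only the cycles that do so exactly twice contribute to the
  leading term. Such a cycle is a pair of paths, one in each block, up to \<open>g+1\<close> rotations, so the leading
  coefficient is a product of path sums. The case \<open>g\<^sub>2 = 0\<close> identifies each path sum with \<open>* H\<close>.
  Uniqueness holds since for \<open>f \<in> Sw w r\<close> the inversion \<open>z \<mapsto> -1/z\<close> turns \<open>* f\<close> into the restriction of \<open>f\<close>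
  to \<open>a\<^sub>r = 0\<close>, which by translation invariance determines \<open>f\<close>.
\<close>

subsection \<open>Substitution and evaluation\<close>

text \<open>The constants are forced by the leading term of the translation. The square of
  \<open>Delta\<close> contributes 2 (2 g1 + 1)(2 g2 + 1) powers of t and a contributing cycle takes
  away two, which leaves 4 (2 g1 g2 + g1 + g2): the exponent that the Witt map prescribes for weight
  4 g. Of the 2 g + 2 rotations of a cycle, g + 1 respect the parity condition, and 1/(g+1)
  compensates for them. The factor 1/2^g is multiplicative along g = g1 + g2 and is fixed by the
  case g = 1. The obstacle is that the maps involved are given by descriptions and by leading
  coefficients. \<open>star\<close> takes the leading coefficient whatever the degree, so a nonzero
  element of \<open>Sw w r\<close> must be shown to have degree exactly w in its last variable;
  \<open>star_tensor\<close> and \<open>witt\<close> denote something only once uniqueness is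
  known.\<close>

locale unital_hom =
  fixes h :: "'a::comm_ring_1 \<Rightarrow> 'b::comm_ring_1"
  assumes hom_one: "h 1 = 1"
    and hom_add: "h (a + b) = h a + h b"
    and hom_mult: "h (a * b) = h a * h b"
begin

lemma hom_zero: "h 0 = 0"
  using hom_add[of 0 0] by simp

lemma hom_uminus: "h (- a) = - h a"
  using hom_add[of "- a" a] by (simp add: hom_zero eq_neg_iff_add_eq_0)

lemma hom_diff: "h (a - b) = h a - h b"
  using hom_add[of a "- b"] by (simp add: hom_uminus)

lemma hom_sum: "h (sum f A) = (\<Sum>a\<in>A. h (f a))"
  by (induction A rule: infinite_finite_induct) (simp_all add: hom_zero hom_add)

lemma hom_prod: "h (prod f A) = (\<Prod>a\<in>A. h (f a))"
  by (induction A rule: infinite_finite_induct) (simp_all add: hom_one hom_mult)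

lemma hom_power: "h (a ^ n) = h a ^ n"
  by (induction n) (simp_all add: hom_one hom_mult)

lemma hom_of_nat: "h (of_nat n) = of_nat n"
  by (induction n) (simp_all add: hom_zero hom_one hom_add)

lemmas hom_simps = hom_zero hom_one hom_add hom_mult hom_uminus hom_diff hom_sum hom_prod hom_power

end

definition mon :: "('v \<Rightarrow> 'b::comm_ring_1) \<Rightarrow> ('v \<Rightarrow>\<^sub>0 nat) \<Rightarrow> 'b" where
  "mon x m = (\<Prod>v\<in>Poly_Mapping.keys m. x v ^ Poly_Mapping.lookup m v)"

lemma mon_superset:
  assumes "finite V" "Poly_Mapping.keys m \<subseteq> V"
  shows "mon x m = (\<Prod>v\<in>V. x v ^ Poly_Mapping.lookup m v)"
  unfolding mon_def using assms
  by (intro prod.mono_neutral_left) (auto simp: in_keys_iff)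

lemma mon_add: "mon x (m + n) = mon x m * mon x n"
proof -
  let ?V = "Poly_Mapping.keys m \<union> Poly_Mapping.keys n"
  have "Poly_Mapping.keys (m + n) \<subseteq> ?V" by (rule keys_add)
  then show ?thesis
    by (simp add: mon_superset[of ?V] lookup_add power_add prod.distrib)
qed

lemma insertion_superset:
  assumes "c 0 = 0" "finite A" "Poly_Mapping.keys f \<subseteq> A"
  shows "insertion c x f = (\<Sum>m\<in>A. c (Poly_Mapping.lookup f m) * mon x m)"
  unfolding insertion_def mon_def[symmetric] using assms
  by (intro sum.mono_neutral_left) (auto simp: in_keys_iff)

lemma insertion_single: "c 0 = 0 \<Longrightarrow> insertion c x (Poly_Mapping.single m a) = c a * mon x m"
  by (subst insertion_superset[of c "{m}"]) auto

lemma mpoly_eq_sum_single: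
  "f = (\<Sum>m\<in>Poly_Mapping.keys f. Poly_Mapping.single m (Poly_Mapping.lookup f m))"
proof (rule poly_mapping_eqI)
  fix k
  have "(\<Sum>m\<in>Poly_Mapping.keys f. Poly_Mapping.lookup f m when m = k)
      = (\<Sum>m\<in>Poly_Mapping.keys f. if m = k then Poly_Mapping.lookup f k else 0)"
    by (intro sum.cong) (auto simp: when_def)
  also have "\<dots> = Poly_Mapping.lookup f k"
    by (simp add: in_keys_iff)
  finally show "Poly_Mapping.lookup f k = Poly_Mapping.lookup
      (\<Sum>m\<in>Poly_Mapping.keys f. Poly_Mapping.single m (Poly_Mapping.lookup f m)) k"
    by (simp add: lookup_sum lookup_single)
qed

lemma mpoly_induct [case_names zero single_add]:
  assumes "P (0 :: 'v mpoly)"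
    and "\<And>m a f. P f \<Longrightarrow> P (Poly_Mapping.single m a + f)"
  shows "P f"
proof -
  have "P (\<Sum>m\<in>A. Poly_Mapping.single m (Poly_Mapping.lookup f m))" if "finite A" for A
    using that by (induction A) (simp_all add: assms)
  then show ?thesis by (subst mpoly_eq_sum_single) simp
qed

text \<open>Both sides of the multiplication law are additive in each factor, so two inductions
  reduce it to a pair of monomials, where it is \<open>mon_add\<close> together with
  multiplicativity of \<open>c\<close>.\<close>

lemma insertion_hom:
  assumes "unital_hom c"
  shows "unital_hom (insertion c x)"
proof -
  interpret c: unital_hom c by fact
  have add: "insertion c x (f + g) = insertion c x f + insertion c x g" for f g
  proof -
    let ?A = "Poly_Mapping.keys f \<union> Poly_Mapping.keys g"
    have "Poly_Mapping.keys (f + g) \<subseteq> ?A" by (rule keys_add)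
    then show ?thesis
      by (simp add: insertion_superset[of c ?A] c.hom_simps lookup_add ring_distribs sum.distrib)
  qed
  have zero: "insertion c x 0 = 0" by (simp add: insertion_def)
  have single: "insertion c x (Poly_Mapping.single m a * g)
      = insertion c x (Poly_Mapping.single m a) * insertion c x g" for m a g
  proof (induction g rule: mpoly_induct)
    case (single_add n b g)
    then show ?case
      by (simp add: ring_distribs add insertion_single c.hom_simps mult_single mon_add mult_ac)
  qed (simp add: zero)
  have mult: "insertion c x (f * g) = insertion c x f * insertion c x g" for f g
    by (induction f rule: mpoly_induct) (simp_all add: zero single ring_distribs add)
  have one: "insertion c x 1 = 1"
    using insertion_single[of c x 0 1] by (simp add: c.hom_simps mon_def)
  show ?thesis by unfold_locales (fact one add mult)+
qed

lemma insertion_Const: "unital_hom c \<Longrightarrow> insertion c x (Const a) = c a"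
  unfolding Const_def by (simp add: insertion_single unital_hom.hom_zero mon_def)

lemma insertion_Var: "unital_hom c \<Longrightarrow> insertion c x (Var v) = x v"
  unfolding Var_def by (simp add: insertion_single unital_hom.hom_simps mon_def)

lemma insertion_comp:
  assumes "unital_hom h"
  shows "h (insertion c x f) = insertion (\<lambda>a. h (c a)) (\<lambda>v. h (x v)) f"
  by (simp add: insertion_def unital_hom.hom_simps[OF assms])

lemma insertion_cong:
  assumes "\<And>m v. m \<in> Poly_Mapping.keys f \<Longrightarrow> v \<in> Poly_Mapping.keys m \<Longrightarrow> x v = y v"
  shows "insertion c x f = insertion c y f"
  unfolding insertion_def using assms by (intro sum.cong refl arg_cong2[of _ _ _ _ "(*)"] prod.cong) auto

lemma insertion_cong_polys:
  "f \<in> polys r \<Longrightarrow> (\<And>i. i \<in> {1..r} \<Longrightarrow> x i = y i) \<Longrightarrow> insertion c x f = insertion c y f"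
  by (rule insertion_cong) (unfold polys_def, blast)

lemma unital_hom_comp: "unital_hom h \<Longrightarrow> unital_hom k \<Longrightarrow> unital_hom (\<lambda>a. h (k a))"
  unfolding unital_hom_def by simp

lemma unital_hom_id: "unital_hom (\<lambda>a. a)"
  by unfold_locales simp_all

lemma unital_hom_Const: "unital_hom Const"
  by unfold_locales (simp_all add: Const_def mult_single single_add)

lemma unital_hom_poly: "unital_hom (\<lambda>p. poly p a)"
  by unfold_locales simp_all

lemma unital_hom_to_fract: "unital_hom to_fract"
  by unfold_locales simp_all

section \<open>Evaluation at complex points and vanishing at generic points\<close>

definition meval :: "('v \<Rightarrow> complex) \<Rightarrow> 'v mpoly \<Rightarrow> complex" where
  "meval x f = insertion (\<lambda>a. a) x f"

lemma unital_hom_meval: "unital_hom (meval x)"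
  unfolding meval_def[abs_def] by (intro insertion_hom unital_hom_id)

lemmas meval_simps [simp] = unital_hom.hom_simps[OF unital_hom_meval]

lemma meval_Const [simp]: "meval x (Const a) = a"
  by (simp add: meval_def insertion_Const unital_hom_id)

lemma meval_Var [simp]: "meval x (Var v) = x v"
  by (simp add: meval_def insertion_Var unital_hom_id)

lemma meval_msubst: "meval x (msubst s f) = meval (\<lambda>v. meval x (s v)) f"
  by (simp add: msubst_def insertion_comp[OF unital_hom_meval] meval_def[of _ f])

lemma meval_perm_act: "meval x (perm_act \<sigma> f) = meval (\<lambda>i. x (\<sigma> i)) f"
  by (simp add: perm_act_def meval_msubst)

lemma meval_tensor: "meval z (tensor f h) = meval (\<lambda>i. z (Inl i)) f * meval (\<lambda>i. z (Inr i)) h"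
  by (simp add: tensor_def meval_msubst)

lemma meval_poly_insertion:
  "meval x (poly (insertion (\<lambda>c. [:Const c:]) s f) (Const t)) = meval (\<lambda>v. meval x (poly (s v) (Const t))) f"
  using insertion_comp[where h = "\<lambda>p. meval x (poly p (Const t))" and c = "\<lambda>c. [:Const c:]",
      OF unital_hom_comp[OF unital_hom_meval unital_hom_poly]]
  by (simp add: meval_def[of _ f])

lemma poly_map_poly_meval: "poly (map_poly (meval x) p) t = meval x (poly p (Const t))"
  by (induction p) (simp_all add: map_poly_pCons)

text \<open>Positional notation: the weight \<open>L\<close> of the new variable exceeds every
  weight that members of \<open>K\<close> reach on the old ones, so division by \<open>L\<close>
  with remainder returns the exponent of \<open>u\<close> and the old weight.\<close>

lemma separating_weight:
  fixes K :: "('v \<Rightarrow> nat) set"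
  assumes "finite V" "finite K"
  shows "\<exists>d::'v \<Rightarrow> nat. \<forall>m\<in>K. \<forall>n\<in>K. (\<Sum>v\<in>V. m v * d v) = (\<Sum>v\<in>V. n v * d v) \<longrightarrow> (\<forall>v\<in>V. m v = n v)"
  using assms(1)
proof (induction V)
  case (insert u V)
  then obtain d where d: "\<And>m n. m \<in> K \<Longrightarrow> n \<in> K \<Longrightarrow> (\<Sum>v\<in>V. m v * d v) = (\<Sum>v\<in>V. n v * d v) \<Longrightarrow> \<forall>v\<in>V. m v = n v"
    by blast
  define W where "W = (\<lambda>m. \<Sum>v\<in>V. m v * d v)"
  define L where "L = Suc (Max (W ` K))"
  have L: "W m < L" if "m \<in> K" for m
    using that assms(2) by (simp add: L_def less_Suc_eq_le)
  let ?d = "d(u := L)"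
  have W': "(\<Sum>v\<in>insert u V. m v * ?d v) = m u * L + W m" for m
  proof -
    have "(\<Sum>v\<in>V. m v * ?d v) = W m"
      unfolding W_def using insert.hyps by (intro sum.cong) auto
    then show ?thesis using insert.hyps by simp
  qed
  show ?case
  proof (intro exI[of _ ?d] ballI impI)
    fix m n v assume mn: "m \<in> K" "n \<in> K" and v: "v \<in> insert u V"
      and "(\<Sum>v\<in>insert u V. m v * ?d v) = (\<Sum>v\<in>insert u V. n v * ?d v)"
    then have eq: "m u * L + W m = n u * L + W n" by (simp only: W')
    have "(m u * L + W m) div L = m u" "(n u * L + W n) div L = n u"
      using L[OF mn(1)] L[OF mn(2)] by simp_all
    with eq have u: "m u = n u" by simp
    with eq have "W m = W n" by simp
    with d[OF mn] have "\<forall>v\<in>V. m v = n v" by (simp add: W_def)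
    with u v show "m v = n v" by auto
  qed
qed simp

text \<open>Kronecker substitution: \<open>x v = t ^ d v\<close> with weights \<open>d\<close> that separate the monomials of \<open>f\<close>
  and the variables in \<open>V\<close>.\<close>

lemma mpoly_eq_0_generic:
  fixes f :: "'v mpoly"
  assumes V: "finite V"
    and zero: "\<And>x. (\<And>v. x v \<in> \<real>) \<Longrightarrow> (\<And>v. x v \<noteq> 0) \<Longrightarrow> inj_on x V \<Longrightarrow> meval x f = 0"
  shows "f = 0"
proof -
  define U where "U = V \<union> (\<Union>m\<in>Poly_Mapping.keys f. Poly_Mapping.keys m)"
  \<comment> \<open>The unit vectors stand for the variables in \<open>V\<close>; separating them
    makes \<open>d\<close> injective on \<open>V\<close>.\<close>
  define K where "K = Poly_Mapping.lookup ` Poly_Mapping.keys f \<union> (\<lambda>u v. if v = u then 1 else 0) ` V"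
  have "finite U" "finite K" using V by (auto simp: U_def K_def)
  from separating_weight[OF this] obtain d where
    d: "\<And>m n. m \<in> K \<Longrightarrow> n \<in> K \<Longrightarrow> (\<Sum>v\<in>U. m v * d v) = (\<Sum>v\<in>U. n v * d v) \<Longrightarrow> \<forall>v\<in>U. m v = n v"
    by blast
  have inj: "inj_on d V"
  proof (rule inj_onI)
    fix u w assume uw: "u \<in> V" "w \<in> V" "d u = d w"
    let ?e = "\<lambda>u v. if v = u then 1 else 0 :: nat"
    have "(\<Sum>v\<in>U. ?e u v * d v) = d u" "(\<Sum>v\<in>U. ?e w v * d v) = d w"
      using uw \<open>finite U\<close> by (simp_all add: if_distrib[of "\<lambda>a. a * _"] U_def cong: if_cong)
    moreover have "?e u \<in> K" "?e w \<in> K" using uw by (auto simp: K_def)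
    ultimately have "\<forall>v\<in>U. ?e u v = ?e w v" using uw by (intro d) simp_all
    with uw show "u = w" by (auto simp: U_def split: if_splits)
  qed
  define wt where "wt = (\<lambda>m. \<Sum>v\<in>U. Poly_Mapping.lookup m v * d v)"
  have wt_inj: "inj_on wt (Poly_Mapping.keys f)"
  proof (rule inj_onI)
    fix m n assume mn: "m \<in> Poly_Mapping.keys f" "n \<in> Poly_Mapping.keys f" and "wt m = wt n"
    then have eq: "\<forall>v\<in>U. Poly_Mapping.lookup m v = Poly_Mapping.lookup n v"
      by (intro d) (auto simp: K_def wt_def)
    show "m = n"
    proof (rule poly_mapping_eqI)
      fix v show "Poly_Mapping.lookup m v = Poly_Mapping.lookup n v"
      proof (cases "v \<in> U")
        case False
        then show ?thesis using mn by (auto simp: U_def in_keys_iff)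
      qed (use eq in auto)
    qed
  qed
  define p where "p = (\<Sum>m\<in>Poly_Mapping.keys f. monom (Poly_Mapping.lookup f m) (wt m))"
  have meval_p: "meval (\<lambda>v. t ^ d v) f = poly p t" for t
  proof -
    have "mon (\<lambda>v. t ^ d v) m = t ^ wt m" if "m \<in> Poly_Mapping.keys f" for m
      using that \<open>finite U\<close>
      by (subst mon_superset[of U]) (auto simp: U_def wt_def power_sum mult.commute simp flip: power_mult)
    then show ?thesis
      by (simp add: meval_def insertion_def p_def poly_sum poly_monom mon_def)
  qed
  \<comment> \<open>With a base of at least 2, distinct exponents give distinct nonzero coordinates,
    so the hypothesis applies at these points.\<close>
  have "poly p (of_nat (n + 2)) = 0" for n
  proof -
    let ?t = "of_nat (n + 2) :: complex"
    have "inj_on (\<lambda>v. ?t ^ d v) V"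
    proof (rule inj_onI)
      fix u w assume "u \<in> V" "w \<in> V" "?t ^ d u = ?t ^ d w"
      moreover from this(3) have "(n + 2) ^ d u = (n + 2) ^ d w"
        by (metis of_nat_eq_iff of_nat_power)
      then have "d u = d w" by (subst (asm) power_inject_exp) auto
      ultimately show "u = w" using inj by (auto dest: inj_onD)
    qed
    moreover have "?t \<noteq> 0" by (metis of_nat_eq_0_iff add_is_0 zero_neq_numeral)
    moreover have "?t \<in> \<real>" by simp
    ultimately show ?thesis
      unfolding meval_p[symmetric] by (intro zero) (auto intro: Reals_power)
  qed
  then have "range (\<lambda>n::nat. of_nat (n + 2) :: complex) \<subseteq> {t. poly p t = 0}" by auto
  moreover have "infinite (range (\<lambda>n::nat. of_nat (n + 2) :: complex))"
    by (rule range_inj_infinite) (simp add: inj_def)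
  ultimately have p: "p = 0" using poly_roots_finite[of p] finite_subset by blast
  have "Poly_Mapping.lookup f m = 0" if m: "m \<in> Poly_Mapping.keys f" for m
  proof -
    have "coeff p (wt m) = (\<Sum>n\<in>Poly_Mapping.keys f. if n = m then Poly_Mapping.lookup f n else 0)"
      unfolding p_def coeff_sum using wt_inj m by (intro sum.cong) (auto dest: inj_onD)
    then show ?thesis using p m by simp
  qed
  then show ?thesis by (intro poly_mapping_eqI) (metis in_keys_iff lookup_zero)
qed

lemma mpoly_eq_generic:
  fixes f h :: "'v mpoly"
  assumes "finite V"
    and "\<And>x. (\<And>v. x v \<in> \<real>) \<Longrightarrow> (\<And>v. x v \<noteq> 0) \<Longrightarrow> inj_on x V \<Longrightarrow> meval x f = meval x h"
  shows "f = h"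
  using mpoly_eq_0_generic[of V "f - h"] assms by simp

section \<open>Degrees and coefficients read off from limits along the natural numbers\<close>

lemma poly_over_power_tendsto:
  fixes p :: "complex poly"
  assumes "degree p \<le> d"
  shows "(\<lambda>n. poly p (of_nat n) / of_nat n ^ d) \<longlonglongrightarrow> coeff p d"
proof -
  have inv: "(\<lambda>n. 1 / of_nat n :: complex) \<longlonglongrightarrow> 0"
    using lim_inverse_n[where 'a=complex] by (simp add: inverse_eq_divide)
  have "(\<lambda>n. \<Sum>i\<le>d. coeff p i * (1 / of_nat n) ^ (d - i)) \<longlonglongrightarrow> (\<Sum>i\<le>d. coeff p i * 0 ^ (d - i))"
    by (intro tendsto_intros inv)
  moreover have "(\<Sum>i\<le>d. coeff p i * 0 ^ (d - i)) = (\<Sum>i\<le>d. if i = d then coeff p i else 0)"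
    by (intro sum.cong) (auto simp: power_0_left)
  moreover have "\<forall>\<^sub>F n in sequentially. (\<Sum>i\<le>d. coeff p i * (1 / of_nat n) ^ (d - i))
      = poly p (of_nat n) / of_nat n ^ d"
  proof (rule eventually_mono[OF eventually_gt_at_top[of 0]])
    fix n :: nat assume n: "n > 0"
    have "poly p (of_nat n) = (\<Sum>i\<le>d. coeff p i * of_nat n ^ i)"
      unfolding poly_altdef using assms
      by (intro sum.mono_neutral_left) (auto simp: coeff_eq_0)
    moreover have "coeff p i * of_nat n ^ i / of_nat n ^ d = coeff p i * (1 / of_nat n) ^ (d - i)"
      if "i \<le> d" for i
      using that n by (simp add: power_diff power_divide)
    ultimately show "(\<Sum>i\<le>d. coeff p i * (1 / of_nat n) ^ (d - i)) = poly p (of_nat n) / of_nat n ^ d"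
      by (simp add: sum_divide_distrib)
  qed
  ultimately show ?thesis by (simp add: tendsto_cong)
qed

text \<open>If the degree exceeded \<open>k\<close>, dividing further by
  \<open>n ^ (degree p - k)\<close> would send to 0 a sequence whose limit is the leading
  coefficient.\<close>

lemma poly_growth:
  fixes p :: "complex poly"
  assumes lim: "(\<lambda>n. poly p (of_nat n) / of_nat n ^ k) \<longlonglongrightarrow> L"
  shows "degree p \<le> k" and "coeff p k = L"
proof -
  show deg: "degree p \<le> k"
  proof (rule ccontr)
    assume *: "\<not> degree p \<le> k"
    have inv: "(\<lambda>n. 1 / of_nat n :: complex) \<longlonglongrightarrow> 0"
      using lim_inverse_n[where 'a=complex] by (simp add: inverse_eq_divide)
    have "(\<lambda>n. poly p (of_nat n) / of_nat n ^ k * (1 / of_nat n) ^ (degree p - k)) \<longlonglongrightarrow> L * 0 ^ (degree p - k)"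
      by (intro tendsto_intros lim inv)
    also have "L * 0 ^ (degree p - k) = 0" using * by simp
    finally have 1: "(\<lambda>n. poly p (of_nat n) / of_nat n ^ k * (1 / of_nat n) ^ (degree p - k)) \<longlonglongrightarrow> 0" .
    have "(\<lambda>n. poly p (of_nat n) / of_nat n ^ k * (1 / of_nat n) ^ (degree p - k))
        = (\<lambda>n. poly p (of_nat n) / of_nat n ^ degree p)"
    proof
      fix n
      have "(of_nat n :: complex) ^ degree p = of_nat n ^ k * of_nat n ^ (degree p - k)"
        using * by (simp flip: power_add)
      then show "poly p (of_nat n) / of_nat n ^ k * (1 / of_nat n) ^ (degree p - k)
        = poly p (of_nat n) / of_nat n ^ degree p"
        by (simp add: power_divide)
    qed
    with 1 poly_over_power_tendsto[of p "degree p"] have "lead_coeff p = 0"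
      using LIMSEQ_unique by fastforce
    with * show False by simp
  qed
  show "coeff p k = L" using LIMSEQ_unique[OF poly_over_power_tendsto[OF deg] lim] .
qed

text \<open>Each coefficient of \<open>P\<close> beyond \<open>k\<close> vanishes at all generic
  points and hence is 0, so pointwise limits bound the degree of \<open>P\<close> itself.\<close>

lemma poly_growth_meval:
  fixes P :: "'v mpoly poly"
  assumes "finite V"
    and "\<And>x. (\<And>v. x v \<in> \<real>) \<Longrightarrow> (\<And>v. x v \<noteq> 0) \<Longrightarrow> inj_on x V \<Longrightarrow>
      (\<lambda>n. meval x (poly P (Const (of_nat n))) / of_nat n ^ k) \<longlonglongrightarrow> L x"
  shows "degree P \<le> k"
    and "(\<And>v. x v \<in> \<real>) \<Longrightarrow> (\<And>v. x v \<noteq> 0) \<Longrightarrow> inj_on x V \<Longrightarrow> meval x (coeff P k) = L x"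
proof -
  have *: "degree (map_poly (meval x) P) \<le> k" "coeff (map_poly (meval x) P) k = L x"
    if "\<And>v. x v \<in> \<real>" "\<And>v. x v \<noteq> 0" "inj_on x V" for x
    using poly_growth[of "map_poly (meval x) P" k "L x"] assms(2)[OF that]
    by (simp_all add: poly_map_poly_meval)
  show "degree P \<le> k"
  proof (rule degree_le, intro allI impI)
    fix i assume i: "k < i"
    show "coeff P i = 0"
    proof (rule mpoly_eq_0_generic[OF assms(1)])
      fix x :: "'v \<Rightarrow> complex" assume "\<And>v. x v \<in> \<real>" "\<And>v. x v \<noteq> 0" "inj_on x V"
      from *(1)[OF this] i have "coeff (map_poly (meval x) P) i = 0" by (simp add: coeff_eq_0)
      then show "meval x (coeff P i) = 0" by (simp add: coeff_map_poly)
    qed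
  qed
  show "meval x (coeff P k) = L x" if "\<And>v. x v \<in> \<real>" "\<And>v. x v \<noteq> 0" "inj_on x V"
    using *(2)[OF that] by (simp add: coeff_map_poly)
qed

subsection \<open>The polynomial \<open>H\<^sub>g\<close> and its values\<close>

lemma insertion_Const_Var: "insertion Const Var f = f"
proof (rule mpoly_eq_generic[of "{}"])
  fix x show "meval x (insertion Const Var f) = meval x f"
    using meval_msubst[of x Var f] by (simp add: msubst_def)
qed simp

lemma insertion_to_fract:
  "insertion (\<lambda>c. to_fract (Const c)) (\<lambda>v. to_fract (Var v)) f = to_fract f"
  using insertion_comp[OF unital_hom_to_fract, of Const Var f] by (simp add: insertion_Const_Var)

lemma polys_Const: "Const a \<in> polys r"
  by (simp add: polys_def Const_def)

lemma polys_Var: "i \<in> {1..r} \<Longrightarrow> Var i \<in> polys r"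
  by (simp add: polys_def Var_def)

lemma polys_add: "f \<in> polys r \<Longrightarrow> h \<in> polys r \<Longrightarrow> f + h \<in> polys r"
  unfolding polys_def using keys_add[of f h] by blast

lemma polys_mult: "f \<in> polys r \<Longrightarrow> h \<in> polys r \<Longrightarrow> f * h \<in> polys r"
  unfolding polys_def using keys_mult[of f h] keys_add[where ?'a=nat and ?'b=nat] by blast

lemma polys_uminus: "f \<in> polys r \<Longrightarrow> - f \<in> polys r"
  by (simp add: polys_def)

lemma polys_diff: "f \<in> polys r \<Longrightarrow> h \<in> polys r \<Longrightarrow> f - h \<in> polys r"
  using polys_add[of f r "- h"] polys_uminus[of h r] by simp

lemma polys_one: "1 \<in> polys r"
  using polys_Const[of 1] by (simp add: Const_def)

lemma polys_sum: "(\<And>a. a \<in> A \<Longrightarrow> f a \<in> polys r) \<Longrightarrow> sum f A \<in> polys r"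
proof (induction A rule: infinite_finite_induct)
  case (insert a A) then show ?case by (simp add: polys_add)
qed (simp_all add: polys_def)

lemma polys_prod: "(\<And>a. a \<in> A \<Longrightarrow> f a \<in> polys r) \<Longrightarrow> prod f A \<in> polys r"
proof (induction A rule: infinite_finite_induct)
  case (insert a A) then show ?case by (simp add: polys_mult)
qed (simp_all add: polys_one)

text \<open>Treating the closing difference as the edge from position \<open>r\<close> to position 1
  makes \<open>psi\<close> a single product over the cycle, which can be reindexed by
  rotation.\<close>

definition cyc_next :: "nat \<Rightarrow> nat \<Rightarrow> nat" where
  "cyc_next r i = (if i = r then 1 else i + 1)"

definition psi_at :: "nat \<Rightarrow> (nat \<Rightarrow> nat) \<Rightarrow> (nat \<Rightarrow> 'k::comm_ring_1) \<Rightarrow> 'k" where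
  "psi_at r e x = (\<Prod>i=1..r. x (e i) - x (e (cyc_next r i)))"

definition psi'_at :: "nat \<Rightarrow> (nat \<Rightarrow> nat) \<Rightarrow> (nat \<Rightarrow> 'k::comm_ring_1) \<Rightarrow> 'k" where
  "psi'_at r e x = (\<Prod>i=1..r-1. x (e i) - x (e (i+1)))"

definition pairs :: "nat set \<Rightarrow> (nat \<times> nat) set" where
  "pairs X = {(i, j). i \<in> X \<and> j \<in> X \<and> i > j}"

definition Delta_at :: "nat set \<Rightarrow> (nat \<Rightarrow> 'k::comm_ring_1) \<Rightarrow> 'k" where
  "Delta_at X x = (\<Prod>(i, j)\<in>pairs X. x i - x j)"

text \<open>The field is arbitrary because the formula is used both at complex points and at the
  generic point of the field of rational functions. A vanishing \<open>psi_at\<close> would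
  contribute 0 by the convention for division, so agreement with \<open>Hpoly g\<close> is claimed
  only at points with distinct coordinates.\<close>

definition H_at :: "nat \<Rightarrow> (nat \<Rightarrow> 'k::field) \<Rightarrow> 'k" where
  "H_at g x = 1 / 2 ^ g * (1 / of_nat (g+1)) * Delta_at (Bset g) x ^ 2 *
     (\<Sum>e\<in>EE (2*g+2). - 1 / psi_at (2*g+2) e x)"

lemma finite_pairs: "finite X \<Longrightarrow> finite (pairs X)"
  by (rule finite_subset[of _ "X \<times> X"]) (auto simp: pairs_def)

lemma psi_at_eq: "r \<ge> 1 \<Longrightarrow> psi_at r e x = (x (e r) - x (e 1)) * psi'_at r e x"
proof -
  assume r: "r \<ge> 1"
  then have "{1..r} = insert r {1..r-1}" "r \<notin> {1..r-1}" by auto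
  moreover have "psi'_at r e x = (\<Prod>i=1..r-1. x (e i) - x (e (cyc_next r i)))"
    unfolding psi'_at_def using r by (intro prod.cong) (auto simp: cyc_next_def)
  ultimately show ?thesis by (simp add: psi_at_def cyc_next_def)
qed

context
  fixes c :: "complex \<Rightarrow> 'k::comm_ring_1" and x :: "nat \<Rightarrow> 'k"
  assumes c: "unital_hom c"
begin

interpretation i: unital_hom "insertion c x" by (rule insertion_hom[OF c])

lemma insertion_psi': "insertion c x (psi' r e) = psi'_at r e x"
  by (simp add: psi'_def psi'_at_def i.hom_simps insertion_Var[OF c])

lemma insertion_psi: "r \<ge> 1 \<Longrightarrow> insertion c x (psi r e) = psi_at r e x"
  by (simp add: psi_def psi_at_eq i.hom_simps insertion_Var[OF c] insertion_psi')

lemma insertion_Delta: "insertion c x (Delta X) = Delta_at X x"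
  by (simp add: Delta_def Delta_at_def pairs_def i.hom_simps insertion_Var[OF c] case_prod_unfold)

end

lemma cyc_next_in: "i \<in> {1..r} \<Longrightarrow> cyc_next r i \<in> {1..r}"
  by (auto simp: cyc_next_def)

lemma psi_at_nonzero:
  fixes x :: "nat \<Rightarrow> 'k::idom"
  assumes "e permutes {1..r}" "inj_on x {1..r}" "r \<ge> 2"
  shows "psi_at r e x \<noteq> 0"
proof -
  have "x (e i) \<noteq> x (e (cyc_next r i))" if i: "i \<in> {1..r}" for i
  proof
    assume "x (e i) = x (e (cyc_next r i))"
    moreover have "e i \<in> {1..r}" "e (cyc_next r i) \<in> {1..r}"
      using i cyc_next_in[OF i] by (simp_all only: permutes_in_image[OF assms(1)])
    ultimately have "e i = e (cyc_next r i)" using assms(2) by (auto dest: inj_onD)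
    then have "i = cyc_next r i" using permutes_inj[OF assms(1)] by (auto dest: injD)
    with assms(3) show False by (auto simp: cyc_next_def split: if_splits)
  qed
  then show ?thesis by (simp add: psi_at_def)
qed

text \<open>For \<open>r \<ge> 3\<close> the edges of the cycle \<open>e\<close> are distinct unordered pairs.\<close>

lemma psi_dvd_Delta:
  assumes r: "r \<ge> 3" and e: "e permutes {1..r}"
  shows "\<exists>q\<in>polys r. Delta {1..r} = psi r e * q"
proof -
  define s where "s = (\<lambda>i. if e i > e (cyc_next r i) then 1 else - 1 :: nat mpoly)"
  define ed where "ed = (\<lambda>i. (max (e i) (e (cyc_next r i)), min (e i) (e (cyc_next r i))))"
  let ?d = "\<lambda>(i, j). Var i - Var j :: nat mpoly"
  have inj: "inj e" by (rule permutes_inj[OF e])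
  have e_in: "e i \<in> {1..r} \<longleftrightarrow> i \<in> {1..r}" for i by (rule permutes_in_image[OF e])
  have inj_ed: "inj_on ed {1..r}"
  proof (rule inj_onI)
    fix i j assume ij: "i \<in> {1..r}" "j \<in> {1..r}" "ed i = ed j"
    then have "{e i, e (cyc_next r i)} = {e j, e (cyc_next r j)}"
      by (auto simp: ed_def max_def min_def split: if_splits)
    \<comment> \<open>The second alternative would close the cycle after two steps, which
      \<open>r \<ge> 3\<close> excludes.\<close>
    then have "i = j \<or> i = cyc_next r j \<and> j = cyc_next r i"
      by (auto simp: doubleton_eq_iff inj_eq[OF inj])
    with r ij show "i = j" by (auto simp: cyc_next_def split: if_splits)
  qed
  have sub: "ed ` {1..r} \<subseteq> pairs {1..r}"
  proof
    fix p assume "p \<in> ed ` {1..r}"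
    then obtain i where i: "i \<in> {1..r}" "p = ed i" by blast
    then have "e i \<in> {1..r}" "e (cyc_next r i) \<in> {1..r}" using cyc_next_in[OF i(1)] by (simp_all only: e_in)
    moreover have "e i \<noteq> e (cyc_next r i)" using r i by (auto simp: inj_eq[OF inj] cyc_next_def)
    ultimately show "p \<in> pairs {1..r}" by (auto simp: i pairs_def ed_def max_def min_def)
  qed
  have fin: "finite (pairs {1..r})" by (simp add: finite_pairs)
  have "?d p \<in> polys r" if "p \<in> pairs {1..r}" for p
    using that by (auto simp: pairs_def intro!: polys_diff polys_Var)
  then have q: "(\<Prod>i=1..r. s i) * prod ?d (pairs {1..r} - ed ` {1..r}) \<in> polys r"
    by (intro polys_mult polys_prod) (auto simp: s_def polys_one polys_uminus)
  have "psi r e = (\<Prod>i=1..r. Var (e i) - Var (e (cyc_next r i)))"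
    using r by (simp add: psi_eq_prod cyc_next_def)
  also have "\<dots> = (\<Prod>i=1..r. s i * ?d (ed i))"
    by (intro prod.cong) (auto simp: s_def ed_def max_def min_def)
  also have "\<dots> = (\<Prod>i=1..r. s i) * prod ?d (ed ` {1..r})"
    by (simp only: prod.distrib prod.reindex[OF inj_ed] o_def)
  finally have "psi r e * ((\<Prod>i=1..r. s i) * prod ?d (pairs {1..r} - ed ` {1..r}))
    = ((\<Prod>i=1..r. s i) * (\<Prod>i=1..r. s i)) * (prod ?d (pairs {1..r} - ed ` {1..r}) * prod ?d (ed ` {1..r}))"
    by (simp add: mult_ac)
  also have "prod ?d (pairs {1..r} - ed ` {1..r}) * prod ?d (ed ` {1..r}) = Delta {1..r}"
    using prod.subset_diff[OF sub fin, of ?d] by (simp add: Delta_def pairs_def)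
  also have "(\<Prod>i=1..r. s i) * (\<Prod>i=1..r. s i) = 1"
    unfolding prod.distrib[symmetric] by (intro prod.neutral) (simp add: s_def)
  finally have "Delta {1..r} = psi r e * ((\<Prod>i=1..r. s i) * prod ?d (pairs {1..r} - ed ` {1..r}))"
    by (simp only: mult_1)
  then show ?thesis using q by (rule bexI)
qed

text \<open>One of the two factors \<open>Delta\<close> already clears all denominators, and the
  other stays visible as a factor of \<open>Hpoly g\<close>. Polynomiality, divisibility and all
  values are drawn from this form.\<close>

lemma Hpoly_decomp:
  assumes g: "g \<ge> 1"
  obtains q where "\<And>e. e \<in> EE (2*g+2) \<Longrightarrow> q e \<in> polys (2*g+2)"
    and "\<And>e. e \<in> EE (2*g+2) \<Longrightarrow> Delta (Bset g) = psi (2*g+2) e * q e"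
    and "Hpoly g = Const (1 / (2 ^ g * of_nat (g+1))) * Delta (Bset g) * (\<Sum>e\<in>EE (2*g+2). - q e)"
    and "\<And>(c :: complex \<Rightarrow> 'k::field) x. unital_hom c \<Longrightarrow> inj_on x (Bset g) \<Longrightarrow>
      insertion c x (Hpoly g) = H_at g x"
proof -
  have "\<forall>e\<in>EE (2*g+2). \<exists>q. q \<in> polys (2*g+2) \<and> Delta (Bset g) = psi (2*g+2) e * q"
    using psi_dvd_Delta[of "2*g+2"] g by (auto simp: EE_def Bset_def)
  then obtain q where q: "\<And>e. e \<in> EE (2*g+2) \<Longrightarrow> q e \<in> polys (2*g+2)"
    "\<And>e. e \<in> EE (2*g+2) \<Longrightarrow> Delta (Bset g) = psi (2*g+2) e * q e" by metis
  let ?R = "Const (1 / (2 ^ g * of_nat (g+1))) * Delta (Bset g) * (\<Sum>e\<in>EE (2*g+2). - q e)"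
  have R: "insertion c x ?R = H_at g x" if c: "unital_hom c" and x: "inj_on x (Bset g)"
    for c :: "complex \<Rightarrow> 'l::field" and x
  proof -
    interpret c: unital_hom c by fact
    interpret i: unital_hom "insertion c x" by (rule insertion_hom[OF c])
    have "of_nat (2 ^ g * (g+1)) \<noteq> (0 :: complex)" by (simp only: of_nat_eq_0_iff) simp
    moreover have "2 ^ g * of_nat (g+1) = (of_nat (2 ^ g * (g+1)) :: complex)"
      by (simp only: of_nat_mult of_nat_power of_nat_numeral)
    ultimately have "(1 / (2 ^ g * of_nat (g+1))) * of_nat (2 ^ g * (g+1)) = (1 :: complex)"
      by simp
    \<comment> \<open>The type class does not provide characteristic zero; invertibility of this
      number is transported from the complex numbers by \<open>c\<close>.\<close>
    from arg_cong[OF this, of c]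
    have c1: "c (1 / (2 ^ g * of_nat (g+1))) * of_nat (2 ^ g * (g+1)) = 1"
      by (simp only: c.hom_mult c.hom_of_nat c.hom_one)
    then have "of_nat (2 ^ g * (g+1)) \<noteq> (0::'l)" by (metis mult_zero_right zero_neq_one)
    with c1 have "c (1 / (2 ^ g * of_nat (g+1))) = 1 / of_nat (2 ^ g * (g+1))"
      by (simp add: field_simps)
    also have "\<dots> = 1 / 2 ^ g * (1 / of_nat (g+1))"
      by (simp only: of_nat_mult of_nat_power of_nat_numeral times_divide_times_eq mult_1)
    finally have cg: "c (1 / (2 ^ g * of_nat (g+1))) = 1 / 2 ^ g * (1 / of_nat (g+1))" .
    have qe: "Delta_at (Bset g) x * insertion c x (- q e) = Delta_at (Bset g) x ^ 2 * (- 1 / psi_at (2*g+2) e x)"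
      if e: "e \<in> EE (2*g+2)" for e
    proof -
      have "psi_at (2*g+2) e x \<noteq> 0"
        using e x by (intro psi_at_nonzero) (auto simp: EE_def Bset_def)
      moreover have "Delta_at (Bset g) x = psi_at (2*g+2) e x * insertion c x (q e)"
        using arg_cong[OF q(2)[OF e], of "insertion c x"]
        by (simp add: insertion_Delta[OF c] i.hom_mult insertion_psi[OF c])
      ultimately show ?thesis by (simp add: i.hom_simps power2_eq_square)
    qed
    have "insertion c x ?R = 1 / 2 ^ g * (1 / of_nat (g+1)) *
      (\<Sum>e\<in>EE (2*g+2). Delta_at (Bset g) x * insertion c x (- q e))"
      by (simp only: i.hom_mult i.hom_sum insertion_Const[OF c] cg insertion_Delta[OF c]
        sum_distrib_left mult.assoc)
    also have "(\<Sum>e\<in>EE (2*g+2). Delta_at (Bset g) x * insertion c x (- q e))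
      = (\<Sum>e\<in>EE (2*g+2). Delta_at (Bset g) x ^ 2 * (- 1 / psi_at (2*g+2) e x))"
      by (intro sum.cong qe refl)
    finally show ?thesis by (simp only: H_at_def sum_distrib_left mult.assoc)
  qed
  have fr: "unital_hom (\<lambda>c. to_fract (Const c))"
    by (rule unital_hom_comp[OF unital_hom_to_fract unital_hom_Const])
  \<comment> \<open>Inserting the variables themselves is \<open>to_fract\<close>, so evaluation at
    this generic point meets the defining formula \<open>H_frac\<close>.\<close>
  have "to_fract ?R = H_at g (\<lambda>v. to_fract (Var v))"
  proof (subst R[OF fr, symmetric])
    show "inj_on (\<lambda>v. to_fract (Var v :: nat mpoly)) (Bset g)"
    proof (rule inj_onI)
      fix u v :: nat assume "to_fract (Var u :: nat mpoly) = to_fract (Var v)"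
      then show "u = v" using Var_diff_nonzero[of u v] by auto
    qed
  qed (simp add: insertion_to_fract)
  also have "\<dots> = H_frac g"
    by (simp add: H_at_def H_frac_def flip: insertion_psi[OF fr] insertion_Delta[OF fr])
      (simp add: insertion_to_fract)
  also have "\<dots> = to_fract (Hpoly g)" using to_fract_Hpoly[OF g] by simp
  finally have "Hpoly g = ?R" by (simp only: to_fract_eq_iff)
  with that q R show thesis by metis
qed

lemma insertion_Hpoly:
  fixes c :: "complex \<Rightarrow> 'k::field"
  shows "g \<ge> 1 \<Longrightarrow> unital_hom c \<Longrightarrow> inj_on x (Bset g) \<Longrightarrow> insertion c x (Hpoly g) = H_at g x"
  by (metis Hpoly_decomp)

lemma meval_Hpoly: "g \<ge> 1 \<Longrightarrow> inj_on x (Bset g) \<Longrightarrow> meval x (Hpoly g) = H_at g x"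
  unfolding meval_def by (intro insertion_Hpoly unital_hom_id)

lemma Hpoly_in_polys: "g \<ge> 1 \<Longrightarrow> Hpoly g \<in> polys (2*g+2)"
proof (erule Hpoly_decomp)
  fix q assume q: "\<And>e. e \<in> EE (2*g+2) \<Longrightarrow> q e \<in> polys (2*g+2)"
    and H: "Hpoly g = Const (1 / (2 ^ g * of_nat (g+1))) * Delta (Bset g) * (\<Sum>e\<in>EE (2*g+2). - q e)"
  have "Delta (Bset g) \<in> polys (2*g+2)"
    unfolding Delta_def Bset_def by (intro polys_prod) (auto intro!: polys_diff polys_Var)
  with q show ?thesis unfolding H
    by (intro polys_mult polys_Const polys_sum polys_uminus)
qed

lemma Delta_dvd_Hpoly: "g \<ge> 1 \<Longrightarrow> Delta (Bset g) dvd Hpoly g"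
  by (erule Hpoly_decomp) auto

subsection \<open>Symmetry, invariance and the sum over all permutations\<close>

text \<open>Up to sign the square of \<open>Delta_at\<close>. Running over all ordered pairs, it is
  invariant under permutations without any discussion of signs.\<close>

definition ordered_diffs :: "nat set \<Rightarrow> (nat \<Rightarrow> 'k::comm_ring_1) \<Rightarrow> 'k" where
  "ordered_diffs X x = (\<Prod>i\<in>X. \<Prod>j\<in>X - {i}. x i - x j)"

lemma Delta_at_square:
  assumes "finite X"
  shows "Delta_at X x ^ 2 = (-1) ^ card (pairs X) * ordered_diffs X x"
proof -
  let ?d = "\<lambda>(i, j). x i - x j" and ?Q = "prod.swap ` pairs X"
  have "prod ?d ?Q = (\<Prod>p\<in>pairs X. - 1 * ?d p)"
    by (subst prod.reindex) (auto intro!: prod.cong simp: case_prod_unfold)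
  also have "\<dots> = (-1) ^ card (pairs X) * Delta_at X x"
    by (simp only: prod.distrib prod_constant Delta_at_def)
  finally have Q: "prod ?d ?Q = (-1) ^ card (pairs X) * Delta_at X x" .
  have "ordered_diffs X x = prod ?d (SIGMA i:X. X - {i})"
    unfolding ordered_diffs_def using assms by (subst prod.Sigma) auto
  also have "(SIGMA i:X. X - {i}) = pairs X \<union> ?Q"
    by (auto simp: pairs_def image_iff)
  also have "prod ?d (pairs X \<union> ?Q) = Delta_at X x * prod ?d ?Q"
    unfolding Delta_at_def using assms
    by (subst prod.union_disjoint) (simp_all add: finite_pairs, auto simp: pairs_def)
  finally have "ordered_diffs X x = Delta_at X x * ((-1) ^ card (pairs X) * Delta_at X x)" by (simp only: Q)
  then have "(-1) ^ card (pairs X) * ordered_diffs X x = ((-1) ^ card (pairs X) * (-1) ^ card (pairs X)) * Delta_at X x ^ 2"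
    by (simp only: power2_eq_square mult_ac)
  then show ?thesis by (simp only: minus_one_mult_self mult_1)
qed

lemma Delta_at_square_permutes:
  assumes "finite X" "\<sigma> permutes X"
  shows "Delta_at X (\<lambda>i. x (\<sigma> i)) ^ 2 = Delta_at X x ^ 2"
proof -
  have inj: "inj \<sigma>" by (rule permutes_inj[OF assms(2)])
  have "(\<Prod>j\<in>X - {i}. x (\<sigma> i) - x (\<sigma> j)) = (\<Prod>j\<in>X - {\<sigma> i}. x (\<sigma> i) - x j)" for i
  proof -
    have "X - {\<sigma> i} = \<sigma> ` (X - {i})"
      using permutes_image[OF assms(2)] by (simp add: image_set_diff[OF inj])
    then show ?thesis by (simp add: prod.reindex inj_on_subset[OF inj])
  qed
  then have "ordered_diffs X (\<lambda>i. x (\<sigma> i)) = (\<Prod>i\<in>X. \<Prod>j\<in>X - {\<sigma> i}. x (\<sigma> i) - x j)"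
    by (simp add: ordered_diffs_def)
  also have "\<dots> = ordered_diffs X x"
    unfolding ordered_diffs_def by (rule prod.permute[OF assms(2), symmetric, unfolded o_def])
  finally show ?thesis using assms(1) by (simp add: Delta_at_square)
qed

text \<open>\<open>cyc_next\<close> made into a permutation in the sense of \<open>permutes\<close>,
  which demands the identity outside \<open>{1..r}\<close>.\<close>

definition rot :: "nat \<Rightarrow> nat \<Rightarrow> nat" where
  "rot r i = (if i \<in> {1..r} then cyc_next r i else i)"

lemma rot_permutes: "rot r permutes {1..r}"
proof (rule bij_imp_permutes)
  show "bij_betw (rot r) {1..r} {1..r}"
    by (rule bij_betw_byWitness[where f' = "\<lambda>i. if i = 1 then r else i - 1"])
      (auto simp: rot_def cyc_next_def)
qed (auto simp: rot_def)

lemma psi_at_rot: "psi_at r (e \<circ> rot r) x = psi_at r e x"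
proof -
  have "psi_at r (e \<circ> rot r) x = (\<Prod>i=1..r. x (e (rot r i)) - x (e (cyc_next r (rot r i))))"
    unfolding psi_at_def using cyc_next_in[of _ r] by (intro prod.cong) (auto simp: rot_def)
  also have "\<dots> = psi_at r e x"
    unfolding psi_at_def by (rule prod.permute[OF rot_permutes, symmetric, unfolded o_def])
  finally show ?thesis .
qed

text \<open>Both parity patterns; rotation by one step exchanges them when \<open>r\<close> is even.\<close>

definition Alt :: "nat \<Rightarrow> bool \<Rightarrow> (nat \<Rightarrow> nat) set" where
  "Alt r b = {e. e permutes {1..r} \<and> (\<forall>i\<in>{1..r}. even (e i) \<longleftrightarrow> (even i \<longleftrightarrow> b))}"

lemma EE_eq_Alt: "EE r = Alt r True"
  by (simp add: EE_def Alt_def)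

lemma finite_Alt: "finite (Alt r b)"
  by (rule finite_subset[OF _ finite_permutations[of "{1..r}"]]) (auto simp: Alt_def)

lemma Alt_permutes: "e \<in> Alt r b \<Longrightarrow> e permutes {1..r}"
  by (simp add: Alt_def)

lemma Alt_in: "e \<in> Alt r b \<Longrightarrow> i \<in> {1..r} \<Longrightarrow> e i \<in> {1..r}"
  using permutes_in_image[OF Alt_permutes] by blast

lemma Alt_even: "e \<in> Alt r b \<Longrightarrow> i \<in> {1..r} \<Longrightarrow> even (e i) \<longleftrightarrow> (even i \<longleftrightarrow> b)"
  unfolding Alt_def by blast

lemma Alt_comp:
  assumes "e \<in> Alt r b" "f \<in> Alt r c"
  shows "e \<circ> f \<in> Alt r (b \<longleftrightarrow> c)"
proof -
  have "e \<circ> f permutes {1..r}"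
    using assms by (intro permutes_compose Alt_permutes)
  moreover have "even ((e \<circ> f) i) \<longleftrightarrow> (even i \<longleftrightarrow> (b \<longleftrightarrow> c))" if "i \<in> {1..r}" for i
    using Alt_even[OF assms(1) Alt_in[OF assms(2) that]] Alt_even[OF assms(2) that]
    by (cases b; cases c) simp_all
  ultimately show ?thesis unfolding Alt_def by blast
qed

lemma Alt_inv:
  assumes "e \<in> Alt r b"
  shows "inv e \<in> Alt r b"
proof -
  note p = Alt_permutes[OF assms]
  have "even (inv e i) \<longleftrightarrow> (even i \<longleftrightarrow> b)" if "i \<in> {1..r}" for i
  proof -
    have "inv e i \<in> {1..r}" using permutes_in_image[OF permutes_inv[OF p]] that by blast
    from Alt_even[OF assms this] show ?thesis by (cases b) (simp_all add: permutes_inverses[OF p])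
  qed
  with permutes_inv[OF p] show ?thesis unfolding Alt_def by blast
qed

lemma bij_Alt_right:
  assumes "f \<in> Alt r c"
  shows "bij_betw (\<lambda>e. e \<circ> f) (Alt r b) (Alt r (b \<longleftrightarrow> c))"
proof (rule bij_betw_byWitness[where f' = "\<lambda>e. e \<circ> inv f"])
  note p = Alt_permutes[OF assms]
  show "\<forall>e\<in>Alt r b. e \<circ> f \<circ> inv f = e" "\<forall>e\<in>Alt r (b \<longleftrightarrow> c). e \<circ> inv f \<circ> f = e"
    by (simp_all add: o_assoc[symmetric] permutes_inv_o[OF p])
  show "(\<lambda>e. e \<circ> f) ` Alt r b \<subseteq> Alt r (b \<longleftrightarrow> c)"
    using Alt_comp[OF _ assms] by blast
  show "(\<lambda>e. e \<circ> inv f) ` Alt r (b \<longleftrightarrow> c) \<subseteq> Alt r b"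
    using Alt_comp[OF _ Alt_inv[OF assms], of _ "b \<longleftrightarrow> c"] by (cases b; cases c) auto
qed

lemma bij_Alt_left:
  assumes "f \<in> Alt r c"
  shows "bij_betw (\<lambda>e. f \<circ> e) (Alt r b) (Alt r (c \<longleftrightarrow> b))"
proof (rule bij_betw_byWitness[where f' = "\<lambda>e. inv f \<circ> e"])
  note p = Alt_permutes[OF assms]
  show "\<forall>e\<in>Alt r b. inv f \<circ> (f \<circ> e) = e" "\<forall>e\<in>Alt r (c \<longleftrightarrow> b). f \<circ> (inv f \<circ> e) = e"
    by (simp_all add: o_assoc permutes_inv_o[OF p])
  show "(\<lambda>e. f \<circ> e) ` Alt r b \<subseteq> Alt r (c \<longleftrightarrow> b)"
    using Alt_comp[OF assms] by blast
  show "(\<lambda>e. inv f \<circ> e) ` Alt r (c \<longleftrightarrow> b) \<subseteq> Alt r b"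
    using Alt_comp[OF Alt_inv[OF assms], of _ "c \<longleftrightarrow> b"] by (cases b; cases c) auto
qed

lemma rot_in_Alt: "even r \<Longrightarrow> rot r \<in> Alt r False"
proof -
  assume "even r"
  then have "even (rot r i) \<longleftrightarrow> (even i \<longleftrightarrow> False)" if "i \<in> {1..r}" for i
    using that by (auto simp: rot_def cyc_next_def)
  with rot_permutes show ?thesis unfolding Alt_def by blast
qed

lemma sum_Alt_rot:
  assumes "even r" "\<And>e. F (e \<circ> rot r) = F e"
  shows "sum F (Alt r False) = sum F (EE r)"
  using sum.reindex_bij_betw[OF bij_Alt_right[OF rot_in_Alt[OF assms(1)], of True], of F] assms(2)
  by (simp add: EE_eq_Alt)

text \<open>If \<open>\<sigma>\<close> flips parities, the sum moves to the other parity pattern and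
  one rotation step brings it back. This extends the invariance to permutations that exchange
  \<open>Uset g\<close> and \<open>Uset' g\<close>.\<close>

lemma sum_EE_comp:
  assumes r: "even r" and \<sigma>: "\<sigma> \<in> Alt r b"
    and F: "\<And>e. F (e \<circ> rot r) = F e"
  shows "(\<Sum>e\<in>EE r. F (\<sigma> \<circ> e)) = sum F (EE r)"
  using sum.reindex_bij_betw[OF bij_Alt_left[OF \<sigma>, of True], of F] sum_Alt_rot[where F = F, OF r F]
  by (cases b) (simp_all add: EE_eq_Alt)

lemma psi_at_comp: "psi_at r e (\<lambda>i. x (\<sigma> i)) = psi_at r (\<sigma> \<circ> e) x"
  by (simp add: psi_at_def)

lemma H_at_S_U:
  assumes "\<sigma> \<in> S_U g"
  shows "H_at g (\<lambda>i. x (\<sigma> i)) = H_at g x"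
proof -
  have \<sigma>: "\<sigma> permutes Bset g" using assms by (simp add: S_U_def)
  have \<sigma>': "\<sigma> permutes {1..2*g+2}" using \<sigma> by (simp add: Bset_def)
  have inj: "inj \<sigma>" by (rule permutes_inj[OF \<sigma>])
  have mem: "\<sigma> i \<in> \<sigma> ` Uset g \<longleftrightarrow> odd i" "\<sigma> i \<in> Bset g" if "i \<in> {1..2*g+2}" for i
    using that permutes_in_image[OF \<sigma>, of i]
    by (auto simp: Uset_def Bset_def inj_image_mem_iff[OF inj])
  have "\<exists>b. \<sigma> \<in> Alt (2*g+2) b"
  proof (cases "\<sigma> ` Uset g = Uset g")
    case True
    then have "even (\<sigma> i) \<longleftrightarrow> (even i \<longleftrightarrow> True)" if "i \<in> {1..2*g+2}" for i
      using mem[OF that] by (simp add: Uset_def)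
    with \<sigma>' show ?thesis unfolding Alt_def by blast
  next
    case False
    with assms have "\<sigma> ` Uset g = Uset' g" by (simp add: S_U_def)
    then have "even (\<sigma> i) \<longleftrightarrow> (even i \<longleftrightarrow> False)" if "i \<in> {1..2*g+2}" for i
      using mem[OF that] by (simp add: Uset_def Uset'_def)
    with \<sigma>' show ?thesis unfolding Alt_def by blast
  qed
  then obtain b where b: "\<sigma> \<in> Alt (2*g+2) b" ..
  have "(\<Sum>e\<in>EE (2*g+2). - 1 / psi_at (2*g+2) (\<sigma> \<circ> e) x) = (\<Sum>e\<in>EE (2*g+2). - 1 / psi_at (2*g+2) e x)"
    by (rule sum_EE_comp[OF _ b]) (simp_all only: psi_at_rot, simp)
  moreover have "finite (Bset g)" by (simp add: Bset_def)
  ultimately show ?thesis by (simp add: H_at_def psi_at_comp Delta_at_square_permutes[OF _ \<sigma>])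
qed

lemma inj_on_comp_permutes:
  assumes "\<sigma> permutes X" "inj_on x X"
  shows "inj_on (\<lambda>i. x (\<sigma> i)) X"
  using comp_inj_on[OF permutes_inj_on[OF assms(1)], of x] assms(2) permutes_image[OF assms(1)]
  by (simp add: o_def)

lemma perm_act_Hpoly:
  assumes "g \<ge> 1" "\<sigma> \<in> S_U g"
  shows "perm_act \<sigma> (Hpoly g) = Hpoly g"
proof (rule mpoly_eq_generic[of "Bset g"])
  fix x :: "nat \<Rightarrow> complex" assume x: "inj_on x (Bset g)"
  have "inj_on (\<lambda>i. x (\<sigma> i)) (Bset g)"
    using assms(2) x by (intro inj_on_comp_permutes[of \<sigma> _ x]) (auto simp: S_U_def)
  with x assms show "meval x (perm_act \<sigma> (Hpoly g)) = meval x (Hpoly g)"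
    by (simp add: meval_perm_act meval_Hpoly H_at_S_U)
qed (simp add: Bset_def)

text \<open>Inserting the value \<open>y\<close> at \<open>r\<close> into the cycle of the other \<open>r - 1\<close> values, partial fractions
  in \<open>y\<close> telescope around the cycle.\<close>

lemma sum_inverse_psi_at:
  fixes x :: "nat \<Rightarrow> 'k::field"
  assumes r: "r \<ge> 3" and x: "inj_on x {1..r}"
  shows "(\<Sum>\<tau> | \<tau> permutes {1..r}. 1 / psi_at r \<tau> x) = 0"
proof -
  \<comment> \<open>\<open>\<rho>\<close> turns the cycle of the first \<open>r - 1\<close>
    positions and fixes position \<open>r\<close>, so it moves the gap into which the last value is
    inserted.\<close>
  define \<rho> where "\<rho> = rot (r - 1)"
  have \<rho>: "\<rho> permutes {1..r}"
    unfolding \<rho>_def by (rule permutes_subset[OF rot_permutes]) auto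
  \<comment> \<open>One term of \<open>1/((y-b1)*(b2-y)) = (1/(y-b1) - 1/(y-b2)) / (b2-b1)\<close>,
    where \<open>y\<close> is inserted between \<open>b2\<close> and \<open>b1\<close>. The factor
    \<open>b2 - b1\<close> closes the remaining path to the shorter cycle, whose
    \<open>psi_at\<close> does not change under \<open>\<rho>\<close>.\<close>
  define G where "G = (\<lambda>\<tau>. 1 / (psi_at (r-1) \<tau> x * (x (\<tau> r) - x (\<tau> 1))))"
  have step: "1 / psi_at r (\<upsilon> \<circ> \<rho>) x = G (\<upsilon> \<circ> \<rho>) - G \<upsilon>" if \<upsilon>: "\<upsilon> permutes {1..r}" for \<upsilon>
  proof -
    define \<tau> where "\<tau> = \<upsilon> \<circ> \<rho>"
    have \<tau>: "\<tau> permutes {1..r}" unfolding \<tau>_def by (rule permutes_compose[OF \<rho> \<upsilon>])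
    have ne: "x (\<tau> i) \<noteq> x (\<tau> j)" if "i \<in> {1..r}" "j \<in> {1..r}" "i \<noteq> j" for i j
    proof
      assume "x (\<tau> i) = x (\<tau> j)"
      with that x permutes_in_image[OF \<tau>] have "\<tau> i = \<tau> j" by (meson inj_onD)
      with that(3) permutes_inj[OF \<tau>] show False by (meson injD)
    qed
    define A where "A = psi'_at (r-1) \<tau> x"
    define y b1 b2 where "y = x (\<tau> r)" and "b1 = x (\<tau> 1)" and "b2 = x (\<tau> (r-1))"
    have n: "y \<noteq> b1" "y \<noteq> b2" "b2 \<noteq> b1"
      unfolding y_def b1_def b2_def using r ne[of r 1] ne[of r "r-1"] ne[of "r-1" 1] by auto
    have A: "A \<noteq> 0"
    proof -
      have "x (\<tau> i) - x (\<tau> (i+1)) \<noteq> 0" if "i \<in> {1..r-1-1}" for i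
        proof -
        have "i \<in> {1..r}" "i + 1 \<in> {1..r}" using that by auto
        from ne[OF this] show ?thesis by simp
      qed
      then show ?thesis unfolding A_def psi'_at_def by (subst prod_zero_iff) auto
    qed
    have pv1: "psi_at (r-1) \<tau> x = (b2 - b1) * A"
      using r by (subst psi_at_eq) (auto simp: A_def b1_def b2_def)
    have "{1..r-1} = insert (r-1) {1..r-1-1}" "r-1 \<notin> {1..r-1-1}" using r by auto
    then have "psi'_at r \<tau> x = (x (\<tau> (r-1)) - x (\<tau> (r-1+1))) * A"
      unfolding psi'_at_def A_def by (simp only:) (simp add: prod.insert)
    then have psi_at: "psi_at r \<tau> x = (y - b1) * ((b2 - y) * A)"
      using r by (subst psi_at_eq) (auto simp: y_def b1_def b2_def)
    have \<upsilon>r: "\<upsilon> r = \<tau> r" "\<upsilon> 1 = \<tau> (r-1)"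
      using r by (auto simp: \<tau>_def \<rho>_def rot_def cyc_next_def)
    have "psi_at (r-1) \<upsilon> x = psi_at (r-1) \<tau> x" by (simp add: \<tau>_def \<rho>_def psi_at_rot)
    then have "G \<upsilon> = 1 / ((b2 - b1) * A * (y - b2))"
      unfolding G_def \<upsilon>r y_def[symmetric] b2_def[symmetric] by (simp only: pv1)
    moreover have "G \<tau> = 1 / ((b2 - b1) * A * (y - b1))"
      unfolding G_def y_def[symmetric] b1_def[symmetric] pv1 ..
    ultimately have "1 / psi_at r \<tau> x = G \<tau> - G \<upsilon>"
      using n A unfolding psi_at by (simp add: divide_simps) algebra
    then show ?thesis by (simp add: \<tau>_def)
  qed
  have re: "(\<Sum>\<tau> | \<tau> permutes {1..r}. F (\<tau> \<circ> \<rho>)) = (\<Sum>\<tau> | \<tau> permutes {1..r}. F \<tau>)" for F :: "_ \<Rightarrow> 'k"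
    using sum_permutations_compose_right[OF \<rho>, of F] by simp
  have "(\<Sum>\<tau> | \<tau> permutes {1..r}. 1 / psi_at r \<tau> x) = (\<Sum>\<tau> | \<tau> permutes {1..r}. 1 / psi_at r (\<tau> \<circ> \<rho>) x)"
    using re[of "\<lambda>\<tau>. 1 / psi_at r \<tau> x"] by simp
  also have "\<dots> = (\<Sum>\<tau> | \<tau> permutes {1..r}. G (\<tau> \<circ> \<rho>) - G \<tau>)"
    by (intro sum.cong) (simp_all add: step)
  also have "\<dots> = 0" by (simp only: sum_subtractf re diff_self)
  finally show ?thesis .
qed

lemma sum_perm_act_Hpoly:
  assumes g: "g \<ge> 1"
  shows "(\<Sum>\<sigma> | \<sigma> permutes Bset g. perm_act \<sigma> (Hpoly g)) = 0"
proof (rule mpoly_eq_0_generic[of "Bset g"])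
  fix x :: "nat \<Rightarrow> complex" assume x: "inj_on x (Bset g)"
  let ?K = "1 / 2 ^ g * (1 / of_nat (g+1)) * Delta_at (Bset g) x ^ 2" and ?r = "2*g+2"
  have fin: "finite (Bset g)" by (simp add: Bset_def)
  have "(\<Sum>\<sigma> | \<sigma> permutes Bset g. meval x (perm_act \<sigma> (Hpoly g)))
      = (\<Sum>\<sigma> | \<sigma> permutes Bset g. ?K * (\<Sum>e\<in>EE ?r. - 1 / psi_at ?r (\<sigma> \<circ> e) x))"
  proof (intro sum.cong refl)
    fix \<sigma> assume "\<sigma> \<in> {\<sigma>. \<sigma> permutes Bset g}"
    then have \<sigma>: "\<sigma> permutes Bset g" by simp
    show "meval x (perm_act \<sigma> (Hpoly g)) = ?K * (\<Sum>e\<in>EE ?r. - 1 / psi_at ?r (\<sigma> \<circ> e) x)"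
      unfolding meval_perm_act meval_Hpoly[OF g inj_on_comp_permutes[OF \<sigma> x]]
        H_at_def psi_at_comp Delta_at_square_permutes[OF fin \<sigma>] ..
  qed
  also have "\<dots> = ?K * (\<Sum>e\<in>EE ?r. - (\<Sum>\<sigma> | \<sigma> permutes Bset g. 1 / psi_at ?r (\<sigma> \<circ> e) x))"
    unfolding sum_distrib_left[symmetric] sum_negf[symmetric]
    by (subst sum.swap) simp
  \<comment> \<open>For each \<open>e\<close> the composites \<open>\<sigma> \<circ> e\<close> run
    through all permutations, so the parity condition on \<open>e\<close> disappears.\<close>
  also have "(\<Sum>e\<in>EE ?r. - (\<Sum>\<sigma> | \<sigma> permutes Bset g. 1 / psi_at ?r (\<sigma> \<circ> e) x)) = (\<Sum>e\<in>EE ?r. 0)"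
  proof (intro sum.cong refl)
    fix e assume "e \<in> EE ?r"
    then have e: "e permutes Bset g" by (simp add: EE_def Bset_def)
    have "(\<Sum>\<sigma> | \<sigma> permutes Bset g. 1 / psi_at ?r (\<sigma> \<circ> e) x) = (\<Sum>\<sigma> | \<sigma> permutes Bset g. 1 / psi_at ?r \<sigma> x)"
      using sum_permutations_compose_right[OF e, of "\<lambda>\<sigma>. 1 / psi_at ?r \<sigma> x"] by simp
    also have "\<dots> = 0" using g x unfolding Bset_def by (intro sum_inverse_psi_at) auto
    finally show "- (\<Sum>\<sigma> | \<sigma> permutes Bset g. 1 / psi_at ?r (\<sigma> \<circ> e) x) = 0" by simp
  qed
  finally show "meval x (\<Sum>\<sigma> | \<sigma> permutes Bset g. perm_act \<sigma> (Hpoly g)) = 0" by simp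
qed (simp add: Bset_def)

section \<open>Vanishing of the images under \<open>Phi\<close>\<close>

lemma Var_nonzero: "Var v \<noteq> (0 :: 'v mpoly)"
proof
  assume "Var v = (0 :: 'v mpoly)"
  from arg_cong[OF this, of "meval (\<lambda>_. 1)"] show False by simp
qed

lemma Phi_Hpoly:
  assumes g: "g \<ge> 1" and ij: "i \<in> Bset g" "j \<in> Bset g" "i \<noteq> j"
  shows "Phi g 4 i j (Hpoly g) = 0"
proof -
  let ?s = "\<lambda>l. if l \<in> {i, j} then 0 else Var l :: nat mpoly"
  interpret s: unital_hom "insertion Const ?s" by (rule insertion_hom[OF unital_hom_Const])
  obtain q where q: "Hpoly g = Delta (Bset g) * q" using Delta_dvd_Hpoly[OF g] by (elim dvdE)
  have "insertion Const ?s (Delta (Bset g)) = 0"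
  proof -
    have "(max i j, min i j) \<in> pairs (Bset g)" using ij by (auto simp: pairs_def max_def min_def)
    moreover have "?s (max i j) - ?s (min i j) = 0" by (auto simp: max_def min_def)
    moreover have "finite (pairs (Bset g))" by (simp add: finite_pairs Bset_def)
    ultimately show ?thesis
      unfolding insertion_Delta[OF unital_hom_Const] Delta_at_def
      by (intro prod_zero) (auto intro!: bexI[of _ "(max i j, min i j)"])
  qed
  then have "msubst ?s (Hpoly g) = 0" by (simp only: msubst_def q s.hom_mult mult_zero_left)
  \<comment> \<open>Cancelling a power of this nonzero monomial leaves 0 as the only quotient, so
    the description in \<open>Phi_def\<close> denotes it.\<close>
  moreover have "(\<Prod>l\<in>Bset g - {i, j}. Var l :: nat mpoly) \<noteq> 0"
    by (simp add: Bset_def Var_nonzero)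
  ultimately have "(THE q. q * (\<Prod>l\<in>Bset g - {i, j}. Var l) ^ 4 = msubst ?s (Hpoly g)) = 0"
    by (intro the_equality) auto
  then show ?thesis by (simp add: Phi_def msubst_def insertion_def)
qed

section \<open>Weight under fractional linear substitutions\<close>

lemma moebius_diff:
  fixes A B C D :: "'k::field"
  assumes "A * D - B * C = 1" "C * a + D \<noteq> 0" "C * b + D \<noteq> 0"
  shows "(A * a + B) / (C * a + D) - (A * b + B) / (C * b + D) = (a - b) / ((C * a + D) * (C * b + D))"
proof -
  have "(A * a + B) * (C * b + D) - (A * b + B) * (C * a + D) = (A * D - B * C) * (a - b)" by algebra
  with assms show ?thesis by (simp add: diff_frac_eq)
qed

text \<open>Each variable lies in \<open>2*(2*g+1)\<close> factors of the squared
  \<open>Delta_at\<close> and in two factors of \<open>psi_at\<close>; the difference of these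
  numbers is the weight \<open>4*g\<close>.\<close>

lemma H_at_moebius:
  fixes a :: "nat \<Rightarrow> 'k::field"
  assumes det: "A * D - B * C = 1" and d: "\<And>i. i \<in> Bset g \<Longrightarrow> C * a i + D \<noteq> 0"
  shows "H_at g (\<lambda>i. (A * a i + B) / (C * a i + D)) * (\<Prod>i\<in>Bset g. (C * a i + D) ^ (4*g)) = H_at g a"
proof -
  define \<gamma> where "\<gamma> = (\<lambda>i. (A * a i + B) / (C * a i + D))"
  define d where "d = (\<lambda>i. C * a i + D)"
  define Q where "Q = (\<Prod>i\<in>Bset g. d i)"
  have fin: "finite (Bset g)" and card: "card (Bset g) = 2*g+2" by (simp_all add: Bset_def)
  have dn: "d i \<noteq> 0" if "i \<in> Bset g" for i using assms(2)[OF that] by (simp add: d_def)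
  then have Q0: "Q \<noteq> 0" using fin by (auto simp: Q_def)
  have diff: "\<gamma> i - \<gamma> j = (a i - a j) / (d i * d j)" if "i \<in> Bset g" "j \<in> Bset g" for i j
    using moebius_diff[OF det] dn[OF that(1)] dn[OF that(2)] by (simp add: \<gamma>_def d_def)
  have in1: "(\<Prod>j\<in>Bset g - {i}. d i * d j) = d i ^ (2*g) * Q" if i: "i \<in> Bset g" for i
  proof -
    have "Q = d i * (\<Prod>j\<in>Bset g - {i}. d j)" unfolding Q_def by (rule prod.remove[OF fin i])
    moreover have "card (Bset g - {i}) = Suc (2*g)" using fin card i by simp
    ultimately show ?thesis by (simp add: prod.distrib)
  qed
  have "ordered_diffs (Bset g) \<gamma> = (\<Prod>i\<in>Bset g. (\<Prod>j\<in>Bset g - {i}. a i - a j) / (\<Prod>j\<in>Bset g - {i}. d i * d j))"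
    unfolding ordered_diffs_def by (intro prod.cong refl) (simp add: diff flip: prod_dividef)
  also have "\<dots> = ordered_diffs (Bset g) a / (\<Prod>i\<in>Bset g. d i ^ (2*g) * Q)"
    unfolding ordered_diffs_def prod_dividef by (simp add: in1)
  also have "(\<Prod>i\<in>Bset g. d i ^ (2*g) * Q) = Q ^ (4*g) * Q ^ 2"
    unfolding prod.distrib prod_power_distrib[symmetric] Q_def[symmetric] prod_constant card
      power_add[symmetric] by (rule arg_cong[of _ _ "power Q"]) simp
  finally have D: "Delta_at (Bset g) \<gamma> ^ 2 = Delta_at (Bset g) a ^ 2 / (Q ^ (4*g) * Q ^ 2)"
    by (simp add: Delta_at_square[OF fin])
  have P: "- 1 / psi_at (2*g+2) e \<gamma> = Q ^ 2 * (- 1 / psi_at (2*g+2) e a)" if e: "e \<in> EE (2*g+2)" for e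
  proof -
    have e: "e permutes Bset g" using e by (simp add: EE_def Bset_def)
    have e_in: "e i \<in> Bset g" if "i \<in> Bset g" for i using permutes_in_image[OF e] that by blast
    have cyc_next: "cyc_next (2*g+2) i \<in> Bset g" if "i \<in> Bset g" for i
      using cyc_next_in[of i "2*g+2"] that by (simp add: Bset_def)
    have Q1: "(\<Prod>i\<in>Bset g. d (e i)) = Q"
      unfolding Q_def using prod.permute[OF e, of d] by (simp add: o_def)
    have Q2: "(\<Prod>i\<in>Bset g. d (e (cyc_next (2*g+2) i))) = Q"
    proof -
      have rot: "rot (2*g+2) permutes Bset g" using rot_permutes by (simp add: Bset_def)
      have "(\<Prod>i\<in>Bset g. d (e (cyc_next (2*g+2) i))) = (\<Prod>i\<in>Bset g. d (e (rot (2*g+2) i)))"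
        by (intro prod.cong) (auto simp: rot_def Bset_def)
      also have "\<dots> = (\<Prod>i\<in>Bset g. d (e i))"
        using prod.permute[OF rot, of "\<lambda>i. d (e i)"] by (simp add: o_def)
      finally show ?thesis by (simp add: Q1)
    qed
    have "psi_at (2*g+2) e \<gamma> = (\<Prod>i\<in>Bset g. (a (e i) - a (e (cyc_next (2*g+2) i))) / (d (e i) * d (e (cyc_next (2*g+2) i))))"
      unfolding psi_at_def Bset_def[symmetric] using e_in cyc_next by (intro prod.cong refl diff) auto
    also have "\<dots> = psi_at (2*g+2) e a / (Q * Q)"
      unfolding prod_dividef prod.distrib Q1 Q2 by (simp add: psi_at_def Bset_def)
    finally show ?thesis by (simp add: power2_eq_square)
  qed
  have "H_at g \<gamma> = 1 / 2 ^ g * (1 / of_nat (g+1)) * (Delta_at (Bset g) a ^ 2 / (Q ^ (4*g) * Q ^ 2)) *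
     (Q ^ 2 * (\<Sum>e\<in>EE (2*g+2). - 1 / psi_at (2*g+2) e a))"
    unfolding H_at_def D sum_distrib_left by (simp only: P cong: sum.cong)
  then have "H_at g \<gamma> * Q ^ (4*g) = H_at g a"
    using Q0 by (simp add: H_at_def)
  then show ?thesis by (simp add: \<gamma>_def Q_def d_def prod_power_distrib)
qed

lemma Hpoly_in_Sw:
  assumes g: "g \<ge> 1"
  shows "Hpoly g \<in> Sw (4*g) (2*g+2)"
proof -
  define k where "k = (\<lambda>x :: real. to_fract (Const (complex_of_real x) :: nat mpoly))"
  define a where "a = (\<lambda>i :: nat. to_fract (Var i :: nat mpoly))"
  have hom: "unital_hom (\<lambda>c. to_fract (Const c :: nat mpoly))"
    by (rule unital_hom_comp[OF unital_hom_to_fract unital_hom_Const])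
  have k: "k (x * y) = k x * k y" "k (x - y) = k x - k y" "k 1 = 1" for x y
    unfolding k_def by (simp_all add: unital_hom.hom_simps[OF hom])
  have inj: "inj_on a (Bset g)"
  proof (rule inj_onI)
    fix u v :: nat assume "a u = a v"
    then show "u = v" using Var_diff_nonzero[of u v] by (auto simp: a_def)
  qed
  have main: "to_fract (Hpoly g) =
      insertion (\<lambda>c. to_fract (Const c)) (\<lambda>i. (k A * a i + k B) / (k C * a i + k D)) (Hpoly g)
         * (\<Prod>i=1..2*g+2. (k C * a i + k D) ^ (4*g))"
    if det: "A * D - B * C = 1" for A B C D
  proof -
    have det': "k A * k D - k B * k C = 1" using arg_cong[OF det, of k] by (simp add: k)
    have d: "k C * a i + k D \<noteq> 0" for i
    proof
      assume "k C * a i + k D = 0"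
      then have "to_fract (Const (of_real C) * Var i + Const (of_real D) :: nat mpoly) = 0"
        by (simp add: k_def a_def)
      then have 0: "Const (of_real C) * Var i + Const (of_real D) = (0 :: nat mpoly)" by (simp only: to_fract_eq_0_iff)
      from arg_cong[OF this, of "meval (\<lambda>_. 0)"] have "D = 0" by simp
      moreover from arg_cong[OF 0, of "meval (\<lambda>_. 1)"] this have "C = 0" by simp
      ultimately show False using det by simp
    qed
    let ?\<gamma> = "\<lambda>i. (k A * a i + k B) / (k C * a i + k D)"
    \<comment> \<open>The formula for the values is available at the transformed point because its
      coordinates are again distinct.\<close>
    have "inj_on ?\<gamma> (Bset g)"
    proof (rule inj_onI)
      fix i j assume ij: "i \<in> Bset g" "j \<in> Bset g" "?\<gamma> i = ?\<gamma> j"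
      with moebius_diff[OF det' d d, of i j] have "a i - a j = 0" using d[of i] d[of j] by simp
      with ij inj show "i = j" by (auto dest: inj_onD)
    qed
    then have "insertion (\<lambda>c. to_fract (Const c)) ?\<gamma> (Hpoly g) = H_at g ?\<gamma>"
      by (rule insertion_Hpoly[OF g hom])
    moreover have "to_fract (Hpoly g) = H_at g a"
      using insertion_Hpoly[OF g hom inj] by (simp add: a_def insertion_to_fract)
    ultimately show ?thesis
      using H_at_moebius[OF det', of g a] d by (simp add: Bset_def)
  qed
  show ?thesis
    unfolding Sw_def Let_def using main Hpoly_in_polys[OF g] unfolding k_def a_def by blast
qed

subsection \<open>Degeneration along a splitting of the variables\<close>

text \<open>The value of \<open>star (2*g+2) (Hpoly g)\<close>, as \<open>meval_star_Hpoly\<close>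
  shows. Sending the last variable to infinity opens each cycle into a path; the choice of rotation
  absorbs \<open>1 / of_nat (g+1)\<close>, and the difference that leaves the first block absorbs
  the sign.\<close>

definition star_H_at :: "nat \<Rightarrow> (nat \<Rightarrow> complex) \<Rightarrow> complex" where
  "star_H_at g x = 1 / 2 ^ g * Delta_at {1..2*g+1} x ^ 2 * (\<Sum>p\<in>EE (2*g+1). 1 / psi'_at (2*g+1) p x)"

lemma permutesI_inj:
  assumes "finite S" "inj_on f S" "f ` S \<subseteq> S" "\<And>i. i \<notin> S \<Longrightarrow> f i = i"
  shows "f permutes S"
  using assms endo_inj_surj[OF assms(1,3,2)] by (intro bij_imp_permutes) (auto simp: bij_betw_def)

text \<open>With \<open>g2 = 0\<close> the second block is the last variable alone. The odd size of
  the blocks is what excludes the flipped parity pattern later on.\<close>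

locale splitting =
  fixes g1 g2 g r1 r2 N :: nat
  assumes g: "g = g1 + g2" and r1: "r1 = 2*g1+1" and r2: "r2 = 2*g2+1" and N: "N = 2*g+2"
begin

lemma N_eq: "N = r1 + r2"
  by (simp add: g r1 r2 N)

lemma r1_pos: "1 \<le> r1" and r1_less: "r1 < N"
  by (simp_all add: r1 r2 N_eq)

lemma tail_in: "j \<in> {1..r2} \<Longrightarrow> r1 + j \<in> {r1<..N}"
  by (simp add: N_eq)

lemma tail_diff_in: "i \<in> {r1<..N} \<Longrightarrow> i - r1 \<in> {1..r2}"
  by (auto simp: N_eq)

lemma even_N: "even N"
  by (simp add: N)

definition crossing :: "nat \<Rightarrow> nat \<Rightarrow> nat" where
  "crossing a b = (if a \<le> r1 \<longleftrightarrow> b \<le> r1 then 0 else 1)"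

text \<open>Marks a return from the second block to the first. Returns are counted because a
  contributing cycle has exactly one, which tells where to cut it.\<close>

definition ascent :: "nat \<Rightarrow> nat \<Rightarrow> nat" where
  "ascent a b = (if \<not> a \<le> r1 \<and> b \<le> r1 then 1 else 0)"

text \<open>Limit of one difference after division by \<open>n\<close> in case of a crossing:
  leaving the first block it behaves like \<open>- n\<close>, returning to it like
  \<open>n\<close>.\<close>

definition factor_lim :: "(nat \<Rightarrow> complex) \<Rightarrow> nat \<Rightarrow> nat \<Rightarrow> complex" where
  "factor_lim x a b = (if a \<le> r1 \<longleftrightarrow> b \<le> r1 then x a - x b else if a \<le> r1 then - 1 else 1)"

definition ncross :: "(nat \<Rightarrow> nat) \<Rightarrow> nat" where
  "ncross e = (\<Sum>i=1..N. crossing (e i) (e (cyc_next N i)))"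

definition nascent :: "(nat \<Rightarrow> nat) \<Rightarrow> nat" where
  "nascent e = (\<Sum>i=1..N. ascent (e i) (e (cyc_next N i)))"

definition term_lim :: "(nat \<Rightarrow> complex) \<Rightarrow> (nat \<Rightarrow> nat) \<Rightarrow> complex" where
  "term_lim x e = (if nascent e = 1 then 1 / (\<Prod>i=1..N. factor_lim x (e i) (e (cyc_next N i))) else 0)"

definition shift :: "(nat \<Rightarrow> complex) \<Rightarrow> nat \<Rightarrow> nat \<Rightarrow> complex" where
  "shift x n i = (if i \<le> r1 then x i else x i + of_nat n)"

definition ptail :: "(nat \<Rightarrow> complex) \<Rightarrow> nat \<Rightarrow> complex" where
  "ptail x j = x (r1 + j)"

text \<open>A closed walk leaves the first block as often as it returns. In the proof the indicator
  \<open>?s\<close> of the first block cancels, since its sum around the cycle is invariant under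
  rotation.\<close>

lemma ncross_eq: "ncross e = 2 * nascent e"
proof -
  let ?s = "\<lambda>i. if e i \<le> r1 then 1 else 0 :: nat"
  have "(\<Sum>i=1..N. ?s (cyc_next N i)) = (\<Sum>i=1..N. ?s (rot N i))"
    by (intro sum.cong) (auto simp: rot_def)
  also have "\<dots> = (\<Sum>i=1..N. ?s i)"
    by (rule sum.permute[OF rot_permutes, symmetric, unfolded o_def])
  finally have s: "(\<Sum>i=1..N. ?s (cyc_next N i)) = (\<Sum>i=1..N. ?s i)" .
  have "ncross e + (\<Sum>i=1..N. ?s (cyc_next N i)) = (\<Sum>i=1..N. crossing (e i) (e (cyc_next N i)) + ?s (cyc_next N i))"
    by (simp only: ncross_def sum.distrib)
  also have "\<dots> = (\<Sum>i=1..N. 2 * ascent (e i) (e (cyc_next N i)) + ?s i)"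
    by (intro sum.cong) (auto simp: crossing_def ascent_def)
  also have "\<dots> = 2 * nascent e + (\<Sum>i=1..N. ?s i)"
    by (simp only: nascent_def sum.distrib sum_distrib_left)
  finally show ?thesis using s by simp
qed

text \<open>A cycle without crossings would stay in one block, but the values 1 and \<open>N\<close>
  lie in different blocks.\<close>

lemma nascent_pos:
  assumes e: "e permutes {1..N}"
  shows "nascent e > 0"
proof (rule ccontr)
  assume "\<not> nascent e > 0"
  then have "ncross e = 0" by (simp add: ncross_eq)
  then have c: "e i \<le> r1 \<longleftrightarrow> e (cyc_next N i) \<le> r1" if "i \<in> {1..N}" for i
    using that by (auto simp: ncross_def crossing_def split: if_splits)
  have const: "e i \<le> r1 \<longleftrightarrow> e 1 \<le> r1" if "i \<ge> 1" "i \<le> N" for i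
    using that
  proof (induction i rule: dec_induct)
    case (step i)
    with c[of i] show ?case by (auto simp: cyc_next_def)
  qed simp
  have img: "e ` {1..N} = {1..N}" by (rule permutes_image[OF e])
  have "1 \<in> {1..N}" "N \<in> {1..N}" by (simp_all add: N)
  with img obtain a b where "a \<in> {1..N}" "e a = 1" "b \<in> {1..N}" "e b = N" by (metis imageE)
  with const[of a] const[of b] show False by (simp add: N_eq r1 r2)
qed

lemma term_tendsto:
  assumes e: "e permutes {1..N}" and x: "inj_on x {1..N}"
  shows "(\<lambda>n. of_nat n ^ 2 / psi_at N e (shift x n)) \<longlonglongrightarrow> term_lim x e"
proof -
  have inv: "(\<lambda>n. 1 / of_nat n :: complex) \<longlonglongrightarrow> 0"
    using lim_inverse_n[where 'a=complex] by (simp add: inverse_eq_divide)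
  have fac: "(\<lambda>n. (shift x n a - shift x n b) * (1 / of_nat n) ^ crossing a b) \<longlonglongrightarrow> factor_lim x a b" for a b
  proof (cases "a \<le> r1 \<longleftrightarrow> b \<le> r1")
    case True
    then show ?thesis by (auto simp: shift_def crossing_def factor_lim_def)
  next
    case False
    define \<epsilon> :: complex where "\<epsilon> = (if a \<le> r1 then - 1 else 1)"
    have "(\<lambda>n. (x a - x b) * (1 / of_nat n) + \<epsilon>) \<longlonglongrightarrow> (x a - x b) * 0 + \<epsilon>"
      by (intro tendsto_intros inv)
    moreover have "\<forall>\<^sub>F n in sequentially. (x a - x b) * (1 / of_nat n) + \<epsilon>
        = (shift x n a - shift x n b) * (1 / of_nat n) ^ crossing a b"
      using eventually_gt_at_top[of 0]
      by eventually_elim (use False in \<open>auto simp: shift_def crossing_def \<epsilon>_def field_simps\<close>)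
    ultimately have "(\<lambda>n. (shift x n a - shift x n b) * (1 / of_nat n) ^ crossing a b) \<longlonglongrightarrow> (x a - x b) * 0 + \<epsilon>"
      by (rule Lim_transform_eventually)
    then show ?thesis using False by (simp add: factor_lim_def \<epsilon>_def)
  qed
  have fac0: "factor_lim x (e i) (e (cyc_next N i)) \<noteq> 0" if i: "i \<in> {1..N}" for i
  proof -
    have "e i \<in> {1..N}" "e (cyc_next N i) \<in> {1..N}" using i cyc_next_in[OF i] permutes_in_image[OF e] by blast+
    moreover have "e i \<noteq> e (cyc_next N i)"
      using permutes_inj[OF e] i by (auto simp: inj_eq cyc_next_def N split: if_splits)
    ultimately have "x (e i) \<noteq> x (e (cyc_next N i))" using x by (auto dest: inj_onD)
    then show ?thesis by (simp add: factor_lim_def)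
  qed
  let ?p = "\<Prod>i=1..N. factor_lim x (e i) (e (cyc_next N i))"
  have "(\<lambda>n. \<Prod>i=1..N. (shift x n (e i) - shift x n (e (cyc_next N i))) * (1 / of_nat n) ^ crossing (e i) (e (cyc_next N i)))
    \<longlonglongrightarrow> ?p"
    by (intro tendsto_prod fac)
  then have "(\<lambda>n. psi_at N e (shift x n) * (1 / of_nat n) ^ ncross e) \<longlonglongrightarrow> ?p"
    by (simp only: prod.distrib psi_at_def ncross_def power_sum)
  \<comment> \<open>\<open>psi_at\<close> grows like \<open>n ^ ncross e\<close>, and two of these
    powers are compensated. The surplus \<open>ncross e - 2\<close> forces the limit 0 unless it is
    itself 0, where \<open>0 ^ 0 = 1\<close>. The subtraction is not truncated, as there are at
    least two crossings.\<close>
  then have "(\<lambda>n. 1 / (psi_at N e (shift x n) * (1 / of_nat n) ^ ncross e) * (1 / of_nat n) ^ (ncross e - 2))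
    \<longlonglongrightarrow> 1 / ?p * 0 ^ (ncross e - 2)"
    using fac0 by (intro tendsto_mult tendsto_divide tendsto_power inv tendsto_const) auto
  moreover have "1 / ?p * 0 ^ (ncross e - 2) = term_lim x e"
    using nascent_pos[OF e] by (auto simp: term_lim_def ncross_eq power_0_left)
  moreover have "\<forall>\<^sub>F n in sequentially.
      1 / (psi_at N e (shift x n) * (1 / of_nat n) ^ ncross e) * (1 / of_nat n) ^ (ncross e - 2)
      = of_nat n ^ 2 / psi_at N e (shift x n)"
    using eventually_gt_at_top[of 0]
  proof eventually_elim
    case (elim n)
    have "ncross e = 2 + (ncross e - 2)" using nascent_pos[OF e] by (simp add: ncross_eq)
    then have "(1 / of_nat n :: complex) ^ ncross e = (1 / of_nat n) ^ 2 * (1 / of_nat n) ^ (ncross e - 2)"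
      by (metis power_add)
    with elim show ?case by (simp add: power_divide)
  qed
  ultimately show ?thesis by (simp add: tendsto_cong)
qed

lemma term_lim_rot: "term_lim x (e \<circ> rot N) = term_lim x e"
proof -
  have cyc_next: "rot N (cyc_next N i) = cyc_next N (rot N i)" if "i \<in> {1..N}" for i
    using cyc_next_in[OF that] that by (simp add: rot_def)
  have "nascent (e \<circ> rot N) = (\<Sum>i=1..N. ascent (e (rot N i)) (e (cyc_next N (rot N i))))"
    unfolding nascent_def by (intro sum.cong refl) (simp only: o_apply cyc_next)
  also have "\<dots> = nascent e"
    unfolding nascent_def by (rule sum.permute[OF rot_permutes, symmetric, unfolded o_def])
  finally have 1: "nascent (e \<circ> rot N) = nascent e" .
  have "(\<Prod>i=1..N. factor_lim x ((e \<circ> rot N) i) ((e \<circ> rot N) (cyc_next N i)))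
      = (\<Prod>i=1..N. factor_lim x (e (rot N i)) (e (cyc_next N (rot N i))))"
    by (intro prod.cong refl) (simp only: o_apply cyc_next)
  also have "\<dots> = (\<Prod>i=1..N. factor_lim x (e i) (e (cyc_next N i)))"
    by (rule prod.permute[OF rot_permutes, symmetric, unfolded o_def])
  finally show ?thesis by (simp only: term_lim_def 1)
qed

text \<open>These run through the first block and then through the second, so their only return is
  the closing edge; they represent the contributing cycles up to rotation.\<close>

definition split_EE :: "(nat \<Rightarrow> nat) set" where
  "split_EE = {e \<in> EE N. e ` {1..r1} = {1..r1}}"

lemma split_EE_le_iff:
  assumes "e permutes {1..N}" "e ` {1..r1} = {1..r1}" "i \<in> {1..N}"
  shows "e i \<le> r1 \<longleftrightarrow> i \<le> r1"
proof -
  have "e i \<in> {1..N}" using permutes_in_image[OF assms(1)] assms(3) by blast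
  then have "e i \<le> r1 \<longleftrightarrow> e i \<in> e ` {1..r1}" unfolding assms(2) by simp
  also have "\<dots> \<longleftrightarrow> i \<in> {1..r1}" using permutes_inj[OF assms(1)] by (rule inj_image_mem_iff)
  finally show ?thesis using assms(3) by simp
qed

text \<open>If the only return is the closing edge, a sequence that has left the first block stays
  out, so the positions with values up to \<open>r1\<close> form an initial segment, of length
  \<open>r1\<close> by counting.\<close>

lemma single_ascent:
  assumes e: "e permutes {1..N}" and one: "nascent e = 1" and top: "ascent (e N) (e 1) = 1"
  shows "e ` {1..r1} = {1..r1}"
proof -
  have N1: "N \<in> {1..N}" by (simp add: N)
  have "nascent e = ascent (e N) (e (cyc_next N N)) + (\<Sum>i\<in>{1..N} - {N}. ascent (e i) (e (cyc_next N i)))"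
    unfolding nascent_def by (rule sum.remove[OF _ N1]) simp
  with one top have "(\<Sum>i\<in>{1..N} - {N}. ascent (e i) (e (cyc_next N i))) = 0" by (simp add: cyc_next_def)
  then have 0: "ascent (e i) (e (Suc i)) = 0" if "1 \<le> i" "i < N" for i
    using that by (auto simp: cyc_next_def)
  have down: "e i \<le> r1" if "i \<le> j" "1 \<le> i" "j \<le> N" "e j \<le> r1" for i j
    using that
  proof (induction j rule: dec_induct)
    case (step j)
    with 0[of j] show ?case by (auto simp: ascent_def split: if_splits)
  qed simp
  define S where "S = {i \<in> {1..N}. e i \<le> r1}"
  have inj: "inj e" by (rule permutes_inj[OF e])
  have eS: "e ` S = {1..r1}"
  proof -
    have "e i \<in> {1..r1}" if "i \<in> S" for i
      using that permutes_in_image[OF e, of i] by (auto simp: S_def)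
    moreover have "k \<in> e ` S" if "k \<in> {1..r1}" for k
    proof -
      have "k \<in> e ` {1..N}" unfolding permutes_image[OF e] using that r1_less by auto
      then show ?thesis using that by (auto simp: S_def)
    qed
    ultimately show ?thesis by blast
  qed
  have card: "card S = r1" using card_image[OF inj_on_subset[OF inj], of S] eS by simp
  have fin: "finite S" by (simp add: S_def)
  have "S \<subseteq> {1..r1}"
  proof
    fix i assume i: "i \<in> S"
    then have "{1..i} \<subseteq> S" using down[of _ i] by (auto simp: S_def)
    from card_mono[OF fin this] have "i \<le> r1" unfolding card by simp
    with i show "i \<in> {1..r1}" by (simp add: S_def)
  qed
  then have "S = {1..r1}" using card by (intro card_subset_eq) auto
  with eS show ?thesis by simp
qed

text \<open>\<open>{1..r1}\<close> has one odd number more than even ones, so a map that flips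
  parities cannot preserve it: its alternating sum, which is -1, would equal its own
  negative.\<close>

lemma Alt_False_image:
  assumes "e \<in> Alt N False"
  shows "e ` {1..r1} \<noteq> {1..r1}"
proof
  assume img: "e ` {1..r1} = {1..r1}"
  have inj: "inj_on e {1..r1}" using permutes_inj[OF Alt_permutes[OF assms]] by (rule inj_on_subset) simp
  have alt: "(\<Sum>i=1..2*k+1. (-1) ^ i) = (-1 :: int)" for k
    by (induction k) simp_all
  have "(\<Sum>i=1..r1. (-1) ^ i) = (\<Sum>i\<in>e ` {1..r1}. (-1) ^ i :: int)" by (simp only: img)
  also have "\<dots> = (\<Sum>i=1..r1. (-1) ^ e i)" by (simp only: sum.reindex[OF inj] o_def)
  also have "\<dots> = (\<Sum>i=1..r1. - ((-1) ^ i))"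
  proof (rule sum.cong[OF refl])
    fix i assume "i \<in> {1..r1}"
    then have "i \<in> {1..N}" by (simp add: N_eq)
    from Alt_even[OF assms this] show "(-1) ^ e i = (- ((-1) ^ i) :: int)"
      by (cases "even i") simp_all
  qed
  also have "\<dots> = - (\<Sum>i=1..r1. (-1) ^ i)" by (rule sum_negf)
  finally show False using alt[of g1] by (simp only: r1)
qed

lemma nascent_split_EE:
  assumes "e permutes {1..N}" "e ` {1..r1} = {1..r1}"
  shows "nascent e = 1"
proof -
  have N1: "N \<in> {1..N}" by (simp add: N)
  have "ascent (e i) (e (cyc_next N i)) = (if i = N then 1 else 0)" if i: "i \<in> {1..N}" for i
    using split_EE_le_iff[OF assms i] split_EE_le_iff[OF assms cyc_next_in[OF i]] i r1_pos r1_less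
    by (auto simp: ascent_def cyc_next_def)
  then have "nascent e = (\<Sum>i=1..N. if i = N then 1 else 0)" unfolding nascent_def by simp
  then show ?thesis using N1 by simp
qed

text \<open>Mark the unique ascent of a contributing sequence; by rotation invariance it may be moved to
  the last position, and each of the \<open>N\<close> positions contributes equally.\<close>

lemma sum_term_lim: "(\<Sum>e\<in>EE N. term_lim x e) = of_nat (g+1) * (\<Sum>e\<in>split_EE. term_lim x e)"
proof -
  \<comment> \<open>Summing over both parity patterns lets a single rotation step permute the
    summands; within one pattern only double steps do.\<close>
  define A where "A = (\<lambda>i. \<Sum>b\<in>UNIV. \<Sum>e\<in>Alt N b. term_lim x e * of_nat (ascent (e i) (e (cyc_next N i))))"
  have A_rot: "A (cyc_next N i) = A i" if i: "i \<in> {1..N}" for i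
  proof -
    have "A i = (\<Sum>b\<in>UNIV. \<Sum>e\<in>Alt N (\<not> b). term_lim x e * of_nat (ascent (e i) (e (cyc_next N i))))"
      by (simp add: A_def UNIV_bool add.commute)
    moreover have "A (cyc_next N i) = (\<Sum>b\<in>UNIV. \<Sum>e\<in>Alt N b.
        term_lim x (e \<circ> rot N) * of_nat (ascent ((e \<circ> rot N) i) ((e \<circ> rot N) (cyc_next N i))))"
      using i cyc_next_in[OF i] by (simp only: A_def term_lim_rot o_apply) (simp add: rot_def)
    moreover have "(\<Sum>e\<in>Alt N b. term_lim x (e \<circ> rot N) * of_nat (ascent ((e \<circ> rot N) i) ((e \<circ> rot N) (cyc_next N i))))
        = (\<Sum>e\<in>Alt N (\<not> b). term_lim x e * of_nat (ascent (e i) (e (cyc_next N i))))" for b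
      using sum.reindex_bij_betw[OF bij_Alt_right[OF rot_in_Alt[OF even_N], of b],
          of "\<lambda>e. term_lim x e * of_nat (ascent (e i) (e (cyc_next N i)))"]
      by simp
    ultimately show ?thesis by simp
  qed
  have A1: "A i = A 1" if "i \<ge> 1" "i \<le> N" for i
    using that
  proof (induction i rule: dec_induct)
    case (step i)
    with A_rot[of i] show ?case by (auto simp: cyc_next_def)
  qed simp
  have N1: "N \<ge> 1" by (simp add: N)
  have "2 * (\<Sum>e\<in>EE N. term_lim x e) = (\<Sum>b\<in>UNIV. \<Sum>e\<in>Alt N b. term_lim x e)"
    using sum_Alt_rot[where F = "term_lim x", OF even_N term_lim_rot] by (simp add: UNIV_bool EE_eq_Alt)
  \<comment> \<open>\<open>term_lim\<close> vanishes unless \<open>nascent e = 1\<close>, so the new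
    factor changes nothing, but it can be expanded over the positions.\<close>
  also have "\<dots> = (\<Sum>b\<in>UNIV. \<Sum>e\<in>Alt N b. term_lim x e * of_nat (nascent e))"
    by (intro sum.cong refl) (simp add: term_lim_def)
  also have "\<dots> = (\<Sum>b\<in>UNIV. \<Sum>e\<in>Alt N b. \<Sum>i=1..N. term_lim x e * of_nat (ascent (e i) (e (cyc_next N i))))"
    by (simp only: nascent_def of_nat_sum sum_distrib_left)
  also have "\<dots> = (\<Sum>i=1..N. A i)"
  proof -
    have "(\<Sum>b\<in>UNIV. \<Sum>e\<in>Alt N b. \<Sum>i=1..N. term_lim x e * of_nat (ascent (e i) (e (cyc_next N i))))
      = (\<Sum>b\<in>UNIV. \<Sum>i=1..N. \<Sum>e\<in>Alt N b. term_lim x e * of_nat (ascent (e i) (e (cyc_next N i))))"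
      by (intro sum.cong refl sum.swap)
    also have "\<dots> = (\<Sum>i=1..N. A i)" unfolding A_def by (rule sum.swap)
    finally show ?thesis .
  qed
  also have "\<dots> = (\<Sum>i=1..N. A N)"
    by (intro sum.cong refl) (metis A1 N1 atLeastAtMost_iff order_refl)
  \<comment> \<open>There are \<open>N = 2 * (g+1)\<close> positions; the 2 cancels against the two
    parity patterns.\<close>
  also have "\<dots> = 2 * (of_nat (g+1) * A N)" by (simp add: N algebra_simps)
  also have "A N = (\<Sum>e\<in>split_EE. term_lim x e)"
  proof -
    have F: "term_lim x e * of_nat (ascent (e N) (e (cyc_next N N))) = 0"
      if e: "e \<in> Alt N b" "e ` {1..r1} \<noteq> {1..r1}" for e b
    proof (rule ccontr)
      assume *: "term_lim x e * of_nat (ascent (e N) (e (cyc_next N N))) \<noteq> 0"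
      then have "nascent e = 1" "ascent (e N) (e 1) = 1"
        by (auto simp: term_lim_def ascent_def cyc_next_def split: if_splits)
      from single_ascent[OF Alt_permutes[OF e(1)] this] e(2) show False by simp
    qed
    \<comment> \<open>A return at the closing edge forces \<open>e\<close> to preserve
      \<open>{1..r1}\<close>, which the flipped pattern rules out.\<close>
    have "(\<Sum>e\<in>Alt N False. term_lim x e * of_nat (ascent (e N) (e (cyc_next N N)))) = 0"
      using F[OF _ Alt_False_image] by (intro sum.neutral) blast
    moreover have "(\<Sum>e\<in>Alt N True. term_lim x e * of_nat (ascent (e N) (e (cyc_next N N))))
      = (\<Sum>e\<in>split_EE. term_lim x e * of_nat (ascent (e N) (e (cyc_next N N))))"
    proof (rule sum.mono_neutral_right)
      show "\<forall>e\<in>Alt N True - split_EE. term_lim x e * of_nat (ascent (e N) (e (cyc_next N N))) = 0"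
        using F unfolding split_EE_def EE_eq_Alt by blast
    qed (auto simp: split_EE_def EE_eq_Alt finite_Alt)
    moreover have "(\<Sum>e\<in>split_EE. term_lim x e * of_nat (ascent (e N) (e (cyc_next N N)))) = (\<Sum>e\<in>split_EE. term_lim x e)"
    proof (rule sum.cong[OF refl])
      fix e assume "e \<in> split_EE"
      then have e: "e permutes {1..N}" "e ` {1..r1} = {1..r1}" by (auto simp: split_EE_def EE_def)
      have "ascent (e N) (e (cyc_next N N)) = 1"
        using split_EE_le_iff[OF e, of N] split_EE_le_iff[OF e, of 1] r1_pos r1_less by (simp add: ascent_def cyc_next_def)
      then show "term_lim x e * of_nat (ascent (e N) (e (cyc_next N N))) = term_lim x e" by simp
    qed
    ultimately show ?thesis by (simp add: A_def UNIV_bool)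
  qed
  finally show ?thesis by simp
qed

section \<open>Cycles cut into pairs of paths\<close>

definition glue :: "(nat \<Rightarrow> nat) \<Rightarrow> (nat \<Rightarrow> nat) \<Rightarrow> nat \<Rightarrow> nat" where
  "glue p q i = (if i \<le> r1 then p i else if i \<le> N then r1 + q (i - r1) else i)"

definition lpart :: "(nat \<Rightarrow> nat) \<Rightarrow> nat \<Rightarrow> nat" where
  "lpart e i = (if i \<le> r1 then e i else i)"

definition rpart :: "(nat \<Rightarrow> nat) \<Rightarrow> nat \<Rightarrow> nat" where
  "rpart e j = (if j \<in> {1..r2} then e (r1 + j) - r1 else j)"

lemma glue_in_split_EE:
  assumes p: "p \<in> EE r1" and q: "q \<in> EE r2"
  shows "glue p q \<in> split_EE"
proof -
  have pp: "p permutes {1..r1}" and qp: "q permutes {1..r2}" using p q by (simp_all add: EE_def)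
  have p_in: "p i \<in> {1..r1}" if "i \<in> {1..r1}" for i using permutes_in_image[OF pp] that by blast
  have q_in: "q i \<in> {1..r2}" if "i \<in> {1..r2}" for i using permutes_in_image[OF qp] that by blast
  have gl: "glue p q i = p i" if "i \<in> {1..r1}" for i using that by (simp add: glue_def)
  have gr: "glue p q i = r1 + q (i - r1)" "i - r1 \<in> {1..r2}" if "i \<in> {r1<..N}" for i
    using that tail_diff_in by (auto simp: glue_def)
  have split: "i \<in> {1..r1} \<or> i \<in> {r1<..N}" if "i \<in> {1..N}" for i using that by auto
  have "glue p q permutes {1..N}"
  proof (rule permutesI_inj)
    show "inj_on (glue p q) {1..N}"
    proof (rule inj_onI)
      fix i j assume ij: "i \<in> {1..N}" "j \<in> {1..N}" and eq: "glue p q i = glue p q j"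
      consider "i \<in> {1..r1}" "j \<in> {1..r1}" | "i \<in> {1..r1}" "j \<in> {r1<..N}"
        | "i \<in> {r1<..N}" "j \<in> {1..r1}" | "i \<in> {r1<..N}" "j \<in> {r1<..N}"
        using split[OF ij(1)] split[OF ij(2)] by blast
      then show "i = j"
      proof cases
        case 1 then show ?thesis using eq permutes_inj[OF pp] by (simp add: gl inj_eq)
      next
        case 2 then show ?thesis using eq p_in[of i] q_in[OF gr(2)[of j]] by (simp add: gl gr(1))
      next
        case 3 then show ?thesis using eq p_in[of j] q_in[OF gr(2)[of i]] by (simp add: gl gr(1))
      next
        case 4
        then have "i - r1 = j - r1" using eq permutes_inj[OF qp] by (simp add: gr(1) inj_eq)
        with 4 show ?thesis by auto
      qed
    qed
    show "glue p q ` {1..N} \<subseteq> {1..N}"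
    proof
      fix k assume "k \<in> glue p q ` {1..N}"
      then obtain i where i: "i \<in> {1..N}" "k = glue p q i" by blast
      from split[OF i(1)] show "k \<in> {1..N}"
      proof
        assume "i \<in> {1..r1}" with p_in[OF this] r1_less show ?thesis by (simp add: i gl)
      next
        assume "i \<in> {r1<..N}" with tail_in[OF q_in[OF gr(2)[OF this]]] show ?thesis by (simp add: i gr(1))
      qed
    qed
    fix i assume "i \<notin> {1..N}"
    \<comment> \<open>Index 0 falls into the first branch of \<open>glue\<close>, where
      \<open>p\<close> fixes it.\<close>
    then have "i = 0 \<or> i > N" by auto
    then show "glue p q i = i"
      using permutes_not_in[OF pp, of 0] r1_less by (auto simp: glue_def)
  qed simp
  moreover have "even (glue p q i) \<longleftrightarrow> even i" if i: "i \<in> {1..N}" for i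
    using split[OF i]
  proof
    assume "i \<in> {1..r1}" then show ?thesis using p by (simp add: gl EE_def)
  next
    assume i: "i \<in> {r1<..N}"
    \<comment> \<open>Position and value are shifted by the same \<open>r1\<close>, so the agreement
      of their parities carries over.\<close>
    have "even (q (i - r1)) \<longleftrightarrow> even (i - r1)" using q gr(2)[OF i] by (simp add: EE_def)
    moreover have "odd r1" by (simp add: r1)
    ultimately show ?thesis using i by (auto simp: gr(1))
  qed
  moreover have "glue p q ` {1..r1} = {1..r1}"
    using permutes_image[OF pp] gl by (metis image_cong)
  ultimately show ?thesis by (simp add: split_EE_def EE_def)
qed

lemma parts_of_split_EE:
  assumes e: "e \<in> split_EE"
  shows "lpart e \<in> EE r1" and "rpart e \<in> EE r2" and "glue (lpart e) (rpart e) = e"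
proof -
  have ep: "e permutes {1..N}" and img: "e ` {1..r1} = {1..r1}"
    and par: "\<And>i. i \<in> {1..N} \<Longrightarrow> even (e i) \<longleftrightarrow> even i"
    using e by (auto simp: split_EE_def EE_def)
  have inj: "inj e" by (rule permutes_inj[OF ep])
  have hi: "e (r1 + j) \<in> {r1<..N}" if "j \<in> {1..r2}" for j
    using tail_in[OF that] permutes_in_image[OF ep, of "r1+j"] split_EE_le_iff[OF ep img, of "r1+j"] by auto
  have "lpart e permutes {1..r1}"
  proof (rule permutesI_inj)
    show "inj_on (lpart e) {1..r1}" by (rule inj_onI) (simp add: lpart_def inj_eq[OF inj])
    show "lpart e ` {1..r1} \<subseteq> {1..r1}"
      using img by (auto simp: lpart_def)
    show "lpart e i = i" if "i \<notin> {1..r1}" for i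
      using that permutes_not_in[OF ep, of 0] by (cases "i = 0") (auto simp: lpart_def)
  qed simp
  moreover have "even (lpart e i) \<longleftrightarrow> even i" if "i \<in> {1..r1}" for i
    using that par[of i] r1_less by (simp add: lpart_def)
  ultimately show "lpart e \<in> EE r1" by (simp add: EE_def)
  have "rpart e permutes {1..r2}"
  proof (rule permutesI_inj)
    show "inj_on (rpart e) {1..r2}"
    proof (rule inj_onI)
      fix i j assume ij: "i \<in> {1..r2}" "j \<in> {1..r2}" "rpart e i = rpart e j"
      then have "e (r1 + i) = e (r1 + j)" using hi[OF ij(1)] hi[OF ij(2)] by (simp add: rpart_def eq_diff_iff)
      then show "i = j" by (simp add: inj_eq[OF inj])
    qed
    show "rpart e ` {1..r2} \<subseteq> {1..r2}"
    proof
      fix k assume "k \<in> rpart e ` {1..r2}"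
      then obtain j where j: "j \<in> {1..r2}" "k = rpart e j" by blast
      with tail_diff_in[OF hi[OF j(1)]] show "k \<in> {1..r2}" by (auto simp: rpart_def)
    qed
  qed (auto simp: rpart_def)
  moreover have "even (rpart e j) \<longleftrightarrow> even j" if j: "j \<in> {1..r2}" for j
  proof -
    have "even (e (r1 + j)) \<longleftrightarrow> even (r1 + j)" using tail_in[OF j] by (intro par) auto
    moreover have "odd r1" by (simp add: r1)
    ultimately show ?thesis using hi[OF j] j by (auto simp: rpart_def)
  qed
  ultimately show "rpart e \<in> EE r2" by (simp add: EE_def)
  show "glue (lpart e) (rpart e) = e"
  proof
    fix i
    consider "i \<le> r1" | "i \<in> {r1<..N}" | "i > N" by force
    then show "glue (lpart e) (rpart e) i = e i"
    proof cases
      case 2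
      then have "i - r1 \<in> {1..r2}" by (rule tail_diff_in)
      with hi[OF this] 2 show ?thesis by (simp add: glue_def rpart_def)
    next
      case 3
      with permutes_not_in[OF ep, of i] r1_less show ?thesis by (simp add: glue_def)
    qed (simp add: glue_def lpart_def)
  qed
qed

lemma parts_glue:
  assumes "p \<in> EE r1" "q \<in> EE r2"
  shows "lpart (glue p q) = p" "rpart (glue p q) = q"
proof -
  have pp: "p permutes {1..r1}" and qp: "q permutes {1..r2}" using assms by (simp_all add: EE_def)
  show "lpart (glue p q) = p"
    using permutes_not_in[OF pp] by (auto simp: lpart_def glue_def fun_eq_iff)
  show "rpart (glue p q) = q"
    using permutes_not_in[OF qp] tail_in by (auto simp: rpart_def glue_def fun_eq_iff)
qed

text \<open>The closing edge contributes 1 and the edge that leaves position \<open>r1\<close>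
  contributes -1; this sign later cancels the one in \<open>H_at\<close>. All other edges stay
  within a block and form the two paths.\<close>

lemma prod_factor_lim_split_EE:
  assumes e: "e \<in> split_EE"
  shows "(\<Prod>i=1..N. factor_lim x (e i) (e (cyc_next N i))) = - (psi'_at r1 (lpart e) x * psi'_at r2 (rpart e) (ptail x))"
proof -
  have ep: "e permutes {1..N}" and img: "e ` {1..r1} = {1..r1}"
    using e by (auto simp: split_EE_def EE_def)
  note le = split_EE_le_iff[OF ep img]
  have hi: "e (r1 + j) \<in> {r1<..N}" if "j \<in> {1..r2}" for j
    using tail_in[OF that] permutes_in_image[OF ep, of "r1+j"] le[of "r1+j"] by auto
  let ?f = "\<lambda>i. factor_lim x (e i) (e (cyc_next N i))"
  have set: "{1..N} = insert N (insert r1 ({1..r1-1} \<union> {r1+1..N-1}))"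
    by (auto simp: N_eq r1 r2)
  have "prod ?f {1..N} = ?f N * (?f r1 * (prod ?f {1..r1-1} * prod ?f {r1+1..N-1}))"
    unfolding set
    by (subst prod.insert, simp, use N_eq r1 r2 in force, subst prod.insert, simp, use N_eq r1 r2 in force,
        subst prod.union_disjoint) auto
  also have "?f N = 1"
    using le[of N] le[of 1] r1_pos r1_less by (simp add: factor_lim_def cyc_next_def)
  also have "?f r1 = - 1"
    using le[of r1] le[of "r1+1"] r1_pos r1_less by (simp add: factor_lim_def cyc_next_def)
  also have "prod ?f {1..r1-1} = psi'_at r1 (lpart e) x"
    unfolding psi'_at_def
  proof (rule prod.cong[OF refl])
    fix i assume i: "i \<in> {1..r1-1}"
    then have "i \<in> {1..N}" "i + 1 \<in> {1..N}" "i \<noteq> N" by (auto simp: N_eq)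
    with i le[of i] le[of "i+1"] r1_less show "?f i = x (lpart e i) - x (lpart e (i+1))"
      by (auto simp: factor_lim_def cyc_next_def lpart_def)
  qed
  also have "prod ?f {r1+1..N-1} = psi'_at r2 (rpart e) (ptail x)"
    unfolding psi'_at_def
  proof (rule prod.reindex_bij_witness[of _ "\<lambda>j. r1 + j" "\<lambda>i. i - r1"])
    fix i assume i: "i \<in> {r1+1..N-1}"
    then have j: "i - r1 \<in> {1..r2}" "i - r1 + 1 \<in> {1..r2}" by (auto simp: N_eq)
    have "i \<in> {1..N}" "i + 1 \<in> {1..N}" "i \<noteq> N" using i by (auto simp: N_eq)
    then have "?f i = x (e i) - x (e (i+1))"
      using i le[of i] le[of "i+1"] by (auto simp: factor_lim_def cyc_next_def)
    moreover have "e i = r1 + rpart e (i - r1)" "e (i+1) = r1 + rpart e (i - r1 + 1)"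
      using i j hi[OF j(1)] hi[OF j(2)] by (auto simp: rpart_def)
    ultimately show "ptail x (rpart e (i - r1)) - ptail x (rpart e (i - r1 + 1)) = ?f i"
      by (simp add: ptail_def)
  qed (auto simp: N_eq)
  finally show ?thesis by simp
qed

lemma sum_split_EE:
  "(\<Sum>e\<in>split_EE. term_lim x e) = - (\<Sum>p\<in>EE r1. 1 / psi'_at r1 p x) * (\<Sum>q\<in>EE r2. 1 / psi'_at r2 q (ptail x))"
proof -
  have "(\<Sum>e\<in>split_EE. term_lim x e) = (\<Sum>e\<in>split_EE. - (1 / psi'_at r1 (lpart e) x * (1 / psi'_at r2 (rpart e) (ptail x))))"
  proof (rule sum.cong[OF refl])
    fix e assume e: "e \<in> split_EE"
    then have "nascent e = 1" by (intro nascent_split_EE) (auto simp: split_EE_def EE_def)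
    with prod_factor_lim_split_EE[OF e] show "term_lim x e = - (1 / psi'_at r1 (lpart e) x * (1 / psi'_at r2 (rpart e) (ptail x)))"
      by (simp add: term_lim_def)
  qed
  also have "\<dots> = (\<Sum>(p, q)\<in>EE r1 \<times> EE r2. - (1 / psi'_at r1 p x * (1 / psi'_at r2 q (ptail x))))"
    by (rule sum.reindex_bij_witness[of _ "\<lambda>(p, q). glue p q" "\<lambda>e. (lpart e, rpart e)"])
      (auto simp: parts_of_split_EE parts_glue glue_in_split_EE)
  also have "\<dots> = (\<Sum>p\<in>EE r1. \<Sum>q\<in>EE r2. - (1 / psi'_at r1 p x * (1 / psi'_at r2 q (ptail x))))"
    by (rule sum.cartesian_product[symmetric])
  also have "\<dots> = - (\<Sum>p\<in>EE r1. 1 / psi'_at r1 p x) * (\<Sum>q\<in>EE r2. 1 / psi'_at r2 q (ptail x))"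
    by (simp only: sum_negf sum_product mult_minus_left)
  finally show ?thesis .
qed

section \<open>Asymptotics of \<open>Delta_at\<close> and \<open>H_at\<close> under translation of
  the second block\<close>

lemma Delta_at_tendsto:
  "(\<lambda>n. Delta_at {1..N} (shift x n) / of_nat n ^ (r1 * r2)) \<longlonglongrightarrow> Delta_at {1..r1} x * Delta_at {1..r2} (ptail x)"
proof -
  have inv: "(\<lambda>n. 1 / of_nat n :: complex) \<longlonglongrightarrow> 0"
    using lim_inverse_n[where 'a=complex] by (simp add: inverse_eq_divide)
  let ?C = "{r1+1..N} \<times> {1..r1}" and ?P2 = "(\<lambda>(i, j). (r1 + i, r1 + j)) ` pairs {1..r2}"
  have pairs: "pairs {1..N} = pairs {1..r1} \<union> (?P2 \<union> ?C)"
  proof (intro equalityI subsetI)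
    fix p assume "p \<in> pairs {1..N}"
    then obtain i j where p: "p = (i, j)" "i \<in> {1..N}" "j \<in> {1..N}" "i > j" by (auto simp: pairs_def)
    consider "i \<le> r1" | "j > r1" | "i > r1" "j \<le> r1" by linarith
    then show "p \<in> pairs {1..r1} \<union> (?P2 \<union> ?C)"
    proof cases
      case 2
      then have "(i - r1, j - r1) \<in> pairs {1..r2}" "p = (\<lambda>(i, j). (r1 + i, r1 + j)) (i - r1, j - r1)"
        using p by (auto simp: pairs_def N_eq)
      then show ?thesis by blast
    qed (use p in \<open>auto simp: pairs_def\<close>)
  qed (auto simp: pairs_def N_eq)
  have Delta_at: "Delta_at {1..N} (shift x n) = Delta_at {1..r1} x * Delta_at {1..r2} (ptail x) * (\<Prod>(i, j)\<in>?C. x i - x j + of_nat n)" for n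
  proof -
    let ?d = "\<lambda>(i, j). shift x n i - shift x n j"
    have "Delta_at {1..N} (shift x n) = prod ?d (pairs {1..r1}) * (prod ?d ?P2 * prod ?d ?C)"
      unfolding Delta_at_def pairs
      by (subst prod.union_disjoint, (simp add: finite_pairs), (simp add: finite_pairs), (force simp: pairs_def),
          subst prod.union_disjoint) (simp_all add: finite_pairs, force simp: pairs_def)
    moreover have "prod ?d (pairs {1..r1}) = Delta_at {1..r1} x"
      unfolding Delta_at_def by (intro prod.cong) (auto simp: pairs_def shift_def)
    moreover have "prod ?d ?P2 = Delta_at {1..r2} (ptail x)"
      unfolding Delta_at_def
      by (subst prod.reindex) (auto intro!: inj_onI prod.cong simp: pairs_def shift_def ptail_def)
    moreover have "prod ?d ?C = (\<Prod>(i, j)\<in>?C. x i - x j + of_nat n)"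
      by (intro prod.cong) (auto simp: shift_def)
    ultimately show ?thesis by simp
  qed
  \<comment> \<open>Each of the \<open>r1 * r2\<close> differences across the blocks is larger index
    minus smaller, so it grows like \<open>n\<close> with no sign.\<close>
  have "(\<lambda>n. Delta_at {1..r1} x * Delta_at {1..r2} (ptail x) * (\<Prod>p\<in>?C. (x (fst p) - x (snd p)) * (1 / of_nat n) + 1))
     \<longlonglongrightarrow> Delta_at {1..r1} x * Delta_at {1..r2} (ptail x) * (\<Prod>p\<in>?C. (x (fst p) - x (snd p)) * 0 + 1)"
    by (intro tendsto_intros inv)
  moreover have "\<forall>\<^sub>F n in sequentially. Delta_at {1..r1} x * Delta_at {1..r2} (ptail x) *
      (\<Prod>p\<in>?C. (x (fst p) - x (snd p)) * (1 / of_nat n) + 1) = Delta_at {1..N} (shift x n) / of_nat n ^ (r1 * r2)"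
    using eventually_gt_at_top[of 0]
  proof eventually_elim
    case (elim n)
    have "card ?C = r1 * r2" by (simp add: N_eq)
    then have "of_nat n ^ (r1 * r2) = (\<Prod>p\<in>?C. of_nat n :: complex)" by (simp only: prod_constant)
    then have "(\<Prod>(i, j)\<in>?C. x i - x j + of_nat n) / of_nat n ^ (r1 * r2)
      = (\<Prod>p\<in>?C. (x (fst p) - x (snd p) + of_nat n) / of_nat n)"
      by (simp only: prod_dividef case_prod_unfold)
    also have "\<dots> = (\<Prod>p\<in>?C. (x (fst p) - x (snd p)) * (1 / of_nat n) + 1)"
      using elim by (intro prod.cong refl) (simp add: field_simps)
    finally show ?case unfolding Delta_at by (simp only: times_divide_eq_right[symmetric])
  qed
  ultimately show ?thesis by (simp add: tendsto_cong)
qed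

text \<open>For each pair of positions at most one \<open>n\<close> makes the shifted values
  collide, so the formula \<open>H_at\<close> is available for all large \<open>n\<close>.\<close>

lemma shift_inj: "\<forall>\<^sub>F n in sequentially. inj_on (shift x n) {1..N}" if x: "inj_on x {1..N}"
proof -
  have "\<forall>\<^sub>F n in sequentially. of_nat n \<noteq> (z :: complex)" for z
    by (rule eventually_compose_filterlim[OF eventually_not_equal_at_infinity tendsto_of_nat])
  then have "\<forall>\<^sub>F n in sequentially. \<forall>p\<in>{1..N} \<times> {1..N}. of_nat n \<noteq> x (fst p) - x (snd p)"
    by (intro eventually_ball_finite) auto
  then show ?thesis
  proof eventually_elim
    case (elim n)
    have ne: "of_nat n \<noteq> x i - x j" if "i \<in> {1..N}" "j \<in> {1..N}" for i j
      using bspec[OF elim, of "(i, j)"] that by simp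
    show ?case
    proof (rule inj_onI)
      fix i j assume ij: "i \<in> {1..N}" "j \<in> {1..N}" "shift x n i = shift x n j"
      with ne[of i j] ne[of j i] have "x i = x j" by (auto simp: shift_def algebra_simps split: if_splits)
      with ij x show "i = j" by (auto dest: inj_onD)
    qed
  qed
qed

lemma H_at_tendsto:
  assumes x: "inj_on x {1..N}"
  shows "(\<lambda>n. H_at g (shift x n) / of_nat n ^ (4 * (2*g1*g2 + g1 + g2))) \<longlonglongrightarrow> star_H_at g1 x * star_H_at g2 (ptail x)"
proof -
  let ?c = "1 / 2 ^ g * (1 / of_nat (g+1)) :: complex" and ?K = "4 * (2*g1*g2 + g1 + g2)"
  have lim: "(\<lambda>n. of_nat n ^ 2 / psi_at N e (shift x n)) \<longlonglongrightarrow> term_lim x e" if "e \<in> EE N" for e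
    using that x by (intro term_tendsto) (auto simp: EE_def)
  have "(\<lambda>n. ?c * (Delta_at {1..N} (shift x n) / of_nat n ^ (r1 * r2)) ^ 2 *
      (\<Sum>e\<in>EE N. - (of_nat n ^ 2 / psi_at N e (shift x n))))
    \<longlonglongrightarrow> ?c * (Delta_at {1..r1} x * Delta_at {1..r2} (ptail x)) ^ 2 * (\<Sum>e\<in>EE N. - term_lim x e)"
    by (intro tendsto_mult tendsto_power tendsto_sum tendsto_minus tendsto_const Delta_at_tendsto lim)
  moreover have "?c * (Delta_at {1..r1} x * Delta_at {1..r2} (ptail x)) ^ 2 * (\<Sum>e\<in>EE N. - term_lim x e)
      = star_H_at g1 x * star_H_at g2 (ptail x)"
  proof -
    \<comment> \<open>The factor \<open>g+1\<close> from \<open>sum_term_lim\<close> cancels the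
      normalisation, and \<open>2 ^ g\<close> splits along \<open>g = g1 + g2\<close>.\<close>
    have "of_nat (g+1) \<noteq> (0::complex)" by (simp only: of_nat_eq_0_iff)
    then have c: "?c * D * (of_nat (g+1) * S) = 1 / 2 ^ g1 * (1 / 2 ^ g2) * D * S" for D S
      by (simp add: g power_add del: of_nat_add of_nat_Suc)
    have "(\<Sum>e\<in>EE N. - term_lim x e) = of_nat (g+1) *
        ((\<Sum>p\<in>EE r1. 1 / psi'_at r1 p x) * (\<Sum>q\<in>EE r2. 1 / psi'_at r2 q (ptail x)))"
      by (simp only: sum_negf sum_term_lim sum_split_EE mult_minus_left minus_minus mult_minus_right)
    then show ?thesis
      unfolding star_H_at_def r1[symmetric] r2[symmetric] by (simp only: c) (simp only: power_mult_distrib mult_ac)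
  qed
  moreover have "\<forall>\<^sub>F n in sequentially. ?c * (Delta_at {1..N} (shift x n) / of_nat n ^ (r1 * r2)) ^ 2 *
      (\<Sum>e\<in>EE N. - (of_nat n ^ 2 / psi_at N e (shift x n))) = H_at g (shift x n) / of_nat n ^ ?K"
    using eventually_gt_at_top[of 0]
  proof eventually_elim
    case (elim n)
    \<comment> \<open>This is \<open>2 * r1 * r2 = 4 * (2*g1*g2 + g1 + g2) + 2\<close>; the
      remaining two powers go to \<open>psi_at\<close>.\<close>
    have "(of_nat n ^ (r1 * r2)) ^ 2 = (of_nat n :: complex) ^ ?K * of_nat n ^ 2"
      unfolding power_mult[symmetric] power_add[symmetric]
      by (rule arg_cong[of _ _ "power (of_nat n)"]) (simp add: r1 r2 algebra_simps)
    moreover have "(\<Sum>e\<in>EE N. - (of_nat n ^ 2 / psi_at N e (shift x n)))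
        = of_nat n ^ 2 * (\<Sum>e\<in>EE N. - 1 / psi_at N e (shift x n))"
      by (simp add: sum_distrib_left)
    moreover have "H_at g (shift x n) = ?c * Delta_at {1..N} (shift x n) ^ 2 * (\<Sum>e\<in>EE N. - 1 / psi_at N e (shift x n))"
      unfolding H_at_def Bset_def N[symmetric] ..
    ultimately show ?case using elim by (simp add: power_divide)
  qed
  ultimately show ?thesis by (simp add: tendsto_cong)
qed

lemma meval_Hpoly_tendsto:
  assumes x: "inj_on x {1..N}" and "g \<ge> 1"
  shows "(\<lambda>n. meval (shift x n) (Hpoly g) / of_nat n ^ (4 * (2*g1*g2 + g1 + g2))) \<longlonglongrightarrow> star_H_at g1 x * star_H_at g2 (ptail x)"
proof (rule Lim_transform_eventually[OF H_at_tendsto[OF x]])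
  show "\<forall>\<^sub>F n in sequentially. H_at g (shift x n) / of_nat n ^ (4 * (2*g1*g2 + g1 + g2))
      = meval (shift x n) (Hpoly g) / of_nat n ^ (4 * (2*g1*g2 + g1 + g2))"
    using shift_inj[OF x]
    by eventually_elim (simp add: meval_Hpoly[OF assms(2)] Bset_def N)
qed

end

subsection \<open>The star map, the Witt map and the theorem\<close>

text \<open>A relation, since a rational function may have no value at \<open>x\<close>. It carries
  the identity that defines \<open>Sw\<close> from the field of fractions to complex points.\<close>

definition fract_eval :: "(nat \<Rightarrow> complex) \<Rightarrow> nat mpoly fract \<Rightarrow> complex \<Rightarrow> bool" where
  "fract_eval x z y \<longleftrightarrow> (\<exists>p q. meval x q \<noteq> 0 \<and> z = to_fract p / to_fract q \<and> y = meval x p / meval x q)"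

lemma fract_eval_to_fract: "fract_eval x (to_fract p) (meval x p)"
  unfolding fract_eval_def by (rule exI[of _ p], rule exI[of _ 1]) simp

lemma meval_nonzero_imp: "meval x q \<noteq> 0 \<Longrightarrow> to_fract q \<noteq> 0"
  by auto

lemma fract_eval_add:
  assumes "fract_eval x z y" "fract_eval x z' y'"
  shows "fract_eval x (z + z') (y + y')"
proof -
  obtain p q p' q' where *: "meval x q \<noteq> 0" "z = to_fract p / to_fract q" "y = meval x p / meval x q"
    "meval x q' \<noteq> 0" "z' = to_fract p' / to_fract q'" "y' = meval x p' / meval x q'"
    using assms by (auto simp: fract_eval_def)
  with meval_nonzero_imp[OF *(1)] meval_nonzero_imp[OF *(4)] show ?thesis
    unfolding fract_eval_def
    by (intro exI[of _ "p * q' + p' * q"] exI[of _ "q * q'"]) (simp add: add_frac_eq)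
qed

lemma fract_eval_mult:
  assumes "fract_eval x z y" "fract_eval x z' y'"
  shows "fract_eval x (z * z') (y * y')"
proof -
  obtain p q p' q' where *: "meval x q \<noteq> 0" "z = to_fract p / to_fract q" "y = meval x p / meval x q"
    "meval x q' \<noteq> 0" "z' = to_fract p' / to_fract q'" "y' = meval x p' / meval x q'"
    using assms by (auto simp: fract_eval_def)
  then show ?thesis
    unfolding fract_eval_def by (intro exI[of _ "p * p'"] exI[of _ "q * q'"]) simp
qed

lemma fract_eval_inverse:
  assumes "fract_eval x z y" "y \<noteq> 0"
  shows "fract_eval x (1 / z) (1 / y)"
proof -
  obtain p q where *: "meval x q \<noteq> 0" "z = to_fract p / to_fract q" "y = meval x p / meval x q"
    using assms(1) by (auto simp: fract_eval_def)
  with assms(2) show ?thesis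
    unfolding fract_eval_def by (intro exI[of _ q] exI[of _ p]) auto
qed

lemma fract_eval_divide:
  "fract_eval x z y \<Longrightarrow> fract_eval x z' y' \<Longrightarrow> y' \<noteq> 0 \<Longrightarrow> fract_eval x (z / z') (y / y')"
  using fract_eval_mult[OF _ fract_eval_inverse, of x z y z' y'] by simp

lemma fract_eval_power: "fract_eval x z y \<Longrightarrow> fract_eval x (z ^ n) (y ^ n)"
  using fract_eval_to_fract[of x 1] by (induction n) (simp_all add: fract_eval_mult)

lemma fract_eval_prod:
  "(\<And>a. a \<in> A \<Longrightarrow> fract_eval x (f a) (h a)) \<Longrightarrow> fract_eval x (prod f A) (prod h A)"
  using fract_eval_to_fract[of x 1]
  by (induction A rule: infinite_finite_induct) (simp_all add: fract_eval_mult)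

lemma fract_eval_sum:
  "(\<And>a. a \<in> A \<Longrightarrow> fract_eval x (f a) (h a)) \<Longrightarrow> fract_eval x (sum f A) (sum h A)"
  using fract_eval_to_fract[of x 0]
  by (induction A rule: infinite_finite_induct) (simp_all add: fract_eval_add)

lemma fract_eval_unique:
  assumes "fract_eval x z y" "fract_eval x z y'"
  shows "y = y'"
proof -
  obtain p q p' q' where *: "meval x q \<noteq> 0" "z = to_fract p / to_fract q" "y = meval x p / meval x q"
    "meval x q' \<noteq> 0" "z = to_fract p' / to_fract q'" "y' = meval x p' / meval x q'"
    using assms unfolding fract_eval_def by blast
  with meval_nonzero_imp[OF *(1)] meval_nonzero_imp[OF *(4)]
  have "to_fract (p * q') = to_fract (p' * q)" by (simp add: frac_eq_eq)
  then have "p * q' = p' * q" by (simp only: to_fract_eq_iff)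
  from arg_cong[OF this, of "meval x"] * show ?thesis by (simp add: frac_eq_eq)
qed

section \<open>Values of elements of \<open>Sw\<close>\<close>

lemma Sw_polys: "f \<in> Sw w r \<Longrightarrow> f \<in> polys r"
  by (simp add: Sw_def)

lemma Sw_meval:
  fixes A B C D :: real
  assumes f: "f \<in> Sw w r" and det: "A * D - B * C = 1"
    and x: "\<And>i. i \<in> {1..r} \<Longrightarrow> of_real C * x i + of_real D \<noteq> 0"
  shows "meval x f = meval (\<lambda>i. (of_real A * x i + of_real B) / (of_real C * x i + of_real D)) f
    * (\<Prod>i=1..r. (of_real C * x i + of_real D) ^ w)"
proof -
  define k where "k = (\<lambda>x :: real. to_fract (Const (complex_of_real x) :: nat mpoly))"
  define a where "a = (\<lambda>i :: nat. to_fract (Var i :: nat mpoly))"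
  have lin: "fract_eval x (k b * a i + k c) (of_real b * x i + of_real c)" for b c i
    unfolding k_def a_def
    using fract_eval_to_fract[of x "Const (of_real b) * Var i + Const (of_real c)"] by simp
  have eq: "to_fract f = insertion (\<lambda>c. to_fract (Const c)) (\<lambda>i. (k A * a i + k B) / (k C * a i + k D)) f
     * (\<Prod>i=1..r. (k C * a i + k D) ^ w)"
    using f det unfolding Sw_def Let_def k_def a_def by blast
  have keys: "v \<in> {1..r}" if "m \<in> Poly_Mapping.keys f" "v \<in> Poly_Mapping.keys m" for m v
    using Sw_polys[OF f] that unfolding polys_def by blast
  have con: "fract_eval x (to_fract (Const c)) c" for c
    using fract_eval_to_fract[of x "Const c"] by simp
  have "fract_eval x (insertion (\<lambda>c. to_fract (Const c)) (\<lambda>i. (k A * a i + k B) / (k C * a i + k D)) f)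
     (insertion (\<lambda>c. c) (\<lambda>i. (of_real A * x i + of_real B) / (of_real C * x i + of_real D)) f)"
    unfolding insertion_def using keys x
    by (intro fract_eval_sum fract_eval_mult con fract_eval_prod fract_eval_power fract_eval_divide lin) blast
  then have "fract_eval x (to_fract f)
    (meval (\<lambda>i. (of_real A * x i + of_real B) / (of_real C * x i + of_real D)) f
    * (\<Prod>i=1..r. (of_real C * x i + of_real D) ^ w))"
    unfolding eq meval_def by (intro fract_eval_mult fract_eval_prod fract_eval_power lin)
  then show ?thesis by (rule fract_eval_unique[OF fract_eval_to_fract])
qed

text \<open>Invariance under the matrix with rows (1, b) and (0, 1). Its entries are real, and this
  is what ties the later arguments to real points.\<close>

lemma Sw_translate:
  assumes "f \<in> Sw w r" "b \<in> \<real>"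
  shows "meval (\<lambda>i. x i + b) f = meval x f"
proof -
  obtain b' where b: "b = of_real b'" using assms(2) by (auto elim: Reals_cases)
  show ?thesis using Sw_meval[OF assms(1), of 1 1 b' 0 x] by (simp add: b)
qed

lemma Sw_invert:
  assumes "f \<in> Sw w r" "\<And>i. i \<in> {1..r} \<Longrightarrow> x i \<noteq> 0"
  shows "meval x f = meval (\<lambda>i. - 1 / x i) f * (\<Prod>i=1..r. x i ^ w)"
  using Sw_meval[OF assms(1), of 0 0 "-1" 1 x] assms(2) by simp

definition star_poly :: "nat \<Rightarrow> nat mpoly \<Rightarrow> nat mpoly poly" where
  "star_poly r f = insertion (\<lambda>c. [:Const c:]) (\<lambda>i. if i = r then [:0, 1:] else [:Var i:]) f"

lemma meval_star_poly: "meval x (poly (star_poly r f) (Const t)) = meval (x(r := t)) f"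
proof -
  have "(\<lambda>v. meval x (poly (if v = r then [:0, 1:] else [:Var v:]) (Const t))) = x(r := t)"
    by (rule ext) simp
  then show ?thesis unfolding star_poly_def meval_poly_insertion by simp
qed

text \<open>The image of \<open>x\<close> under inversion once coordinate \<open>r\<close> has gone
  to infinity.\<close>

definition inv_pt :: "nat \<Rightarrow> (nat \<Rightarrow> complex) \<Rightarrow> nat \<Rightarrow> complex" where
  "inv_pt r x i = (if i = r then 0 else - 1 / x i)"

text \<open>Inversion exchanges the value \<open>n\<close> at \<open>r\<close> for
  \<open>- 1 / n\<close>, so the limit is a value of a continuous function at 0; the automorphy
  factor supplies exactly \<open>n ^ w\<close>.\<close>

lemma Sw_limit:
  assumes f: "f \<in> Sw w r" and r: "r \<ge> 1" and x: "\<And>i. x i \<noteq> 0"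
  shows "(\<lambda>n. meval (x(r := of_nat n)) f / of_nat n ^ w) \<longlonglongrightarrow> meval (inv_pt r x) f * (\<Prod>i=1..r-1. x i ^ w)"
proof -
  let ?p = "map_poly (meval (inv_pt r x)) (star_poly r f)"
  have p: "poly ?p t = meval ((inv_pt r x)(r := t)) f" for t
    by (simp add: poly_map_poly_meval meval_star_poly)
  have "(\<lambda>n. inverse (of_nat n) :: complex) \<longlonglongrightarrow> 0" by (rule lim_inverse_n)
  then have "(\<lambda>n. - inverse (of_nat n) :: complex) \<longlonglongrightarrow> 0"
    using tendsto_minus by fastforce
  then have "(\<lambda>n. - 1 / of_nat n :: complex) \<longlonglongrightarrow> 0"
    by (simp add: inverse_eq_divide)
  then have "(\<lambda>n. poly ?p (- 1 / of_nat n)) \<longlonglongrightarrow> poly ?p 0"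
    by (rule isCont_tendsto_compose[OF poly_isCont])
  then have "(\<lambda>n. poly ?p (- 1 / of_nat n) * (\<Prod>i=1..r-1. x i ^ w)) \<longlonglongrightarrow> poly ?p 0 * (\<Prod>i=1..r-1. x i ^ w)"
    by (intro tendsto_mult tendsto_const)
  moreover have "(inv_pt r x)(r := 0) = inv_pt r x" by (auto simp: inv_pt_def)
  then have "poly ?p 0 = meval (inv_pt r x) f" by (simp add: p)
  moreover have "\<forall>\<^sub>F n in sequentially. poly ?p (- 1 / of_nat n) * (\<Prod>i=1..r-1. x i ^ w)
      = meval (x(r := of_nat n)) f / of_nat n ^ w"
    using eventually_gt_at_top[of 0]
  proof eventually_elim
    case (elim n)
    let ?x = "x(r := of_nat n)"
    have "{1..r} = insert r {1..r-1}" "r \<notin> {1..r-1}" using r by auto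
    then have "(\<Prod>i=1..r. ?x i ^ w) = of_nat n ^ w * (\<Prod>i=1..r-1. ?x i ^ w)" by simp
    also have "(\<Prod>i=1..r-1. ?x i ^ w) = (\<Prod>i=1..r-1. x i ^ w)"
      using r by (intro prod.cong) auto
    finally have prod: "(\<Prod>i=1..r. ?x i ^ w) = of_nat n ^ w * (\<Prod>i=1..r-1. x i ^ w)" .
    have "(\<lambda>i. - 1 / ?x i) = (inv_pt r x)(r := - 1 / of_nat n)" by (auto simp: inv_pt_def)
    with Sw_invert[OF f, of ?x] x elim prod
    have "meval ?x f = meval ((inv_pt r x)(r := - 1 / of_nat n)) f * (of_nat n ^ w * (\<Prod>i=1..r-1. x i ^ w))"
      by simp
    with elim show ?case by (simp add: p)
  qed
  ultimately show ?thesis by (simp add: tendsto_cong)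
qed

text \<open>Chosen so that \<open>inv_pt r (rec_pt r x)\<close> is \<open>x\<close> translated by
  \<open>- x r\<close> on \<open>{1..r}\<close>. The value 1 elsewhere keeps all coordinates
  nonzero.\<close>

definition rec_pt :: "nat \<Rightarrow> (nat \<Rightarrow> complex) \<Rightarrow> nat \<Rightarrow> complex" where
  "rec_pt r x i = (if i \<in> {1..r-1} then - 1 / (x i - x r) else 1)"

lemma rec_pt:
  assumes "\<And>i. x i \<in> \<real>" "inj_on x {1..r}" "r \<ge> 1"
  shows "rec_pt r x i \<in> \<real>" "rec_pt r x i \<noteq> 0"
proof -
  show "rec_pt r x i \<in> \<real>" using assms(1) by (simp add: rec_pt_def)
  show "rec_pt r x i \<noteq> 0"
  proof (cases "i \<in> {1..r-1}")
    case True
    then have "i \<in> {1..r}" "r \<in> {1..r}" "i \<noteq> r" using assms(3) by auto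
    then have "x i \<noteq> x r" using assms(2) by (meson inj_onD)
    then show ?thesis by (simp add: rec_pt_def)
  qed (auto simp: rec_pt_def)
qed

text \<open>By translation invariance, an element of \<open>Sw w r\<close> is determined by its values at \<open>a\<^sub>r = 0\<close>.\<close>

lemma Sw_recover:
  assumes f: "f \<in> Sw w r" and "\<And>i. x i \<in> \<real>"
  shows "meval (inv_pt r (rec_pt r x)) f = meval x f"
proof -
  have "meval (\<lambda>i. x i + - x r) f = meval x f"
    using assms(2)[of r] by (intro Sw_translate[OF f]) simp
  moreover have "meval (inv_pt r (rec_pt r x)) f = meval (\<lambda>i. x i + - x r) f"
    unfolding meval_def
    by (rule insertion_cong_polys[OF Sw_polys[OF f]]) (auto simp: inv_pt_def rec_pt_def)
  ultimately show ?thesis by simp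
qed

text \<open>The limit yields the coefficient of the power \<open>w\<close>, which is the leading one
  if the degree is \<open>w\<close>. Otherwise that coefficient is 0, hence \<open>f\<close>
  vanishes at every generic point, and both sides are 0.\<close>

lemma meval_star:
  assumes f: "f \<in> Sw w r" and r: "r \<ge> 1" and x: "\<And>i. x i \<in> \<real>" "\<And>i. x i \<noteq> 0"
  shows "meval x (star r f) = meval (inv_pt r x) f * (\<Prod>i=1..r-1. x i ^ w)"
proof -
  let ?L = "\<lambda>x. meval (inv_pt r x) f * (\<Prod>i=1..r-1. x i ^ w)"
  have lim: "(\<lambda>n. meval x (poly (star_poly r f) (Const (of_nat n))) / of_nat n ^ w) \<longlonglongrightarrow> ?L x"
    if "\<And>i. x i \<noteq> 0" for x
    using Sw_limit[OF f r that] by (simp add: meval_star_poly)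
  have deg: "degree (star_poly r f) \<le> w"
    by (rule poly_growth_meval(1)[of "{}" _ _ ?L, OF _ lim]) auto
  have val: "meval x (coeff (star_poly r f) w) = ?L x" if "\<And>i. x i \<in> \<real>" "\<And>i. x i \<noteq> 0" for x
    by (rule poly_growth_meval(2)[of "{}" _ _ ?L, OF _ lim]) (use that in auto)
  have star: "star r f = lead_coeff (star_poly r f)" by (simp add: star_def star_poly_def)
  show ?thesis
  proof (cases "degree (star_poly r f) = w")
    case True
    with val[OF x] star show ?thesis by simp
  next
    case False
    with deg have c0: "coeff (star_poly r f) w = 0" by (simp add: coeff_eq_0)
    have "f = 0"
    proof (rule mpoly_eq_0_generic[of "{1..r}"])
      fix y :: "nat \<Rightarrow> complex" assume y: "\<And>v. y v \<in> \<real>" "inj_on y {1..r}"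
      note rp = rec_pt[OF y r]
      have "?L (rec_pt r y) = 0" using val[OF rp] c0 by simp
      moreover have "(\<Prod>i=1..r-1. rec_pt r y i ^ w) \<noteq> 0" using rp(2) by simp
      ultimately have "meval (inv_pt r (rec_pt r y)) f = 0" by (simp only: mult_eq_0_iff) blast
      then show "meval y f = 0" by (simp add: Sw_recover[OF f y(1)])
    qed simp
    then show ?thesis by (simp add: star_def insertion_def)
  qed
qed

section \<open>Well-definedness and injectivity of the star map on tensor products\<close>

context
  fixes w1 r1 w2 r2 :: nat
  assumes r: "r1 \<ge> 1" "r2 \<ge> 1"
begin

definition tensor_pt :: "(nat + nat \<Rightarrow> complex) \<Rightarrow> nat + nat \<Rightarrow> complex" where
  "tensor_pt z = case_sum (inv_pt r1 (\<lambda>i. z (Inl i))) (inv_pt r2 (\<lambda>i. z (Inr i)))"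

definition tensor_factor :: "(nat + nat \<Rightarrow> complex) \<Rightarrow> complex" where
  "tensor_factor z = (\<Prod>i=1..r1-1. z (Inl i) ^ w1) * (\<Prod>i=1..r2-1. z (Inr i) ^ w2)"

text \<open>The right-hand side depends only on the sum of tensors and not on its decomposition,
  which is what makes \<open>star_tensor\<close> well defined.\<close>

lemma meval_star_sum:
  assumes "\<And>i. i < n \<Longrightarrow> u i \<in> Sw w1 r1 \<and> v i \<in> Sw w2 r2"
    and z: "\<And>i. z i \<in> \<real>" "\<And>i. z i \<noteq> 0"
  shows "meval z (\<Sum>i<n::nat. tensor (star r1 (u i)) (star r2 (v i)))
    = meval (tensor_pt z) (\<Sum>i<n. tensor (u i) (v i)) * tensor_factor z"
  unfolding meval_simps sum_distrib_right
proof (rule sum.cong[OF refl])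
  fix i assume "i \<in> {..<n}"
  then have "u i \<in> Sw w1 r1" "v i \<in> Sw w2 r2" using assms(1) by auto
  then show "meval z (tensor (star r1 (u i)) (star r2 (v i)))
    = meval (tensor_pt z) (tensor (u i) (v i)) * tensor_factor z"
    using r z by (simp add: meval_tensor tensor_pt_def tensor_factor_def meval_star)
qed

lemma star_tensor_eq:
  assumes uv: "\<And>i. i < n \<Longrightarrow> u i \<in> Sw w1 r1 \<and> v i \<in> Sw w2 r2"
  shows "star_tensor w1 r1 w2 r2 (\<Sum>i<n::nat. tensor (u i) (v i))
    = (\<Sum>i<n. tensor (star r1 (u i)) (star r2 (v i)))"
  unfolding star_tensor_def
proof (rule the_equality)
  fix G assume "\<exists>(n'::nat) u' v'. (\<forall>i<n'. u' i \<in> Sw w1 r1 \<and> v' i \<in> Sw w2 r2) \<and>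
     (\<Sum>i<n. tensor (u i) (v i)) = (\<Sum>i<n'. tensor (u' i) (v' i)) \<and>
     G = (\<Sum>i<n'. tensor (star r1 (u' i)) (star r2 (v' i)))"
  then obtain n' :: nat and u' v' where uv': "\<And>i. i < n' \<Longrightarrow> u' i \<in> Sw w1 r1 \<and> v' i \<in> Sw w2 r2"
    and F: "(\<Sum>i<n. tensor (u i) (v i)) = (\<Sum>i<n'. tensor (u' i) (v' i))"
    and G: "G = (\<Sum>i<n'. tensor (star r1 (u' i)) (star r2 (v' i)))" by blast
  show "G = (\<Sum>i<n. tensor (star r1 (u i)) (star r2 (v i)))"
  proof (rule mpoly_eq_generic[of "{}"])
    fix z :: "nat + nat \<Rightarrow> complex" assume z: "\<And>i. z i \<in> \<real>" "\<And>i. z i \<noteq> 0"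
    show "meval z G = meval z (\<Sum>i<n. tensor (star r1 (u i)) (star r2 (v i)))"
      unfolding G using meval_star_sum[of n' u' v' z, OF uv' z] meval_star_sum[of n u v z, OF uv z] F
      by (simp only:)
  qed simp
qed (use uv in blast)

text \<open>\<open>rec_pt\<close> in each factor undoes the inversion up to a translation, so the
  values of the image recover those of \<open>F\<close> at every generic point.\<close>

lemma star_tensor_inj:
  assumes F: "F \<in> Sw_tensor w1 r1 w2 r2" "F' \<in> Sw_tensor w1 r1 w2 r2"
    and eq: "star_tensor w1 r1 w2 r2 F = star_tensor w1 r1 w2 r2 F'"
  shows "F = F'"
proof (rule mpoly_eq_generic[of "Inl ` {1..r1} \<union> Inr ` {1..r2}"])
  fix z :: "nat + nat \<Rightarrow> complex"
  assume z: "\<And>i. z i \<in> \<real>" "inj_on z (Inl ` {1..r1} \<union> Inr ` {1..r2})"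
  define y where "y = case_sum (rec_pt r1 (\<lambda>i. z (Inl i))) (rec_pt r2 (\<lambda>i. z (Inr i)))"
  have inj: "inj_on (\<lambda>i. z (Inl i)) {1..r1}" "inj_on (\<lambda>i. z (Inr i)) {1..r2}"
    using z(2) by (auto simp: inj_on_def)
  have y: "y i \<in> \<real>" "y i \<noteq> 0" for i
    using rec_pt[of "\<lambda>i. z (Inl i)" r1] rec_pt[of "\<lambda>i. z (Inr i)" r2] z(1) inj r
    by (auto simp: y_def split: sum.split)
  have "tensor_factor y \<noteq> 0" using y(2) by (simp add: tensor_factor_def)
  have *: "meval z F = meval y (star_tensor w1 r1 w2 r2 F) / tensor_factor y"
    if F_in: "F \<in> Sw_tensor w1 r1 w2 r2" for F
  proof -
    obtain n :: nat and u v where uv: "\<And>i. i < n \<Longrightarrow> u i \<in> Sw w1 r1 \<and> v i \<in> Sw w2 r2"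
      and F: "F = (\<Sum>i<n. tensor (u i) (v i))"
      using F_in unfolding Sw_tensor_def by blast
    have "meval (tensor_pt y) F = meval z F"
      unfolding F meval_simps
    proof (rule sum.cong[OF refl])
      fix i assume "i \<in> {..<n}"
      then have "u i \<in> Sw w1 r1" "v i \<in> Sw w2 r2" using uv by auto
      then show "meval (tensor_pt y) (tensor (u i) (v i)) = meval z (tensor (u i) (v i))"
        using z(1) by (simp add: meval_tensor tensor_pt_def y_def Sw_recover)
    qed
    then have "meval y (star_tensor w1 r1 w2 r2 F) = meval z F * tensor_factor y"
      using meval_star_sum[of n u v y, OF uv y] star_tensor_eq[of n u v, OF uv] by (simp only: F)
    with \<open>tensor_factor y \<noteq> 0\<close> show ?thesis by simp
  qed
  show "meval z F = meval z F'" using *[OF F(1)] *[OF F(2)] eq by simp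
qed simp

end

section \<open>Star map and translation applied to \<open>Hpoly\<close>\<close>

lemma star_H_at_cong:
  assumes "\<And>i. i \<in> {1..2*g+1} \<Longrightarrow> x i = y i"
  shows "star_H_at g x = star_H_at g y"
proof -
  have "Delta_at {1..2*g+1} x = Delta_at {1..2*g+1} y"
    unfolding Delta_at_def by (rule prod.cong[OF refl]) (use assms in \<open>auto simp: pairs_def\<close>)
  moreover have "psi'_at (2*g+1) p x = psi'_at (2*g+1) p y" if "p \<in> EE (2*g+1)" for p
    unfolding psi'_at_def
  proof (rule prod.cong[OF refl])
    fix i assume i: "i \<in> {1..2*g+1-1}"
    have p: "p permutes {1..2*g+1}" using that by (simp add: EE_def)
    have "i \<in> {1..2*g+1}" "i + 1 \<in> {1..2*g+1}" using i by auto
    then have "p i \<in> {1..2*g+1}" "p (i + 1) \<in> {1..2*g+1}" using permutes_in_image[OF p] by blast+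
    then show "x (p i) - x (p (i + 1)) = y (p i) - y (p (i + 1))" by (simp only: assms)
  qed
  ultimately show ?thesis by (simp add: star_H_at_def cong: sum.cong)
qed

text \<open>A block of one variable has a single sequence and only empty products; hence the second
  factor disappears when just the last variable goes to infinity.\<close>

lemma star_H_at_0: "star_H_at 0 x = 1"
proof -
  have "EE 1 = {id}"
    by (auto simp: EE_def permutes_sing)
  moreover have "pairs {1::nat..1} = {}" by (auto simp: pairs_def)
  ultimately show ?thesis by (simp add: star_H_at_def Delta_at_def psi'_at_def)
qed

lemma meval_star_Hpoly:
  assumes gpos: "g \<ge> 1" and x: "\<And>i. x i \<in> \<real>" "\<And>i. x i \<noteq> 0" "inj_on x {1..2*g+1}"
  shows "meval x (star (2*g+2) (Hpoly g)) = star_H_at g x"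
proof -
  interpret splitting g 0 g "2*g+1" 1 "2*g+2" by unfold_locales simp_all
  \<comment> \<open>Starting the last coordinate at 0 makes \<open>shift ?x n\<close> put exactly
    \<open>n\<close> there; 0 differs from the other coordinates because those are nonzero.\<close>
  let ?r = "2*g+2" and ?x = "x(2*g+2 := 0)"
  have "inj_on ?x {1..?r}"
  proof (rule inj_onI)
    fix i j assume ij: "i \<in> {1..?r}" "j \<in> {1..?r}" "?x i = ?x j"
    show "i = j"
    proof (cases "i = ?r \<or> j = ?r")
      case True then show ?thesis using ij x(2) by (auto split: if_splits)
    next
      case False
      then have "i \<in> {1..2*g+1}" "j \<in> {1..2*g+1}" using ij by auto
      with False ij x(3) show ?thesis by (auto dest: inj_onD)
    qed
  qed
  from meval_Hpoly_tendsto[OF this gpos]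
  have "(\<lambda>n. meval (shift ?x n) (Hpoly g) / of_nat n ^ (4*g)) \<longlonglongrightarrow> star_H_at g ?x * star_H_at 0 (ptail ?x)"
    by simp
  moreover have "meval (shift ?x n) (Hpoly g) = meval (x(?r := of_nat n)) (Hpoly g)" for n
    unfolding meval_def
    by (rule insertion_cong_polys[OF Hpoly_in_polys[OF gpos]]) (unfold shift_def, auto)
  moreover have "star_H_at g ?x = star_H_at g x" by (rule star_H_at_cong) auto
  ultimately have "(\<lambda>n. meval (x(?r := of_nat n)) (Hpoly g) / of_nat n ^ (4*g)) \<longlonglongrightarrow> star_H_at g x"
    by (simp add: star_H_at_0)
  moreover have "(\<lambda>n. meval (x(?r := of_nat n)) (Hpoly g) / of_nat n ^ (4*g))
      \<longlonglongrightarrow> meval x (star ?r (Hpoly g))"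
  proof -
    have "1 \<le> ?r" by simp
    from Sw_limit[OF Hpoly_in_Sw[OF gpos] this x(2)] meval_star[OF Hpoly_in_Sw[OF gpos] this x(1,2)]
    show ?thesis by (simp only:)
  qed
  ultimately show ?thesis by (rule LIMSEQ_unique[rotated])
qed

lemma translate_Hpoly:
  fixes g1 g2 :: nat
  defines "V \<equiv> Inl ` {1..2*g1+1} \<union> Inr ` {1..2*g2+1}"
  assumes gs: "g1 + g2 = g" "g \<ge> 1"
  shows "nu (2*g1+1) (Hpoly g) \<le> 4 * (2*g1*g2 + g1 + g2)"
    and "(\<And>v. z v \<in> \<real>) \<Longrightarrow> (\<And>v. z v \<noteq> 0) \<Longrightarrow> inj_on z V \<Longrightarrow>
      meval z (Tcoeff (4 * (2*g1*g2 + g1 + g2)) (2*g1+1) (Hpoly g))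
        = star_H_at g1 (\<lambda>i. z (Inl i)) * star_H_at g2 (\<lambda>i. z (Inr i))"
proof -
  interpret splitting g1 g2 g "2*g1+1" "2*g2+1" "2*g+2" by unfold_locales (use gs in simp_all)
  let ?P = "translate (2*g1+1) (Hpoly g)" and ?K = "4 * (2*g1*g2 + g1 + g2)"
  have lim: "(\<lambda>n. meval z (poly ?P (Const (of_nat n))) / of_nat n ^ ?K)
      \<longlonglongrightarrow> star_H_at g1 (\<lambda>i. z (Inl i)) * star_H_at g2 (\<lambda>i. z (Inr i))" if z: "inj_on z V" for z
  proof -
    \<comment> \<open>Renames one row of variables to the two families, so that translation becomes
      \<open>shift\<close>.\<close>
    define s where "s = (\<lambda>i. if i \<le> 2*g1+1 then Inl i else Inr (i - (2*g1+1)))"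
    define x where "x = (\<lambda>i. z (s i))"
    have inj_s: "inj_on s {1..2*g+2}" by (rule inj_onI) (auto simp: s_def split: if_splits)
    have sub: "s ` {1..2*g+2} \<subseteq> V" using gs by (auto simp: s_def V_def image_iff)
    have "inj_on x {1..2*g+2}"
      using comp_inj_on[OF inj_s inj_on_subset[OF z sub]] by (simp add: x_def o_def)
    from meval_Hpoly_tendsto[OF this gs(2)]
    have "(\<lambda>n. meval (shift x n) (Hpoly g) / of_nat n ^ ?K) \<longlonglongrightarrow> star_H_at g1 x * star_H_at g2 (ptail x)" .
    moreover have "star_H_at g1 x = star_H_at g1 (\<lambda>i. z (Inl i))"
      by (rule star_H_at_cong) (simp add: x_def s_def)
    moreover have "star_H_at g2 (ptail x) = star_H_at g2 (\<lambda>i. z (Inr i))"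
      by (rule star_H_at_cong) (unfold ptail_def x_def s_def, auto)
    moreover have "meval z (poly ?P (Const (of_nat n))) = meval (shift x n) (Hpoly g)" for n
    proof -
      have "(\<lambda>v. meval z (poly (if v \<le> 2*g1+1 then [:Var (Inl v):] else [:Var (Inr (v - (2*g1+1))), 1:])
          (Const (of_nat n)))) = shift x n"
        by (rule ext) (unfold shift_def x_def s_def, auto)
      then show ?thesis unfolding translate_def meval_poly_insertion by simp
    qed
    ultimately show ?thesis by simp
  qed
  have fin: "finite V" by (simp add: V_def)
  show "nu (2*g1+1) (Hpoly g) \<le> ?K"
    unfolding nu_def by (rule poly_growth_meval(1)[OF fin lim])
  show "meval z (Tcoeff ?K (2*g1+1) (Hpoly g)) = star_H_at g1 (\<lambda>i. z (Inl i)) * star_H_at g2 (\<lambda>i. z (Inr i))"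
    if "\<And>v. z v \<in> \<real>" "\<And>v. z v \<noteq> 0" "inj_on z V"
    unfolding Tcoeff_def by (rule poly_growth_meval(2)[OF fin lim that])
qed

section \<open>Membership in \<open>BB\<close> and the Witt map\<close>

lemma Hpoly_in_BB:
  assumes g: "g \<ge> 1"
  shows "Hpoly g \<in> BB 8 g"
proof -
  have w: "8 * g div 2 = 4 * g" by simp
  have "real (nu (2*g1+1) (Hpoly g)) \<le> real (4*g) / real g * real (2*g1*g2 + g1 + g2)"
    if "g1 + g2 = g" for g1 g2
  proof -
    have "real (nu (2*g1+1) (Hpoly g)) \<le> real (4 * (2*g1*g2 + g1 + g2))"
      using translate_Hpoly(1)[OF that g] by (simp only: of_nat_le_iff)
    also have "\<dots> = real (4*g) / real g * real (2*g1*g2 + g1 + g2)" using g by simp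
    finally show ?thesis .
  qed
  then show ?thesis
    unfolding BB_def Sw0_def mem_Collect_eq w using Hpoly_in_Sw[OF g] perm_act_Hpoly[OF g] by blast
qed

text \<open>The tensor is a candidate for the description because the weights are
  \<open>g1*4\<close> and \<open>g2*4\<close>. Its image under \<open>star_tensor\<close> and the
  translation coefficient have the same generic values, and injectivity of
  \<open>star_tensor\<close> excludes other candidates.\<close>

lemma witt_Hpoly:
  assumes g1: "g1 \<ge> 1" and g2: "g2 \<ge> 1" and g: "g1 + g2 = g"
  shows "witt g1 g2 4 (Hpoly g) = tensor (Hpoly g1) (Hpoly g2)"
proof -
  let ?F = "tensor (Hpoly g1) (Hpoly g2)" and ?K = "4 * (2*g1*g2 + g1 + g2)"
  let ?st = "star_tensor (g1*4) (2*g1+2) (g2*4) (2*g2+2)"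
  have S: "Hpoly g1 \<in> Sw (g1*4) (2*g1+2)" "Hpoly g2 \<in> Sw (g2*4) (2*g2+2)"
    using Hpoly_in_Sw[OF g1] Hpoly_in_Sw[OF g2] by (simp_all add: mult.commute)
  have F: "?F \<in> Sw_tensor (g1*4) (2*g1+2) (g2*4) (2*g2+2)"
    unfolding Sw_tensor_def
    by (rule CollectI, rule exI[of _ 1], rule exI[of _ "\<lambda>_. Hpoly g1"], rule exI[of _ "\<lambda>_. Hpoly g2"])
      (use S in simp)
  have "?st ?F = tensor (star (2*g1+2) (Hpoly g1)) (star (2*g2+2) (Hpoly g2))"
    using star_tensor_eq[of "2*g1+2" "2*g2+2" 1 "\<lambda>_. Hpoly g1" "g1*4" "\<lambda>_. Hpoly g2" "g2*4"] S by simp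
  also have "\<dots> = Tcoeff ?K (2*g1+1) (Hpoly g)"
  proof (rule mpoly_eq_generic[of "Inl ` {1..2*g1+1} \<union> Inr ` {1..2*g2+1}"])
    fix z :: "nat + nat \<Rightarrow> complex"
    assume z: "\<And>v. z v \<in> \<real>" "\<And>v. z v \<noteq> 0" "inj_on z (Inl ` {1..2*g1+1} \<union> Inr ` {1..2*g2+1})"
    have "inj_on (\<lambda>i. z (Inl i)) {1..2*g1+1}" "inj_on (\<lambda>i. z (Inr i)) {1..2*g2+1}"
      using z(3) by (auto simp: inj_on_def)
    with z g1 g2 have "meval (\<lambda>i. z (Inl i)) (star (2*g1+2) (Hpoly g1)) = star_H_at g1 (\<lambda>i. z (Inl i))"
      "meval (\<lambda>i. z (Inr i)) (star (2*g2+2) (Hpoly g2)) = star_H_at g2 (\<lambda>i. z (Inr i))"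
      by (intro meval_star_Hpoly; blast)+
    moreover have "meval z (Tcoeff ?K (2*g1+1) (Hpoly g)) = star_H_at g1 (\<lambda>i. z (Inl i)) * star_H_at g2 (\<lambda>i. z (Inr i))"
      using g1 by (intro translate_Hpoly(2)[OF g _ z]) (simp add: g[symmetric])
    ultimately show "meval z (tensor (star (2*g1+2) (Hpoly g1)) (star (2*g2+2) (Hpoly g2)))
      = meval z (Tcoeff ?K (2*g1+1) (Hpoly g))"
      by (simp only: meval_tensor)
  qed simp
  finally have st: "?st ?F = Tcoeff ?K (2*g1+1) (Hpoly g)" .
  show ?thesis
    unfolding witt_def
  proof (rule the_equality)
    fix F' assume "F' \<in> Sw_tensor (g1*4) (2*g1+2) (g2*4) (2*g2+2) \<and> ?st F' = Tcoeff ?K (2*g1+1) (Hpoly g)"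
    then have F': "F' \<in> Sw_tensor (g1*4) (2*g1+2) (g2*4) (2*g2+2)" and st': "?st F' = ?st ?F"
      by (simp_all only: st)
    show "F' = ?F" by (rule star_tensor_inj[OF _ _ F' F st']) simp_all
  qed (intro conjI F st)
qed

section \<open>The case of four variables\<close>

lemma EE_4: "EE 4 = {id, Transposition.transpose 1 3, Transposition.transpose 2 4,
  Transposition.transpose 1 3 \<circ> Transposition.transpose 2 4}" (is "_ = ?S")
proof (intro equalityI subsetI)
  fix e assume "e \<in> EE 4"
  then have e: "e permutes {1..4}" and par: "\<And>i. i \<in> {1..4} \<Longrightarrow> even (e i) \<longleftrightarrow> even i"
    by (auto simp: EE_def)
  have inj: "inj e" by (rule permutes_inj[OF e])
  have mem: "e i \<in> {1,2,3,4}" if "i \<in> {1..4}" for i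
  proof -
    have "e i \<in> {1..4}" using permutes_in_image[OF e] that by blast
    then show ?thesis by auto
  qed
  have odd: "e 1 = 1 \<or> e 1 = 3" "e 3 = 1 \<or> e 3 = 3"
    using mem[of 1] par[of 1] mem[of 3] par[of 3] by auto
  have even: "e 2 = 2 \<or> e 2 = 4" "e 4 = 2 \<or> e 4 = 4"
    using mem[of 2] par[of 2] mem[of 4] par[of 4] by auto
  have ne: "e 1 \<noteq> e 3" "e 2 \<noteq> e 4" by (simp_all add: inj_eq[OF inj])
  have out: "e i = i" if "i \<noteq> 1" "i \<noteq> 2" "i \<noteq> 3" "i \<noteq> 4" for i
    using that by (intro permutes_not_in[OF e]) auto
  have ext: "e = f" if "e 1 = f 1" "e 2 = f 2" "e 3 = f 3" "e 4 = f 4"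
      "\<And>i. i \<noteq> 1 \<Longrightarrow> i \<noteq> 2 \<Longrightarrow> i \<noteq> 3 \<Longrightarrow> i \<noteq> 4 \<Longrightarrow> f i = i" for f
  proof
    fix i show "e i = f i" using that out[of i] by (cases "i \<in> {1,2,3,4}") auto
  qed
  consider "e 1 = 1" "e 2 = 2" "e 3 = 3" "e 4 = 4" | "e 1 = 3" "e 2 = 2" "e 3 = 1" "e 4 = 4"
    | "e 1 = 1" "e 2 = 4" "e 3 = 3" "e 4 = 2" | "e 1 = 3" "e 2 = 4" "e 3 = 1" "e 4 = 2"
    using odd even ne by metis
  then show "e \<in> ?S"
  proof cases
    case 1 then have "e = id" by (intro ext) auto
    then show ?thesis by simp
  next
    case 2 then have "e = Transposition.transpose 1 3" by (intro ext) (auto simp: Transposition.transpose_def)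
    then show ?thesis by simp
  next
    case 3 then have "e = Transposition.transpose 2 4" by (intro ext) (auto simp: Transposition.transpose_def)
    then show ?thesis by simp
  next
    case 4 then have "e = Transposition.transpose 1 3 \<circ> Transposition.transpose 2 4"
      by (intro ext) (auto simp: Transposition.transpose_def)
    then show ?thesis by simp
  qed
next
  fix e assume e: "e \<in> ?S"
  have "Transposition.transpose 1 3 permutes {1..4::nat}" "Transposition.transpose 2 4 permutes {1..4::nat}"
    by (auto intro!: permutes_swap_id)
  then have "e permutes {1..4}" using e by (auto intro: permutes_compose permutes_id)
  moreover have "even (e i) \<longleftrightarrow> even i" for i
    using e by (auto simp: Transposition.transpose_def split: if_splits)
  ultimately show "e \<in> EE 4" by (simp add: EE_def)
qed

text \<open>The four sequences traverse one 4-cycle up to rotation and reversal, and reversal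
  changes an even number of signs, so all have the same \<open>psi\<close>. Four equal terms cancel
  \<open>1 / 2 * (1 / 2)\<close>; the edges missing from the cycle are the two diagonals
  \<open>Delta (Uset 1)\<close> and \<open>Delta (Uset' 1)\<close>.\<close>

lemma Hpoly_1: "Hpoly 1 = Delta (Bset 1) * Delta (Uset 1) * Delta (Uset' 1)"
proof (rule mpoly_eq_generic[of "Bset 1"])
  fix x :: "nat \<Rightarrow> complex" assume x: "inj_on x (Bset 1)"
  have B: "Bset 1 = {1..4}" by (simp add: Bset_def)
  have U: "Uset 1 = {1, 3}" "Uset' 1 = {2, 4}"
    by (auto simp: Uset_def Uset'_def Bset_def) presburger+
  have set4: "{1..4::nat} = {1, 2, 3, 4}" by auto
  have pairs: "pairs {1..4} = {(2,1), (3,1), (3,2), (4,1), (4,2), (4,3)}" "pairs {1, 3} = {(3, 1)}"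
    "pairs {2, 4} = {(4, 2)}"
    unfolding set4 by (auto simp: pairs_def)
  define D where "D = Delta_at {1..4} x"
  define V where "V = (x 1 - x 2) * (x 2 - x 3) * (x 3 - x 4) * (x 4 - x 1)"
  have psi_at: "psi_at 4 e x = V" if "e \<in> EE 4" for e
  proof -
    have cyc_next: "cyc_next 4 1 = 2" "cyc_next 4 2 = 3" "cyc_next 4 3 = 4" "cyc_next 4 4 = 1" by (simp_all add: cyc_next_def)
    have "psi_at 4 e x = (x (e 1) - x (e 2)) * ((x (e 2) - x (e 3)) * ((x (e 3) - x (e 4)) * (x (e 4) - x (e 1))))"
      unfolding psi_at_def set4 by (simp add: cyc_next del: One_nat_def)
    with that show ?thesis
      unfolding EE_4 by (auto simp: V_def Transposition.transpose_def algebra_simps)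
  qed
  have "psi_at 4 id x \<noteq> 0" using x unfolding B by (intro psi_at_nonzero) (auto simp: permutes_id)
  then have V0: "V \<noteq> 0" using psi_at[of id] by (simp add: EE_4)
  have card: "card (EE 4) = 4"
  proof -
    have "id \<noteq> Transposition.transpose 1 (3::nat)" "id \<noteq> Transposition.transpose 2 (4::nat)"
      "id \<noteq> Transposition.transpose 1 3 \<circ> Transposition.transpose 2 (4::nat)"
      "Transposition.transpose 1 3 \<noteq> Transposition.transpose 2 (4::nat)"
      "Transposition.transpose 1 3 \<noteq> Transposition.transpose 1 3 \<circ> Transposition.transpose 2 (4::nat)"
      "Transposition.transpose 2 4 \<noteq> Transposition.transpose 1 3 \<circ> Transposition.transpose 2 (4::nat)"
      by (auto simp: fun_eq_iff Transposition.transpose_def intro: exI[of _ 1] exI[of _ 2])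
    then show ?thesis unfolding EE_4 by simp
  qed
  have DV: "D = - V * ((x 3 - x 1) * (x 4 - x 2))"
    unfolding D_def Delta_at_def pairs V_def by (simp add: algebra_simps)
  have "meval x (Hpoly 1) = H_at 1 x" by (rule meval_Hpoly[OF _ x]) simp
  also have "\<dots> = 1 / 2 * (1 / 2) * D ^ 2 * (\<Sum>e\<in>EE 4. - 1 / V)"
    unfolding H_at_def B D_def[symmetric] by (simp add: psi_at cong: sum.cong)
  also have "\<dots> = D * ((x 3 - x 1) * (x 4 - x 2))"
    unfolding sum_constant card power2_eq_square using V0 by (simp add: DV)
  also have "\<dots> = meval x (Delta (Bset 1) * Delta (Uset 1) * Delta (Uset' 1))"
    by (simp only: meval_def unital_hom.hom_mult[OF insertion_hom[OF unital_hom_id]]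
        insertion_Delta[OF unital_hom_id] U B D_def[symmetric]) (unfold Delta_at_def pairs, simp)
  finally show "meval x (Hpoly 1) = meval x (Delta (Bset 1) * Delta (Uset 1) * Delta (Uset' 1))" .
qed (simp add: Bset_def)

theorem theorem2p12:
  shows "Hpoly 1 = Delta (Bset 1) * Delta (Uset 1) * Delta (Uset' 1) \<and>
    (\<forall>g\<ge>1.
      Hpoly g \<in> BB 8 g \<and>
      (\<forall>g1 g2. g1 \<ge> 1 \<longrightarrow> g2 \<ge> 1 \<longrightarrow> g1 + g2 = g \<longrightarrow>
         witt g1 g2 4 (Hpoly g) = tensor (Hpoly g1) (Hpoly g2)) \<and>
      (\<Sum>\<sigma> | \<sigma> permutes Bset g. perm_act \<sigma> (Hpoly g)) = 0 \<and>
      (\<forall>i\<in>Bset g. \<forall>j\<in>Bset g. i \<noteq> j \<longrightarrow> Phi g 4 i j (Hpoly g) = 0))"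
  using Hpoly_1 Hpoly_in_BB witt_Hpoly sum_perm_act_Hpoly Phi_Hpoly by blast

end
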